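(* Let $\diamondsuit\in\{\varnothing,\square,\mathrm{v},\mathrm{h}\}$ and let $R=(R_1,\dots,R_k)$ be a sequence of partitions. Put $b_i=\ell(R_i)$. Then $$\mathbb{H}^\diamondsuit_R[X;t]=\sum_{\nu}\sum_{\gamma}t^{|\nu|}\left(\prod_{i=1}^k c^{\,R_i-(a_i^{b_i})}_{\nu^{(i)},\;\gamma^{(i)}-(a_i^{b_i})}\right)\mathbb{B}^\diamondsuit_\gamma[X;t^2],$$ where the first sum is over all sequences $\nu=(\nu^{(1)},\dots,\nu^{(k)})$ of partitions with every $\nu^{(i)}\in\mathcal{P}^\diamondsuit$, $|\nu|=\sum_i|\nu^{(i)}|$, the second sum is over all sequences $\gamma=(\gamma^{(1)},\dots,\gamma^{(k)})$ with $\gamma^{(i)}\in\mathbb{Z}^{b_i}$ weakly decreasing, $a_i=\gamma^{(i)}_{b_i}$ is the last entry of $\gamma^{(i)}$, and $(a_i^{b_i})=(a_i,\dots,a_i)\in\mathbb{Z}^{b_i}$.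
   Context: $\Lambda$ is the ring of symmetric functions in $X=x_1+x_2+\cdots$ (rational coefficients, extended by auxiliary indeterminates as needed), with the scalar product for which Schur functions are orthonormal. Plethystic notation: $P[A]$ is obtained from $P\in\Lambda$ by expressing $P$ in power sums and replacing $p_k$ by $p_k[A]$, where $p_k[A]$ raises every indeterminate in $A$ (including $t$) to the $k$-th power and $p_k[A-B]=p_k[A]-p_k[B]$; $\Omega[A]=\exp(\sum_{k\ge1}p_k[A]/k)$. $P^\perp$ is the operator adjoint to multiplication by $P$ (in the $X$ variables); in particular $\Omega[XA]^\perp P[X]=P[X+A]$. The symbols: $\varnothing$, $\square$ (single cell), $\mathrm{h}$ (horizontal domino), $\mathrm{v}$ (vertical domino). Put $f_\varnothing=0$, $f_\square=s_1+s_{(1^2)}$, $f_{\mathrm{h}}=s_2$, $f_{\mathrm{v}}=s_{(1^2)}$; thus $f_\diamondsuit[tX]$ is $0$, $ts_1[X]+t^2s_{(1^2)}[X]$, $t^2s_2[X]$, $t^2s_{(1^2)}[X]$ respectively. $\mathcal{P}^\varnothing$ consists of the empty partition only, $\mathcal{P}^\square$ is the set of all partitions, $\mathcal{P}^{\mathrm h}$ the partitions all of whose rows have even length, $\mathcal{P}^{\mathrm v}$ the partitions all of whose columns have even length. Bernstein's operators $B_r\in\mathrm{End}(\Lambda)$ are defined by $\sum_{r\in\mathbb{Z}}B_rz^r=\Omega[zX]\,\Omega[-z^{-1}X]^\perp$ (skew, then multiply). For $\nu\in\mathbb{Z}^n$, $B_\nu=B_{\nu_1}\circ\cdots\circ B_{\nu_n}$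 and $B^\diamondsuit_\nu=\Omega[-f_\diamondsuit]^\perp\circ B_\nu\circ\Omega[f_\diamondsuit]^\perp$ (so $B^\varnothing_\nu=B_\nu$). The $t$-analogue of $V\in\mathrm{End}(\Lambda)$ is $\widetilde V(P[X])=V^Y(P[tX+(1-t)Y])|_{Y\to X}$, where $V^Y$ is $V$ acting in a second set of variables $Y$ and afterwards $Y$ is replaced by $X$. Let $\widetilde B_\nu$, $\widetilde B^\diamondsuit_\nu$ be the $t$-analogues of $B_\nu$, $B^\diamondsuit_\nu$, and let $\widetilde B_{\nu,t^2}$ denote $\widetilde B_\nu$ with $t$ replaced by $t^2$. Define $$H^\diamondsuit_\nu=\Omega[f_\diamondsuit[tX]-f_\diamondsuit[X]]^\perp\circ\widetilde B_{\nu,t^2}\circ\Omega[f_\diamondsuit[X]-f_\diamondsuit[tX]]^\perp .$$ A partition $R_i$ is regarded as an element of $\mathbb{Z}^{\ell(R_i)}$, where $\ell(R_i)$ is its number of parts. Put $\mathbb{H}^\diamondsuit_R[X;t]=H^\diamondsuit_{R_1}\cdots H^\diamondsuit_{R_k}1$ and, for a sequence $\gamma$ of integer vectors, $\mathbb{B}^\diamondsuit_\gamma[X;t]=\widetilde B^\diamondsuit_{\gamma^{(1)}}\cdots\widetilde B^\diamondsuit_{\gamma^{(k)}}1$; $\mathbb{B}^\diamondsuit_\gamma[X;t^2]$ is this with $t\mapsto t^2$. $c^{\alpha}_{\beta\delta}$ is the Littlewood–Richardson coefficient (the coefficient of $s_\alpha$ in $s_\beta s_\delta$), taken to be $0$ if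 $\alpha$ is not a partition (i.e. has a negative entry). Only finitely many terms of the sum are nonzero. If some $R_i$ is empty, then $b_i=0$, $\gamma^{(i)}$ and $(a_i^{b_i})$ are the empty vector (no value of $a_i$ is needed), and the operators indexed by the empty vector are the identity. *)

theory Defs
  imports
    "HOL-Library.Poly_Mapping"
    "HOL-Computational_Algebra.Polynomial"
    "HOL-Computational_Algebra.Formal_Power_Series"
    "Jordan_Normal_Form.Determinant"
begin

section \<open>Symmetric functions as polynomials in the power sums\<close>

text \<open>
  Over rational coefficients the power sums \<open>p\<^sub>1, p\<^sub>2, \<dots>\<close> are free polynomial generators of the
  ring of symmetric functions, and plethysm is defined by expansion in them. A symmetric function
  is therefore represented by its expansion in power sums, in the usual representation of
  polynomials as finitely supported maps on exponent vectors. The polynomial variable with index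
  \<open>i\<close> stands for \<open>p\<close> with index \<open>i + 1\<close>, so that there is no spurious \<open>p\<^sub>0\<close>.
\<close>

type_synonym 'a psum_poly = "(nat \<Rightarrow>\<^sub>0 nat) \<Rightarrow>\<^sub>0 'a"

text \<open>The coefficient ring is \<open>\<rat>[t]\<close>.\<close>

type_synonym coeff = "rat poly"

type_synonym sym = "coeff psum_poly"

abbreviation tt :: coeff where "tt \<equiv> monom 1 1"

text \<open>Symmetric functions in two alphabets \<open>X\<close>, \<open>Y\<close>: polynomials in the power sums of \<open>Y\<close> whose
  coefficients are symmetric functions of \<open>X\<close>.\<close>

type_synonym sym2 = "sym psum_poly"

definition const :: "'a::comm_ring_1 \<Rightarrow> 'a psum_poly" where
  "const c = Poly_Mapping.single 0 c"

abbreviation rat_const :: "rat \<Rightarrow> sym" where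
  "rat_const r \<equiv> const [:r:]"

text \<open>Only used for \<open>k \<ge> 1\<close>.\<close>

definition psum :: "nat \<Rightarrow> 'a::comm_ring_1 psum_poly" where
  "psum k = Poly_Mapping.single (Poly_Mapping.single (k - 1) 1) 1"

abbreviation XX :: sym where "XX \<equiv> psum 1"

text \<open>\<open>psubst \<iota> \<phi> P\<close> replaces every \<open>p\<^sub>k\<close> in \<open>P\<close> by \<open>\<phi> k\<close> and every coefficient \<open>c\<close> by \<open>\<iota> c\<close>.\<close>

definition psubst ::
  "('a::comm_ring_1 \<Rightarrow> 'b::comm_ring_1) \<Rightarrow> (nat \<Rightarrow> 'b) \<Rightarrow> 'a psum_poly \<Rightarrow> 'b" where
  "psubst \<iota> \<phi> P =
     (\<Sum>m\<in>Poly_Mapping.keys P. \<iota> (Poly_Mapping.lookup P m) *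
        (\<Prod>i\<in>Poly_Mapping.keys m. \<phi> (Suc i) ^ Poly_Mapping.lookup m i))"

text \<open>\<open>X_part f\<close> and \<open>Y_part f\<close> are \<open>f[X]\<close> and \<open>f[Y]\<close> in two alphabets.\<close>

definition X_part :: "sym \<Rightarrow> sym2" where
  "X_part f = const f"

definition Y_part :: "sym \<Rightarrow> sym2" where
  "Y_part f = psubst (\<lambda>c. X_part (const c)) psum f"

definition Y_to_X :: "sym2 \<Rightarrow> sym" where
  "Y_to_X F = psubst (\<lambda>f. f) psum F"


section \<open>Plethysm\<close>

text \<open>\<open>p\<^sub>k[A]\<close> for \<open>A\<close> in \<open>\<rat>[t]\<close>, in one alphabet and in two alphabets: every indeterminate,
  \<open>t\<close> included, is raised to the \<open>k\<close>-th power; on power sums this is \<open>p\<^sub>m \<mapsto> p\<^sub>k\<^sub>m\<close>.\<close>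

definition adams_coeff :: "nat \<Rightarrow> coeff \<Rightarrow> coeff" where
  "adams_coeff k c = pcompose c (monom 1 k)"

definition adams :: "nat \<Rightarrow> sym \<Rightarrow> sym" where
  "adams k = psubst (\<lambda>c. const (adams_coeff k c)) (\<lambda>m. psum (k * m))"

definition adams2 :: "nat \<Rightarrow> sym2 \<Rightarrow> sym2" where
  "adams2 k = psubst (\<lambda>f. X_part (adams k f)) (\<lambda>m. psum (k * m))"

text \<open>\<open>P[A]\<close>; the coefficients of \<open>P\<close> itself are left alone.\<close>

definition pleth :: "sym \<Rightarrow> sym \<Rightarrow> sym" where
  "pleth P A = psubst const (\<lambda>k. adams k A) P"

definition pleth2 :: "sym \<Rightarrow> sym2 \<Rightarrow> sym2" where
  "pleth2 P A = psubst (\<lambda>c. X_part (const c)) (\<lambda>k. adams2 k A) P"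


section \<open>Grading and the series \<open>\<Omega>[A]\<close>\<close>

definition weight :: "(nat \<Rightarrow>\<^sub>0 nat) \<Rightarrow> nat" where
  "weight m = (\<Sum>i\<in>Poly_Mapping.keys m. Suc i * Poly_Mapping.lookup m i)"

definition sym_degree :: "sym \<Rightarrow> nat" where
  "sym_degree f = Max (insert 0 (weight ` Poly_Mapping.keys f))"

definition homog :: "nat \<Rightarrow> sym \<Rightarrow> sym" where
  "homog n f = (\<Sum>m\<in>{m\<in>Poly_Mapping.keys f. weight m = n}.
                  Poly_Mapping.single m (Poly_Mapping.lookup f m))"

text \<open>
  An element of the completion of the ring by degree is represented by the power series whose
  \<open>n\<close>-th coefficient is its homogeneous component of degree \<open>n\<close>. For \<open>A\<close> without constant term
  \<open>p\<^sub>k[A]\<close> has no component of degree less than \<open>k\<close>, whence the finite inner sum in \<open>log_Omega\<close>.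
\<close>

definition log_Omega :: "sym \<Rightarrow> sym fps" where
  "log_Omega A = Abs_fps (\<lambda>n. \<Sum>k=1..n. rat_const (1 / of_nat k) * homog n (adams k A))"

definition exp_series :: "sym fps" where
  "exp_series = Abs_fps (\<lambda>n. rat_const (1 / fact n))"

definition Omega :: "sym \<Rightarrow> sym fps" where
  "Omega A = fps_compose exp_series (log_Omega A)"


section \<open>Schur functions\<close>

definition is_partition :: "nat list \<Rightarrow> bool" where
  "is_partition \<mu> \<longleftrightarrow> sorted_wrt (\<ge>) \<mu> \<and> 0 \<notin> set \<mu>"

text \<open>\<open>h\<^sub>n\<close>, with \<open>h\<^sub>n = 0\<close> for negative \<open>n\<close>.\<close>

definition complete_sym :: "int \<Rightarrow> sym" where
  "complete_sym n = (if n < 0 then 0 else fps_nth (Omega XX) (nat n))"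

text \<open>The Jacobi--Trudi determinant.\<close>

definition schur :: "nat list \<Rightarrow> sym" where
  "schur \<mu> = det (mat (length \<mu>) (length \<mu>)
                    (\<lambda>(i, j). complete_sym (int (\<mu> ! i) - int i + int j)))"

text \<open>Coefficients of \<open>f\<close> in the basis of Schur functions, indexed by partitions without zero parts.\<close>

definition schur_expansion :: "sym \<Rightarrow> nat list \<Rightarrow>\<^sub>0 coeff" where
  "schur_expansion f =
     (THE c. Poly_Mapping.keys c \<subseteq> {\<mu>. is_partition \<mu>} \<and>
             f = (\<Sum>\<mu>\<in>Poly_Mapping.keys c. const (Poly_Mapping.lookup c \<mu>) * schur \<mu>))"

definition schur_coeff :: "nat list \<Rightarrow> sym \<Rightarrow> coeff" where
  "schur_coeff \<mu> f = Poly_Mapping.lookup (schur_expansion f) \<mu>"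

text \<open>The scalar product for which the Schur functions are orthonormal.\<close>

definition scalar_prod :: "sym \<Rightarrow> sym \<Rightarrow> coeff" where
  "scalar_prod f g =
     (\<Sum>\<mu>\<in>Poly_Mapping.keys (schur_expansion f). schur_coeff \<mu> f * schur_coeff \<mu> g)"

text \<open>The operator adjoint to multiplication by \<open>P\<close>.\<close>

definition perp :: "sym \<Rightarrow> sym \<Rightarrow> sym" where
  "perp P f = (THE g. \<forall>u. scalar_prod g u = scalar_prod f (P * u))"

text \<open>The same for \<open>F\<close> in the completion; components of degree greater than that of \<open>f\<close>
  annihilate \<open>f\<close>.\<close>

definition series_perp :: "sym fps \<Rightarrow> sym \<Rightarrow> sym" where
  "series_perp F f = (\<Sum>n\<le>sym_degree f. perp (fps_nth F n) f)"


section \<open>Littlewood--Richardson coefficients\<close>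

text \<open>Removes trailing zeros of a weakly decreasing vector of nonnegative integers.\<close>

definition strip :: "int list \<Rightarrow> nat list" where
  "strip v = filter (\<lambda>n. n \<noteq> 0) (map nat v)"

text \<open>\<open>LR \<alpha> \<beta> \<delta>\<close> is the coefficient \<open>c\<close> with upper index \<open>\<alpha>\<close> and lower indices \<open>\<beta>\<close>, \<open>\<delta>\<close>. It is
  used for weakly decreasing \<open>\<alpha>\<close>, \<open>\<delta>\<close>, where \<open>\<delta>\<close> has nonnegative entries.\<close>

definition LR :: "int list \<Rightarrow> nat list \<Rightarrow> int list \<Rightarrow> coeff" where
  "LR \<alpha> \<beta> \<delta> =
     (if \<exists>x\<in>set \<alpha>. x < 0 then 0
      else schur_coeff (strip \<alpha>) (schur \<beta> * schur (strip \<delta>)))"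

definition shift_last :: "int list \<Rightarrow> int list \<Rightarrow> int list" where
  "shift_last \<gamma> v = map (\<lambda>x. x - last \<gamma>) v"


section \<open>The four symbols\<close>

datatype symb = Empty | Cell | HDomino | VDomino

fun f_symb :: "symb \<Rightarrow> sym" where
  "f_symb Empty = 0"
| "f_symb Cell = schur [1] + schur [1, 1]"
| "f_symb HDomino = schur [2]"
| "f_symb VDomino = schur [1, 1]"

text \<open>\<open>length (filter (\<lambda>r. j < r) \<mu>)\<close> is the length of the column of \<open>\<mu>\<close> with index \<open>j\<close>.\<close>

fun symb_partitions :: "symb \<Rightarrow> nat list set" where
  "symb_partitions Empty = {[]}"
| "symb_partitions Cell = {\<mu>. is_partition \<mu>}"
| "symb_partitions HDomino = {\<mu>. is_partition \<mu> \<and> (\<forall>r\<in>set \<mu>. even r)}"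
| "symb_partitions VDomino =
     {\<mu>. is_partition \<mu> \<and> (\<forall>j. even (length (filter (\<lambda>r. j < r) \<mu>)))}"


section \<open>Creation operators\<close>

text \<open>\<open>B\<^sub>r\<close> is the coefficient of \<open>z\<^sup>r\<close> in \<open>\<Omega>[zX] \<Omega>[-z\<^sup>-\<^sup>1X]\<^sup>\<bottom>\<close>. As \<open>X\<close> is homogeneous of degree 1,
  the coefficients of \<open>z\<^sup>i\<close> in \<open>\<Omega>[zX]\<close> and of \<open>z\<^sup>-\<^sup>j\<close> in \<open>\<Omega>[-z\<^sup>-\<^sup>1X]\<close> are the homogeneous components
  of degrees \<open>i\<close> and \<open>j\<close> of \<open>\<Omega>[X]\<close> and \<open>\<Omega>[-X]\<close>; the terms with \<open>j\<close> greater than the degree of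
  \<open>P\<close> vanish.\<close>

definition bernstein :: "int \<Rightarrow> sym \<Rightarrow> sym" where
  "bernstein r P =
     (\<Sum>j\<le>sym_degree P. complete_sym (r + int j) * perp (fps_nth (Omega (- XX)) j) P)"

definition B_op :: "int list \<Rightarrow> sym \<Rightarrow> sym" where
  "B_op \<nu> = foldr bernstein \<nu>"

definition B_symb :: "symb \<Rightarrow> int list \<Rightarrow> sym \<Rightarrow> sym" where
  "B_symb d \<nu> = series_perp (Omega (- f_symb d)) \<circ> B_op \<nu> \<circ> series_perp (Omega (f_symb d))"

text \<open>The operator \<open>V\<^sup>Y\<close> for a \<open>\<rat>[t]\<close>-linear operator \<open>V\<close>: it acts on the \<open>Y\<close>-monomials and is linear
  over the symmetric functions of \<open>X\<close>.\<close>

definition act_Y :: "(sym \<Rightarrow> sym) \<Rightarrow> sym2 \<Rightarrow> sym2" where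
  "act_Y V F = (\<Sum>m\<in>Poly_Mapping.keys F.
                  X_part (Poly_Mapping.lookup F m) * Y_part (V (Poly_Mapping.single m 1)))"

text \<open>The \<open>t\<close>-analogue of \<open>V\<close>, with \<open>t\<close> replaced by \<open>q\<close>.\<close>

definition t_analogue :: "coeff \<Rightarrow> (sym \<Rightarrow> sym) \<Rightarrow> sym \<Rightarrow> sym" where
  "t_analogue q V P =
     Y_to_X (act_Y V (pleth2 P (X_part (const q * XX) + Y_part (const (1 - q) * XX))))"

definition H_op :: "symb \<Rightarrow> int list \<Rightarrow> sym \<Rightarrow> sym" where
  "H_op d \<nu> =
     (let f = f_symb d; ft = pleth f (const tt * XX) in
        series_perp (Omega (ft - f)) \<circ> t_analogue (tt ^ 2) (B_op \<nu>) \<circ> series_perp (Omega (f - ft)))"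

definition HH :: "symb \<Rightarrow> nat list list \<Rightarrow> sym" where
  "HH d R = foldr (\<lambda>\<mu>. H_op d (map int \<mu>)) R 1"

text \<open>\<open>BB d \<gamma> q\<close> is the function \<open>\<bbbB>[X; q]\<close>.\<close>

definition BB :: "symb \<Rightarrow> int list list \<Rightarrow> coeff \<Rightarrow> sym" where
  "BB d \<gamma> q = foldr (\<lambda>g. t_analogue q (B_symb d g)) \<gamma> 1"


section \<open>The index sets and the terms of the sum\<close>

definition nu_seqs :: "symb \<Rightarrow> nat list list \<Rightarrow> nat list list set" where
  "nu_seqs d R = {\<nu>. length \<nu> = length R \<and> set \<nu> \<subseteq> symb_partitions d}"

definition gamma_seqs :: "nat list list \<Rightarrow> int list list set" where
  "gamma_seqs R = {\<gamma>. map length \<gamma> = map length R \<and> (\<forall>g\<in>set \<gamma>. sorted_wrt (\<ge>) g)}"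

definition sum_term :: "symb \<Rightarrow> nat list list \<Rightarrow> nat list list \<Rightarrow> int list list \<Rightarrow> sym" where
  "sum_term d R \<nu> \<gamma> =
     const (tt ^ (\<Sum>i<length R. sum_list (\<nu> ! i)) *
            (\<Prod>i<length R. LR (shift_last (\<gamma> ! i) (map int (R ! i))) (\<nu> ! i)
                              (shift_last (\<gamma> ! i) (\<gamma> ! i)))) *
     BB d \<gamma> (tt ^ 2)"

end

theory Submission
  imports Defs
begin

text \<open>
  In the power sum basis \<open>p\<^sub>k\<^sup>\<bottom> = k \<partial>/\<partial>p\<^sub>k\<close>, and an operator on symmetric functions is determined by its
  commutators with multiplication by the \<open>p\<^sub>k\<close> and its value at \<open>1\<close>. This gives the relations between
  Bernstein's operators and their adjoints, from which Schur functions \<open>s\<^sub>\<nu> = B\<^sub>\<nu> 1\<close> are orthonormal for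
  the form with \<open>\<langle>p\<^sub>\<mu>, p\<^sub>\<mu>\<rangle> = z\<^sub>\<mu>\<close>; so the two scalar products agree.

  Since \<open>f\<close> is quadratic in the power sums, \<open>p\<^sub>k\<^sup>\<bottom> \<Omega>[f] = (a p\<^sub>k + b\<^sub>k) \<Omega>[f]\<close> with constants \<open>a\<close>, \<open>b\<^sub>k\<close>. Hence
  the generating series in \<open>Z\<close> of the operators \<open>H\<^sub>\<nu>\<close> and of the \<open>t\<^sup>2\<close>-analogues \<open>V\<^sub>\<nu>\<close> of \<open>B\<^sub>\<nu>\<close> conjugated by
  \<open>\<Omega>[f]\<^sup>\<bottom>\<close> satisfy the same commutation relation
  \<open>W(Z) p\<^sub>k = (p\<^sub>k - (1 - t\<^sup>2\<^sup>k)(p\<^sub>k[Z\<^sup>-\<^sup>1] + a p\<^sub>k[Z])) W(Z)\<close>, and \<open>H(Z) = \<Omega>[f[tZ]] V(Z)\<close> need only be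
  verified at \<open>1\<close>, where it follows from \<open>G\<^sup>\<bottom> B(Z) 1 = G[Z] B(Z) 1\<close>. By Littlewood's identities
  \<open>\<Omega>[f[tZ]]\<close> is the sum of \<open>t\<^sup>|\<^sup>\<lambda>\<^sup>| s\<^sub>\<lambda>[Z]\<close> over the partitions of the given shape, and straightening the
  coefficients of \<open>s\<^sub>\<lambda>[Z] V(Z)\<close> produces the Littlewood--Richardson coefficients.
\<close>

section \<open>Polynomials in the power sums\<close>

text \<open>The parameter is t^2 because f is quadratic: passing to f[tX] multiplies a by t^(2k).
  Conjugating the t^2-analogue of B by the series of f - f[tX] therefore adds the term a - a t^(2k)
  = (1 - t^(2k)) a, and conjugating B by the series of f first and taking the t^2-analogue
  afterwards adds the same term. The constants \<open>b\<^sub>k\<close> cancel between the two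
  conjugating series, so they matter only for the value at 1.

  Two obstacles shape the rest. Each coefficient of \<Omega>[f[tZ]] V(Z) is an infinite sum; it is
  truncated at a degree that depends on the argument and grows by k with each factor
  \<open>p\<^sub>k\<close>. And \<open>B\<^sub>\<gamma> 1\<close> vanishes if a weakly decreasing
  \<gamma> has a negative entry, so values at 1 do not reveal all straightening coefficients.
  Straightening is therefore done once for all alternating families, and the coefficient of \<gamma>
  is read off after subtracting its last entry from all indices. This is the origin of the shifts by
  \<open>a\<^sub>i\<close>.\<close>

lemma const_0 [simp]: "const 0 = 0"
  and const_1 [simp]: "const 1 = 1"
  and const_add: "const (a + b) = const a + const b"
  and const_mult: "const (a * b) = const a * const b"
  and const_minus: "const (- a) = - const a"
  and const_diff: "const (a - b) = const a - const b"
  by (simp_all add: const_def single_add mult_single single_uminus single_diff)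

lemma const_of_nat: "const (of_nat n) = of_nat n"
  by (induction n) (auto simp: const_add)

lemma const_inject [simp]: "const a = const b \<longleftrightarrow> a = b"
  by (metis const_def lookup_single_eq)

lemma lookup_const_mult: "Poly_Mapping.lookup (const c * f) m = c * Poly_Mapping.lookup f m"
proof -
  have "const c * f = Poly_Mapping.map ((*) c) f"
    by (simp add: const_def mult_map_scale_conv_mult)
  then show ?thesis by (simp add: Poly_Mapping.map.rep_eq when_def)
qed

lemma const_ring_hom: "comm_ring_hom (const :: 'a::comm_ring_1 \<Rightarrow> 'a psum_poly)"
  by unfold_locales (auto simp: const_add const_mult)

lemma psum_poly_expand: "f = (\<Sum>m\<in>Poly_Mapping.keys f. Poly_Mapping.single m (Poly_Mapping.lookup f m))"
  by (rule poly_mapping_eqI)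
    (simp add: lookup_sum lookup_single when_def in_keys_iff)

lemma psum_mult_single:
  "psum k * Poly_Mapping.single m c = Poly_Mapping.single (Poly_Mapping.single (k - 1) 1 + m) c"
  by (simp add: psum_def mult_single)

lemma const_mult_single: "const a * Poly_Mapping.single m c = Poly_Mapping.single m (a * c)"
  by (simp add: const_def mult_single)

lemma keys_monom_add: "Poly_Mapping.keys (m + n) = Poly_Mapping.keys m \<union> Poly_Mapping.keys (n :: nat \<Rightarrow>\<^sub>0 nat)"
  by (auto simp: in_keys_iff lookup_add)

lemma weight_superset:
  assumes "finite S" "Poly_Mapping.keys m \<subseteq> S"
  shows "weight m = (\<Sum>i\<in>S. Suc i * Poly_Mapping.lookup m i)"
  unfolding weight_def using assms by (intro sum.mono_neutral_left) (auto simp: in_keys_iff)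

lemma weight_0 [simp]: "weight 0 = 0"
  by (simp add: weight_def)

lemma weight_add: "weight (m + n) = weight m + weight n"
proof -
  let ?S = "Poly_Mapping.keys m \<union> Poly_Mapping.keys n"
  have "weight (m + n) = (\<Sum>i\<in>?S. Suc i * Poly_Mapping.lookup (m + n) i)"
    by (intro weight_superset) (auto simp: keys_monom_add)
  also have "\<dots> = weight m + weight n"
    by (simp add: weight_superset[of ?S m] weight_superset[of ?S n] lookup_add sum.distrib
        add_mult_distrib2)
  finally show ?thesis .
qed

lemma weight_single [simp]: "weight (Poly_Mapping.single i n) = Suc i * n"
  by (auto simp: weight_def)

lemma monom_remove:
  assumes "Poly_Mapping.lookup m i \<noteq> (0::nat)"
  shows "m = Poly_Mapping.single i 1 + (m - Poly_Mapping.single i 1)"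
  using assms by (intro poly_mapping_eqI) (auto simp: lookup_add lookup_minus lookup_single when_def)

lemma monom_induct [case_names zero add]:
  fixes m :: "nat \<Rightarrow>\<^sub>0 nat"
  assumes "P 0" and "\<And>i m. P m \<Longrightarrow> P (Poly_Mapping.single i 1 + m)"
  shows "P m"
proof (induction "weight m" arbitrary: m rule: less_induct)
  case less
  show ?case
  proof (cases "m = 0")
    case False
    then obtain i where i: "Poly_Mapping.lookup m i \<noteq> 0"
      by (metis lookup_zero poly_mapping_eqI)
    let ?n = "m - Poly_Mapping.single i 1"
    have m: "m = Poly_Mapping.single i 1 + ?n" using monom_remove[OF i] .
    have "weight m = Suc i + weight ?n"
      by (subst m) (simp add: weight_add)
    then show ?thesis using less[of ?n] assms(2) m by (metis less_add_same_cancel2 zero_less_Suc)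
  qed (use assms in simp)
qed

text \<open>Turns the comparison of two operators into an induction: in the \<open>psum\<close> case
  \<open>p\<^sub>k\<close> is moved to the left by a commutation rule. Such rules shift indices, so
  the indices are generalised in most of these inductions.\<close>

lemma psum_poly_induct [case_names const add psum]:
  assumes const: "\<And>c. P (const c)"
    and add: "\<And>f g. P f \<Longrightarrow> P g \<Longrightarrow> P (f + g)"
    and psum: "\<And>k f. k \<ge> 1 \<Longrightarrow> P f \<Longrightarrow> P (psum k * f)"
  shows "P f"
proof -
  have single: "P (Poly_Mapping.single m c)" for m c
  proof (induction m rule: monom_induct)
    case zero
    then show ?case using const[of c] by (simp add: const_def)
  next
    case (add i m)
    then show ?case using psum[of "Suc i" "Poly_Mapping.single m c"] by (simp add: psum_mult_single)
  qed
  have "P (\<Sum>m\<in>A. Poly_Mapping.single m (Poly_Mapping.lookup f m))" if "finite A" for A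
    using that by induction (use const[of 0] in \<open>auto intro: add single\<close>)
  then show ?thesis by (subst psum_poly_expand) auto
qed

definition monom_eval :: "(nat \<Rightarrow> 'b::comm_ring_1) \<Rightarrow> (nat \<Rightarrow>\<^sub>0 nat) \<Rightarrow> 'b" where
  "monom_eval \<phi> m = (\<Prod>i\<in>Poly_Mapping.keys m. \<phi> (Suc i) ^ Poly_Mapping.lookup m i)"

lemma monom_eval_superset:
  assumes "finite S" "Poly_Mapping.keys m \<subseteq> S"
  shows "monom_eval \<phi> m = (\<Prod>i\<in>S. \<phi> (Suc i) ^ Poly_Mapping.lookup m i)"
  unfolding monom_eval_def using assms by (intro prod.mono_neutral_left) (auto simp: in_keys_iff)

lemma monom_eval_add: "monom_eval \<phi> (m + n) = monom_eval \<phi> m * monom_eval \<phi> n"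
proof -
  let ?S = "Poly_Mapping.keys m \<union> Poly_Mapping.keys n"
  have "monom_eval \<phi> (m + n) = (\<Prod>i\<in>?S. \<phi> (Suc i) ^ Poly_Mapping.lookup (m + n) i)"
    by (intro monom_eval_superset) (auto simp: keys_monom_add)
  also have "\<dots> = monom_eval \<phi> m * monom_eval \<phi> n"
    by (simp add: monom_eval_superset[of ?S m] monom_eval_superset[of ?S n] lookup_add prod.distrib
        power_add)
  finally show ?thesis .
qed

lemma monom_eval_0 [simp]: "monom_eval \<phi> 0 = 1"
  by (simp add: monom_eval_def)

lemma monom_eval_single [simp]: "monom_eval \<phi> (Poly_Mapping.single i 1) = \<phi> (Suc i)"
  by (simp add: monom_eval_def)

lemma psubst_eq: "psubst \<iota> \<phi> f = (\<Sum>m\<in>Poly_Mapping.keys f. \<iota> (Poly_Mapping.lookup f m) * monom_eval \<phi> m)"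
  by (simp add: psubst_def monom_eval_def)

context
  fixes \<iota> :: "'a::comm_ring_1 \<Rightarrow> 'b::comm_ring_1" and \<phi> :: "nat \<Rightarrow> 'b"
  assumes hom: "comm_ring_hom \<iota>"
begin

interpretation comm_ring_hom \<iota> by (rule hom)

lemma psubst_0 [simp]: "psubst \<iota> \<phi> 0 = 0"
  by (simp add: psubst_eq)

lemma psubst_add: "psubst \<iota> \<phi> (f + g) = psubst \<iota> \<phi> f + psubst \<iota> \<phi> g"
  unfolding psubst_eq
  by (rule setsum_keys_plus_distrib) (auto simp: hom_add distrib_right)

lemma psubst_single: "psubst \<iota> \<phi> (Poly_Mapping.single m c) = \<iota> c * monom_eval \<phi> m"
  by (cases "c = 0") (auto simp: psubst_eq)

lemma psubst_const: "psubst \<iota> \<phi> (const c) = \<iota> c"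
  by (simp add: const_def psubst_single)

lemma psubst_psum_mult:
  assumes "k \<ge> 1"
  shows "psubst \<iota> \<phi> (psum k * f) = \<phi> k * psubst \<iota> \<phi> f"
proof -
  have *: "psubst \<iota> \<phi> (psum k * Poly_Mapping.single m c) = \<phi> k * psubst \<iota> \<phi> (Poly_Mapping.single m c)" for m c
    using assms by (simp add: psum_mult_single psubst_single monom_eval_add mult_ac
      monom_eval_single[unfolded One_nat_def])
  have "psubst \<iota> \<phi> (psum k * (\<Sum>m\<in>A. Poly_Mapping.single m (h m))) = \<phi> k * psubst \<iota> \<phi> (\<Sum>m\<in>A. Poly_Mapping.single m (h m))"
    if "finite A" for A h
    using that by induction (auto simp: distrib_left psubst_add *)
  then show ?thesis using psum_poly_expand[of f] by (metis finite_keys)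
qed

lemma psubst_const_mult: "psubst \<iota> \<phi> (const c * f) = \<iota> c * psubst \<iota> \<phi> f"
proof -
  have *: "psubst \<iota> \<phi> (const c * Poly_Mapping.single m a) = \<iota> c * psubst \<iota> \<phi> (Poly_Mapping.single m a)" for m a
    by (simp add: const_mult_single psubst_single hom_mult mult_ac)
  have "psubst \<iota> \<phi> (const c * (\<Sum>m\<in>A. Poly_Mapping.single m (h m))) = \<iota> c * psubst \<iota> \<phi> (\<Sum>m\<in>A. Poly_Mapping.single m (h m))"
    if "finite A" for A h
    using that by induction (auto simp: distrib_left psubst_add *)
  then show ?thesis using psum_poly_expand[of f] by (metis finite_keys)
qed

lemma psubst_mult: "psubst \<iota> \<phi> (f * g) = psubst \<iota> \<phi> f * psubst \<iota> \<phi> g"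
  by (induction f rule: psum_poly_induct)
    (simp_all add: psubst_const_mult psubst_const psubst_add psubst_psum_mult distrib_right mult.assoc)

lemma psubst_1: "psubst \<iota> \<phi> 1 = 1"
  using psubst_const[of 1] by simp

lemma psubst_hom: "comm_ring_hom (psubst \<iota> \<phi>)"
  by unfold_locales (auto simp: psubst_add psubst_mult psubst_1)

lemma psubst_psum: "k \<ge> 1 \<Longrightarrow> psubst \<iota> \<phi> (psum k) = \<phi> k"
  using psubst_psum_mult[of k 1] by (simp add: psubst_1)

end

section \<open>The derivations dual to multiplication by power sums\<close>

text \<open>The operator k times the partial derivative by \<open>p\<^sub>k\<close>. The subtraction
  of exponents is truncated only where \<open>p\<^sub>k\<close> does not occur in the monomial, and
  there the factor is 0.\<close>

definition D :: "nat \<Rightarrow> 'a::comm_ring_1 psum_poly \<Rightarrow> 'a psum_poly" where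
  "D k f = (\<Sum>m\<in>Poly_Mapping.keys f. Poly_Mapping.single (m - Poly_Mapping.single (k - 1) 1)
                (of_nat (k * Poly_Mapping.lookup m (k - 1)) * Poly_Mapping.lookup f m))"

lemma D_0 [simp]: "D k 0 = 0"
  by (simp add: D_def)

lemma D_add: "D k (f + g) = D k f + D k g"
  unfolding D_def by (rule setsum_keys_plus_distrib) (auto simp: distrib_left single_add)

lemma D_single: "D k (Poly_Mapping.single m c) =
  Poly_Mapping.single (m - Poly_Mapping.single (k - 1) 1) (of_nat (k * Poly_Mapping.lookup m (k - 1)) * c)"
  by (cases "c = 0") (auto simp: D_def)

lemma additive_single_induct:
  fixes F G :: "'a::comm_ring_1 psum_poly \<Rightarrow> 'b::comm_ring_1"
  assumes add: "\<And>x y. F (x + y) = F x + F y" and add': "\<And>x y. G (x + y) = G x + G y"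
    and "F 0 = 0" "G 0 = 0"
    and single: "\<And>m c. F (Poly_Mapping.single m c) = G (Poly_Mapping.single m c)"
  shows "F f = G f"
proof -
  have "F (\<Sum>m\<in>A. Poly_Mapping.single m (h m)) = G (\<Sum>m\<in>A. Poly_Mapping.single m (h m))"
    if "finite A" for A h
    using that by induction (auto simp: assms)
  then show ?thesis using psum_poly_expand[of f] by (metis finite_keys)
qed

lemma D_const_mult: "D k (const c * f) = const c * D k f"
  by (rule additive_single_induct[of "\<lambda>f. D k (const c * f)" "\<lambda>f. const c * D k f"])
    (auto simp: D_add distrib_left D_single const_mult_single mult_ac)

lemma D_const [simp]: "D k (const c) = 0"
  by (simp add: const_def D_single)

lemma D_1 [simp]: "D k 1 = 0"
  using D_const[of k 1] by simp

lemma D_psum_mult: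
  assumes "k \<ge> 1" "j \<ge> 1"
  shows "D k (psum j * f) = (if j = k then of_nat k * f else 0) + psum j * D k f"
proof (rule additive_single_induct[of "\<lambda>f. D k (psum j * f)" "\<lambda>f. (if j = k then of_nat k * f else 0) + psum j * D k f"])
  fix m :: "nat \<Rightarrow>\<^sub>0 nat" and c :: 'a
  let ?s = "\<lambda>i. Poly_Mapping.single i (1::nat)"
  show "D k (psum j * Poly_Mapping.single m c) = (if j = k then of_nat k * Poly_Mapping.single m c else 0) + psum j * D k (Poly_Mapping.single m c)"
  proof (cases "j = k")
    case True
    have 1: "?s (k-1) + (m - ?s (k-1)) = m" if "Poly_Mapping.lookup m (k-1) \<noteq> 0"
      using monom_remove[OF that] by simp
    have 2: "of_nat k * Poly_Mapping.single m c = Poly_Mapping.single m (of_nat k * c)"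
      using const_mult_single[of "of_nat k" m c] by (simp add: const_of_nat)
    show ?thesis
    proof (cases "Poly_Mapping.lookup m (k-1) = 0")
      case True
      then show ?thesis using \<open>j = k\<close>
        by (simp add: psum_mult_single D_single lookup_add 2)
    next
      case False
      then show ?thesis using \<open>j = k\<close> 1
        by (simp add: psum_mult_single D_single lookup_add 2 single_add[symmetric] algebra_simps)
    qed
  next
    case False
    then have ne: "j - 1 \<noteq> k - 1" using assms by auto
    have 1: "?s (j-1) + m - ?s (k-1) = ?s (j-1) + (m - ?s (k-1))" if "Poly_Mapping.lookup m (k-1) \<noteq> 0"
      using that ne by (intro poly_mapping_eqI) (auto simp: lookup_add lookup_minus lookup_single when_def)
    show ?thesis
    proof (cases "Poly_Mapping.lookup m (k-1) = 0")
      case True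
      then show ?thesis using False ne
        by (simp add: psum_mult_single D_single lookup_add lookup_single)
    next
      case f2: False
      then show ?thesis using False ne 1
        by (simp add: psum_mult_single D_single lookup_add lookup_single)
    qed
  qed
qed (auto simp: D_add algebra_simps)

lemma D_mult: "k \<ge> 1 \<Longrightarrow> D k (f * g) = D k f * g + f * D k g"
proof (induction f rule: psum_poly_induct)
  case (psum j f)
  then show ?case
    by (simp add: mult.assoc[of "psum k"] D_psum_mult distrib_left distrib_right if_distribR mult.assoc
        split: if_splits)
qed (simp_all add: D_const_mult D_add distrib_right)

lemma D_psum: "k \<ge> 1 \<Longrightarrow> j \<ge> 1 \<Longrightarrow> D k (psum j) = (if j = k then of_nat k else 0)"
  using D_psum_mult[of k j 1] by auto

lemma D_uminus: "D k (- f) = - D k f"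
  using D_add[of k f "-f"] by (metis D_0 add.right_inverse neg_eq_iff_add_eq_0)

lemma D_diff: "D k (f - g) = D k f - D k g"
  using D_add[of k f "-g"] by (simp add: D_uminus)

lemma D_sum: "D k (\<Sum>i\<in>A. f i) = (\<Sum>i\<in>A. D k (f i))"
  by (induction A rule: infinite_finite_induct) (auto simp: D_add)

section \<open>The form with orthogonal power sums\<close>

definition zfac :: "(nat \<Rightarrow>\<^sub>0 nat) \<Rightarrow> nat" where
  "zfac m = (\<Prod>i\<in>Poly_Mapping.keys m. Suc i ^ Poly_Mapping.lookup m i * fact (Poly_Mapping.lookup m i))"

lemma zfac_superset:
  assumes "finite S" "Poly_Mapping.keys m \<subseteq> S"
  shows "zfac m = (\<Prod>i\<in>S. Suc i ^ Poly_Mapping.lookup m i * fact (Poly_Mapping.lookup m i))"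
  unfolding zfac_def using assms by (intro prod.mono_neutral_left) (auto simp: in_keys_iff)

lemma zfac_pos: "zfac m \<noteq> 0"
  by (simp add: zfac_def)

lemma zfac_0 [simp]: "zfac 0 = 1"
  by (simp add: zfac_def)

lemma zfac_single_add:
  "zfac (Poly_Mapping.single i 1 + m) = Suc i * Suc (Poly_Mapping.lookup m i) * zfac m"
proof -
  let ?S = "insert i (Poly_Mapping.keys m)" and ?R = "Poly_Mapping.keys m - {i}"
  let ?F = "\<lambda>m j. Suc j ^ Poly_Mapping.lookup m j * fact (Poly_Mapping.lookup m j) :: nat"
  have split: "(\<Prod>j\<in>?S. g j) = g i * (\<Prod>j\<in>?R. g j)" for g :: "nat \<Rightarrow> nat"
    by (simp add: prod.insert_remove)
  have 1: "zfac (Poly_Mapping.single i 1 + m) = (\<Prod>j\<in>?S. ?F (Poly_Mapping.single i 1 + m) j)"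
    by (intro zfac_superset) (auto simp: keys_monom_add)
  have 2: "zfac m = (\<Prod>j\<in>?S. ?F m j)"
    by (intro zfac_superset) auto
  have 3: "(\<Prod>j\<in>?R. ?F (Poly_Mapping.single i 1 + m) j) = (\<Prod>j\<in>?R. ?F m j)"
    by (intro prod.cong) (auto simp: lookup_add lookup_single when_def)
  have 4: "?F (Poly_Mapping.single i 1 + m) i = Suc i * Suc (Poly_Mapping.lookup m i) * ?F m i"
    by (simp only: lookup_add lookup_single_eq plus_1_eq_Suc power_Suc fact_Suc of_nat_id mult_ac)
  show ?thesis unfolding 1 2 split 3 4 by (simp only: mult_ac)
qed

definition form :: "sym \<Rightarrow> sym \<Rightarrow> coeff" where
  "form f g = (\<Sum>m\<in>Poly_Mapping.keys f. of_nat (zfac m) * Poly_Mapping.lookup f m * Poly_Mapping.lookup g m)"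

lemma form_add_left: "form (f + g) h = form f h + form g h"
  unfolding form_def by (rule setsum_keys_plus_distrib) (auto simp: algebra_simps)

lemma form_0_left [simp]: "form 0 h = 0"
  by (simp add: form_def)

lemma form_single_left: "form (Poly_Mapping.single m c) g = of_nat (zfac m) * c * Poly_Mapping.lookup g m"
  by (cases "c = 0") (auto simp: form_def)

lemma form_sym: "form f g = form g f"
proof -
  have "form f g = (\<Sum>m\<in>Poly_Mapping.keys f \<inter> Poly_Mapping.keys g. of_nat (zfac m) * Poly_Mapping.lookup f m * Poly_Mapping.lookup g m)" for f g
    unfolding form_def by (intro sum.mono_neutral_right) (auto simp: in_keys_iff)
  from this[of f g] this[of g f] show ?thesis by (simp add: Int_commute mult_ac)
qed

lemma form_add_right: "form h (f + g) = form h f + form h g"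
  using form_add_left form_sym by metis

lemma form_0_right [simp]: "form h 0 = 0"
  using form_0_left form_sym by metis

lemma form_const_left: "form (const c * f) g = c * form f g"
  by (rule additive_single_induct[of "\<lambda>f. form (const c * f) g" "\<lambda>f. c * form f g"])
    (auto simp: distrib_left form_add_left const_mult_single form_single_left)

lemma form_const_right: "form f (const c * g) = c * form f g"
  using form_const_left form_sym by metis

lemma form_sum_left: "form (\<Sum>i\<in>A. f i) g = (\<Sum>i\<in>A. form (f i) g)"
  by (induction A rule: infinite_finite_induct) (auto simp: form_add_left)

lemma form_sum_right: "form g (\<Sum>i\<in>A. f i) = (\<Sum>i\<in>A. form g (f i))"
  by (induction A rule: infinite_finite_induct) (auto simp: form_add_right)

lemma form_nondegenerate:
  assumes "\<And>u. form f u = form g u"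
  shows "f = g"
proof (rule poly_mapping_eqI)
  fix m
  have "of_nat (zfac m) * Poly_Mapping.lookup f m = of_nat (zfac m) * Poly_Mapping.lookup g m"
    using assms[of "Poly_Mapping.single m 1"]
    by (simp add: form_sym[of _ "Poly_Mapping.single m 1"] form_single_left)
  then show "Poly_Mapping.lookup f m = Poly_Mapping.lookup g m"
    using zfac_pos[of m] by simp
qed

lemma form_D:
  assumes "k \<ge> 1"
  shows "form (D k f) g = form f (psum k * g)"
proof (rule additive_single_induct[of "\<lambda>f. form (D k f) g" "\<lambda>f. form f (psum k * g)"])
  fix m c
  let ?e = "Poly_Mapping.single (k - 1) (1::nat)"
  show "form (D k (Poly_Mapping.single m c)) g = form (Poly_Mapping.single m c) (psum k * g)"
  proof (rule additive_single_induct[of "\<lambda>g. form (D k (Poly_Mapping.single m c)) g" "\<lambda>g. form (Poly_Mapping.single m c) (psum k * g)"])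
    fix n b
    show "form (D k (Poly_Mapping.single m c)) (Poly_Mapping.single n b) =
      form (Poly_Mapping.single m c) (psum k * Poly_Mapping.single n b)"
    proof (cases "Poly_Mapping.lookup m (k - 1) = 0")
      case True
      then have "m \<noteq> ?e + n" by (auto simp: lookup_add)
      then show ?thesis using True
        by (simp add: D_single psum_mult_single form_single_left lookup_single when_def)
    next
      case False
      then have m: "m = ?e + (m - ?e)" by (rule monom_remove)
      then have eq: "?e + n = m \<longleftrightarrow> n = m - ?e" by (metis add_left_cancel)
      \<comment> \<open>Removing one \<open>p\<^sub>k\<close> divides z by k times the multiplicity,
        which is the coefficient produced by \<open>D k\<close>.\<close>
      have z: "zfac m = k * Poly_Mapping.lookup m (k - 1) * zfac (m - ?e)"
        using zfac_single_add[of "k - 1" "m - ?e"] False assms m[symmetric]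
        by (cases "Poly_Mapping.lookup m (k - 1)") (simp_all add: lookup_minus)
      show ?thesis
        unfolding D_single psum_mult_single form_single_left lookup_single z when_def eq
        by auto
    qed
  qed (auto simp: form_add_right distrib_left)
qed (auto simp: form_add_left D_add)

section \<open>Skewing\<close>

text \<open>The adjoint for \<open>form\<close>. The given \<open>perp\<close> refers to Schur
  expansions and can be replaced by it only after the two scalar products are identified in
  \<open>scalar_prod_eq_form\<close>.\<close>

definition skew :: "sym \<Rightarrow> sym \<Rightarrow> sym" where
  "skew F P = (THE g. \<forall>u. form g u = form P (F * u))"

text \<open>In infinite dimension an adjoint has to be exhibited. It is built along the generators:
  a constant is its own adjoint, and \<open>p\<^sub>k\<close> contributes
  \<open>D k\<close>.\<close>

lemma skew_exists: "\<exists>g. \<forall>u. form g u = form P (F * u)"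
proof (induction F rule: psum_poly_induct)
  case (const c)
  then show ?case by (intro exI[of _ "const c * P"]) (simp add: form_const_left form_const_right)
next
  case (add f g)
  then obtain a b where "\<forall>u. form a u = form P (f * u)" "\<forall>u. form b u = form P (g * u)" by blast
  then show ?case by (intro exI[of _ "a + b"]) (simp add: form_add_left form_add_right distrib_right)
next
  case (psum k f)
  then obtain a where "\<forall>u. form a u = form P (f * u)" by blast
  with psum show ?case by (intro exI[of _ "D k a"]) (simp add: form_D mult_ac)
qed

lemma form_skew: "form (skew F P) u = form P (F * u)"
proof -
  have "\<exists>!g. \<forall>u. form g u = form P (F * u)"
    using skew_exists[of P F] form_nondegenerate by metis
  from theI'[OF this] show ?thesis by (simp add: skew_def)
qed

lemma skew_eqI: "(\<And>u. form g u = form P (F * u)) \<Longrightarrow> skew F P = g"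
  by (rule form_nondegenerate) (simp add: form_skew)

lemma skew_add: "skew F (P + Q) = skew F P + skew F Q"
  by (rule skew_eqI) (simp add: form_add_left form_skew)

lemma skew_add_left: "skew (F + G) P = skew F P + skew G P"
  by (rule skew_eqI) (simp add: form_add_left form_add_right distrib_right form_skew)

lemma skew_const_mult: "skew F (const c * P) = const c * skew F P"
  by (rule skew_eqI) (simp add: form_const_left form_skew)

lemma skew_const_mult_left: "skew (const c * F) P = const c * skew F P"
  by (rule skew_eqI) (simp add: form_const_left form_const_right form_skew mult.assoc)

lemma skew_mult: "skew (F * G) P = skew F (skew G P)"
  by (rule skew_eqI) (simp add: form_skew mult_ac)

lemma skew_commute: "skew F (skew G P) = skew G (skew F P)"
  by (simp add: skew_mult[symmetric] mult.commute)

lemma skew_psum: "k \<ge> 1 \<Longrightarrow> skew (psum k) P = D k P"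
  by (rule skew_eqI) (simp add: form_D)

lemma skew_1 [simp]: "skew 1 P = P"
  by (rule skew_eqI) simp

lemma skew_0 [simp]: "skew F 0 = 0"
  by (rule skew_eqI) simp

lemma skew_0_left [simp]: "skew 0 P = 0"
  by (rule skew_eqI) simp

lemma skew_const [simp]: "skew (const c) P = const c * P"
  using skew_const_mult_left[of c 1 P] by simp

lemma skew_uminus: "skew F (- P) = - skew F P"
  using skew_const_mult[of F "-1" P] by (simp add: const_minus)

lemma skew_uminus_left: "skew (- F) P = - skew F P"
  using skew_const_mult_left[of "-1" F P] by (simp add: const_minus)

lemma skew_sum: "skew F (\<Sum>i\<in>A. f i) = (\<Sum>i\<in>A. skew F (f i))"
  by (induction A rule: infinite_finite_induct) (auto simp: skew_add)

lemma skew_sum_left: "skew (\<Sum>i\<in>A. f i) P = (\<Sum>i\<in>A. skew (f i) P)"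
  by (induction A rule: infinite_finite_induct) (auto simp: skew_add_left)

lemma D_skew: "k \<ge> 1 \<Longrightarrow> D k (skew F P) = skew F (D k P)"
  by (simp add: skew_psum[symmetric] skew_commute[of "psum k"])

text \<open>The Leibniz rule for \<open>D k\<close> read through the form: its adjoint,
  multiplication by \<open>p\<^sub>k\<close>, commutes with skewing by G up to skewing by
  \<open>D k G\<close>.\<close>

lemma skew_psum_mult: "k \<ge> 1 \<Longrightarrow> skew G (psum k * P) = psum k * skew G P + skew (D k G) P"
proof (rule skew_eqI)
  fix u assume k: "k \<ge> 1"
  have "form (psum k * P) (G * u) = form P (D k (G * u))"
    using form_D[OF k, of "G * u" P] form_sym by metis
  also have "\<dots> = form P (D k G * u) + form P (G * D k u)"
    using k by (simp add: D_mult form_add_right)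
  also have "form P (G * D k u) = form (psum k * skew G P) u"
    using form_D[OF k, of u "skew G P"] form_sym form_skew by metis
  finally show "form (psum k * skew G P + skew (D k G) P) u = form (psum k * P) (G * u)"
    by (simp add: form_add_left form_skew)
qed

section \<open>The grading\<close>

text \<open>The bound is an integer: a negative one forces f = 0, so bounds can be shifted by
  arbitrary indices r without case distinctions.\<close>

definition dle :: "int \<Rightarrow> 'a::zero psum_poly \<Rightarrow> bool" where
  "dle N f \<longleftrightarrow> (\<forall>m\<in>Poly_Mapping.keys f. int (weight m) \<le> N)"

definition homogeneous :: "nat \<Rightarrow> 'a::zero psum_poly \<Rightarrow> bool" where
  "homogeneous n f \<longleftrightarrow> (\<forall>m\<in>Poly_Mapping.keys f. weight m = n)"

lemma dle_sym_degree: "dle (int (sym_degree f)) f"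
  unfolding dle_def sym_degree_def by (auto intro!: Max_ge)

lemma dle_mono: "dle N f \<Longrightarrow> N \<le> M \<Longrightarrow> dle M f"
  by (force simp: dle_def)

lemma dle_neg: "dle N f \<Longrightarrow> N < 0 \<Longrightarrow> f = 0"
  by (rule poly_mapping_eqI) (force simp: dle_def in_keys_iff)

lemma dle_0 [simp]: "dle N 0"
  by (simp add: dle_def)

lemma dle_add: "dle N f \<Longrightarrow> dle N g \<Longrightarrow> dle N (f + g)"
  using keys_add[of f g] by (auto simp: dle_def)

lemma dle_sum: "(\<And>i. i \<in> A \<Longrightarrow> dle N (f i)) \<Longrightarrow> dle N (\<Sum>i\<in>A. f i)"
  by (induction A rule: infinite_finite_induct) (auto intro: dle_add)

lemma dle_mult:
  fixes f g :: "'a::comm_ring_1 psum_poly"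
  assumes "dle N f" "dle M g"
  shows "dle (N + M) (f * g)"
  unfolding dle_def
proof
  fix m assume "m \<in> Poly_Mapping.keys (f * g)"
  then obtain a b where "m = a + b" "a \<in> Poly_Mapping.keys f" "b \<in> Poly_Mapping.keys g"
    using keys_mult[of f g] by blast
  then show "int (weight m) \<le> N + M" using assms by (fastforce simp: dle_def weight_add)
qed

lemma homogeneous_dle: "homogeneous n f \<Longrightarrow> dle (int n) f"
  by (simp add: homogeneous_def dle_def)

lemma homogeneous_0 [simp]: "homogeneous n 0"
  by (simp add: homogeneous_def)

lemma homogeneous_add: "homogeneous n f \<Longrightarrow> homogeneous n g \<Longrightarrow> homogeneous n (f + g)"
  using keys_add[of f g] by (auto simp: homogeneous_def)

lemma homogeneous_sum: "(\<And>i. i \<in> A \<Longrightarrow> homogeneous n (f i)) \<Longrightarrow> homogeneous n (\<Sum>i\<in>A. f i)"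
  by (induction A rule: infinite_finite_induct) (auto intro: homogeneous_add)

lemma homogeneous_mult:
  fixes f g :: "'a::comm_ring_1 psum_poly"
  assumes "homogeneous n f" "homogeneous k g"
  shows "homogeneous (n + k) (f * g)"
  unfolding homogeneous_def
proof
  fix m assume "m \<in> Poly_Mapping.keys (f * g)"
  then obtain a b where "m = a + b" "a \<in> Poly_Mapping.keys f" "b \<in> Poly_Mapping.keys g"
    using keys_mult[of f g] by blast
  then show "weight m = n + k" using assms by (auto simp: homogeneous_def weight_add)
qed

lemma homogeneous_const [simp]: "homogeneous 0 (const c)"
  by (auto simp: homogeneous_def const_def)

lemma homogeneous_1 [simp]: "homogeneous 0 (1 :: 'a::comm_ring_1 psum_poly)"
  using homogeneous_const[of "1 :: 'a"] by simp

lemma homogeneous_const_mult: "homogeneous n f \<Longrightarrow> homogeneous n (const c * f)"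
  using homogeneous_mult[OF homogeneous_const] by fastforce

lemma homogeneous_of_nat_mult_cancel:
  fixes f :: "'a::{idom,ring_char_0} psum_poly"
  assumes "homogeneous n (of_nat k * f)" "k \<noteq> 0"
  shows "homogeneous n f"
proof -
  have "Poly_Mapping.lookup (of_nat k * f) m = of_nat k * Poly_Mapping.lookup f m" for m
    using lookup_const_mult[of "of_nat k" f m] by (simp add: const_of_nat)
  then show ?thesis using assms by (auto simp: homogeneous_def in_keys_iff)
qed

lemma homogeneous_psum: "k \<ge> 1 \<Longrightarrow> homogeneous k (psum k)"
  by (auto simp: homogeneous_def psum_def split: if_splits)

lemma form_disjoint: "Poly_Mapping.keys f \<inter> Poly_Mapping.keys g = {} \<Longrightarrow> form f g = 0"
  unfolding form_def by (intro sum.neutral) (auto simp: in_keys_iff)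

lemma lookup_form: "form f (Poly_Mapping.single m 1) = of_nat (zfac m) * Poly_Mapping.lookup f m"
  by (simp add: form_sym[of f] form_single_left)

lemma keys_form: "m \<in> Poly_Mapping.keys f \<longleftrightarrow> form f (Poly_Mapping.single m 1) \<noteq> 0"
  using zfac_pos[of m] by (simp add: lookup_form in_keys_iff)

text \<open>The coefficient of \<open>skew F P\<close> at m is, up to \<open>zfac m\<close>, the
  pairing of P with F times the monomial m, and monomials of different weight are
  orthogonal.\<close>

lemma dle_skew:
  assumes "homogeneous n F" "dle N P"
  shows "dle (N - int n) (skew F P)"
  unfolding dle_def
proof
  fix m assume "m \<in> Poly_Mapping.keys (skew F P)"
  then have "form P (F * Poly_Mapping.single m 1) \<noteq> 0"
    by (simp add: keys_form form_skew)
  then obtain m' where m': "m' \<in> Poly_Mapping.keys P" "m' \<in> Poly_Mapping.keys (F * Poly_Mapping.single m 1)"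
    using form_disjoint by blast
  have "homogeneous (n + weight m) (F * Poly_Mapping.single m 1)"
    by (intro homogeneous_mult assms) (auto simp: homogeneous_def)
  then show "int (weight m) \<le> N - int n" using m' assms by (auto simp: homogeneous_def dle_def)
qed

lemma skew_eq_0: "homogeneous n F \<Longrightarrow> dle N P \<Longrightarrow> N < int n \<Longrightarrow> skew F P = 0"
  using dle_neg[OF dle_skew] by auto

lemma form_homogeneous: "homogeneous n F \<Longrightarrow> homogeneous k G \<Longrightarrow> n \<noteq> k \<Longrightarrow> form F G = 0"
  by (rule form_disjoint) (auto simp: homogeneous_def)

lemma keys_homog: "Poly_Mapping.keys (homog n f) \<subseteq> {m. weight m = n}"
  unfolding homog_def using keys_sum by (force split: if_splits)

lemma homogeneous_homog: "homogeneous n (homog n f)"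
  using keys_homog by (auto simp: homogeneous_def)

lemma lookup_homog: "Poly_Mapping.lookup (homog n f) m = (if weight m = n then Poly_Mapping.lookup f m else 0)"
proof (cases "weight m = n \<and> m \<in> Poly_Mapping.keys f")
  case True
  then show ?thesis by (simp add: homog_def lookup_sum lookup_single when_def)
next
  case False
  then show ?thesis
    by (auto simp: homog_def lookup_sum lookup_single when_def in_keys_iff intro!: sum.neutral)
qed

lemma homog_add: "homog n (f + g) = homog n f + homog n g"
  by (rule poly_mapping_eqI) (simp add: lookup_homog lookup_add)

lemma homog_homogeneous: "homogeneous k f \<Longrightarrow> homog n f = (if n = k then f else 0)"
  by (rule poly_mapping_eqI) (auto simp: lookup_homog homogeneous_def in_keys_iff)

section \<open>Exponential series\<close>

text \<open>\<Omega> is handled through the equation y' = L y, so the composition of series in its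
  definition never has to be expanded.\<close>

lemma fps_ode_unique:
  fixes y z :: "'a::{idom,ring_char_0} fps"
  assumes "fps_nth y 0 = fps_nth z 0" "fps_deriv y = L * y" "fps_deriv z = L * z"
  shows "y = z"
proof (rule fps_ext)
  fix n show "fps_nth y n = fps_nth z n"
  proof (induction n rule: less_induct)
    case (less n)
    show ?case
    proof (cases n)
      case (Suc n')
      have "of_nat n * fps_nth u n = (\<Sum>i=0..n'. fps_nth L i * fps_nth u (n' - i))"
        if "fps_deriv u = L * u" for u
        using arg_cong[OF that, of "\<lambda>f. fps_nth f n'"] Suc by (simp add: fps_mult_nth)
      from this[OF assms(2)] this[OF assms(3)] have "of_nat n * fps_nth y n = of_nat n * fps_nth z n"
        using less Suc by (simp add: le_imp_less_Suc)
      then show ?thesis using Suc by (simp del: of_nat_Suc)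
    qed (use assms in simp)
  qed
qed

lemma fps_deriv_exp_series: "fps_deriv exp_series = exp_series"
proof (rule fps_ext)
  fix n
  have "rat_const (1 / fact n) = const ([:of_nat (Suc n):] * [:1 / fact (Suc n):])"
    by (simp add: divide_simps del: of_nat_Suc)
  also have "\<dots> = of_nat (Suc n) * rat_const (1 / fact (Suc n))"
    unfolding const_mult by (metis const_of_nat of_nat_poly)
  finally show "fps_nth (fps_deriv exp_series) n = fps_nth exp_series n"
    by (simp add: exp_series_def)
qed

lemma log_Omega_0 [simp]: "fps_nth (log_Omega A) 0 = 0"
  by (simp add: log_Omega_def)

lemma Omega_nth_0 [simp]: "fps_nth (Omega A) 0 = 1"
  by (simp add: Omega_def exp_series_def one_pCons[symmetric])

lemma Omega_deriv: "fps_deriv (Omega A) = fps_deriv (log_Omega A) * Omega A"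
  by (simp add: Omega_def fps_compose_deriv fps_deriv_exp_series)

lemma Omega_unique:
  "fps_nth y 0 = 1 \<Longrightarrow> fps_deriv y = fps_deriv (log_Omega A) * y \<Longrightarrow> Omega A = y"
  by (rule fps_ode_unique[OF _ Omega_deriv]) auto

text \<open>Comparison of coefficients in the differential equation for \<Omega>[A]. For A = X and A
  = -X it becomes Newton's identities \<open>hh_newton\<close> and \<open>ee_newton\<close>.\<close>

lemma Omega_newton:
  "of_nat n * fps_nth (Omega A) n = (\<Sum>j=1..n. of_nat j * fps_nth (log_Omega A) j * fps_nth (Omega A) (n - j))"
proof (cases n)
  case (Suc n')
  have "of_nat n * fps_nth (Omega A) n = fps_nth (fps_deriv (Omega A)) n'"
    using Suc by simp
  also have "\<dots> = (\<Sum>i=0..n'. of_nat (Suc i) * fps_nth (log_Omega A) (Suc i) * fps_nth (Omega A) (n - Suc i))"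
    by (simp only: Omega_deriv fps_mult_nth fps_deriv_nth Suc diff_Suc_Suc Suc_eq_plus1[symmetric])
  also have "\<dots> = (\<Sum>j=1..n. of_nat j * fps_nth (log_Omega A) j * fps_nth (Omega A) (n - j))"
    using sum.shift_bounds_cl_Suc_ivl[of "\<lambda>j. of_nat j * fps_nth (log_Omega A) j * fps_nth (Omega A) (n - j)" 0 n'] Suc
    by simp
  finally show ?thesis .
qed simp

lemma adams_coeff_hom: "comm_ring_hom (adams_coeff k)"
  by unfold_locales (auto simp: adams_coeff_def pcompose_add pcompose_mult pcompose_1)

lemma const_adams_hom: "comm_ring_hom (\<lambda>c. const (adams_coeff k c) :: sym)"
proof -
  interpret comm_ring_hom "adams_coeff k" by (rule adams_coeff_hom)
  show ?thesis by unfold_locales (auto simp: hom_add hom_mult const_add const_mult)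
qed

lemma adams_hom: "comm_ring_hom (adams k)"
  unfolding adams_def by (rule psubst_hom[OF const_adams_hom])

lemma adams_add: "adams k (A + B) = adams k A + adams k B"
  unfolding adams_def by (rule psubst_add[OF const_adams_hom])

lemma adams_psum: "m \<ge> 1 \<Longrightarrow> adams k (psum m) = psum (k * m)"
  unfolding adams_def by (rule psubst_psum[OF const_adams_hom])

lemma adams_const: "adams k (const c) = const (adams_coeff k c)"
  unfolding adams_def by (rule psubst_const[OF const_adams_hom])

lemma adams_mult: "adams k (A * B) = adams k A * adams k B"
  unfolding adams_def by (rule psubst_mult[OF const_adams_hom])

lemma log_Omega_add: "log_Omega (A + B) = log_Omega A + log_Omega B"
  by (rule fps_ext) (simp add: log_Omega_def adams_add homog_add distrib_left sum.distrib)

lemma log_Omega_zero: "log_Omega 0 = 0"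
  using log_Omega_add[of 0 0] by simp

lemma log_Omega_minus: "log_Omega (- A) = - log_Omega A"
  using log_Omega_add[of A "-A"] by (simp add: log_Omega_zero eq_neg_iff_add_eq_0 add.commute)

lemma Omega_add: "Omega (A + B) = Omega A * Omega B"
  by (rule Omega_unique) (auto simp: log_Omega_add Omega_deriv algebra_simps)

lemma Omega_zero [simp]: "Omega 0 = 1"
  by (rule Omega_unique) (auto simp: log_Omega_zero)

lemma Omega_minus: "Omega (- A) * Omega A = 1"
  by (simp flip: Omega_add)

lemma homogeneous_log_Omega: "homogeneous n (fps_nth (log_Omega A) n)"
  unfolding log_Omega_def by (auto intro!: homogeneous_sum homogeneous_const_mult homogeneous_homog)

lemma homogeneous_Omega: "homogeneous n (fps_nth (Omega A) n)"
proof (induction n rule: less_induct)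
  case (less n)
  show ?case
  proof (cases "n = 0")
    case False
    have "homogeneous n (of_nat n * fps_nth (Omega A) n)"
      unfolding Omega_newton
    proof (intro homogeneous_sum)
      fix j assume j: "j \<in> {1..n}"
      have "homogeneous (j + (n - j)) ((const (of_nat j) * fps_nth (log_Omega A) j) * fps_nth (Omega A) (n - j))"
        by (intro homogeneous_mult homogeneous_const_mult homogeneous_log_Omega less) (use j in auto)
      then show "homogeneous n (of_nat j * fps_nth (log_Omega A) j * fps_nth (Omega A) (n - j))"
        using j by (simp add: const_of_nat)
    qed
    then show ?thesis using homogeneous_of_nat_mult_cancel False by blast
  qed simp
qed

definition fps_D :: "nat \<Rightarrow> sym fps \<Rightarrow> sym fps" where
  "fps_D k F = Abs_fps (\<lambda>n. D k (fps_nth F n))"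

lemma fps_D_nth [simp]: "fps_nth (fps_D k F) n = D k (fps_nth F n)"
  by (simp add: fps_D_def)

lemma fps_D_mult: "k \<ge> 1 \<Longrightarrow> fps_D k (F * G) = fps_D k F * G + F * fps_D k G"
  by (rule fps_ext) (simp add: fps_mult_nth D_sum D_mult sum.distrib)

lemma fps_D_deriv: "fps_D k (fps_deriv F) = fps_deriv (fps_D k F)"
proof (rule fps_ext)
  fix n
  show "fps_nth (fps_D k (fps_deriv F)) n = fps_nth (fps_deriv (fps_D k F)) n"
    using D_const_mult[of k "of_nat (n + 1)" "fps_nth F (n + 1)"] by (simp only: fps_D_nth fps_deriv_nth const_of_nat)
qed

text \<open>\<open>D k\<close> acts on coefficients and commutes with the formal derivative. Hence
  the difference of the two sides solves the linear equation of \<Omega>[A] with initial value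
  0.\<close>

lemma fps_D_Omega:
  assumes k: "k \<ge> 1"
  shows "fps_D k (Omega A) = fps_D k (log_Omega A) * Omega A"
proof -
  let ?L = "log_Omega A"
  let ?Y = "fps_D k (Omega A) - fps_D k ?L * Omega A"
  have "fps_deriv (fps_D k (Omega A)) = fps_D k (fps_deriv ?L * Omega A)"
    by (simp add: fps_D_deriv[symmetric] Omega_deriv)
  also have "\<dots> = fps_deriv (fps_D k ?L) * Omega A + fps_deriv ?L * fps_D k (Omega A)"
    using k by (simp add: fps_D_mult fps_D_deriv)
  finally have "fps_deriv ?Y = fps_deriv ?L * ?Y"
    by (simp add: Omega_deriv algebra_simps)
  moreover have "fps_nth ?Y 0 = 0" by simp
  ultimately have "?Y = 0"
    by (intro fps_ode_unique[of ?Y 0 "fps_deriv ?L"]) auto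
  then show ?thesis by simp
qed

lemma fps_D_nth_Omega:
  "k \<ge> 1 \<Longrightarrow> D k (fps_nth (Omega A) n) = (\<Sum>j=0..n. D k (fps_nth (log_Omega A) j) * fps_nth (Omega A) (n - j))"
  using arg_cong[OF fps_D_Omega, of k "\<lambda>f. fps_nth f n" A] by (simp add: fps_mult_nth)

declare One_nat_def [simp del]

section \<open>Complete and signed elementary symmetric functions\<close>

lemma rat_const_inverse: "n \<noteq> 0 \<Longrightarrow> rat_const (1 / of_nat n) * of_nat n = 1"
proof -
  assume "n \<noteq> 0"
  then have "[:1 / of_nat n:] * of_nat n = (1 :: coeff)"
    by (simp add: of_nat_poly one_pCons)
  then show ?thesis by (metis const_1 const_mult const_of_nat)
qed

lemma log_Omega_XX: "fps_nth (log_Omega XX) n = (if n = 0 then 0 else rat_const (1 / of_nat n) * psum n)"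
proof (cases "n = 0")
  case False
  have "rat_const (1 / of_nat k) * homog n (adams k XX) = (if k = n then rat_const (1 / of_nat n) * psum n else 0)"
    if "k \<in> {1..n}" for k
    using that by (simp add: adams_psum homog_homogeneous[OF homogeneous_psum])
  then have "fps_nth (log_Omega XX) n = (\<Sum>k=1..n. if k = n then rat_const (1 / of_nat n) * psum n else 0)"
    unfolding log_Omega_def fps_nth_Abs_fps by (intro sum.cong) auto
  then show ?thesis using False by simp
qed simp

abbreviation hh :: "int \<Rightarrow> sym" where "hh \<equiv> complete_sym"

text \<open>This is the elementary symmetric function with sign \<open>(-1)\<^sup>n\<close>. As for
  \<open>hh\<close>, the index is an integer and negative indices give 0, so that summation indices
  can be shifted freely.\<close>

definition ee :: "int \<Rightarrow> sym" where
  "ee n = (if n < 0 then 0 else fps_nth (Omega (- XX)) (nat n))"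

lemma hh_neg [simp]: "n < 0 \<Longrightarrow> hh n = 0" and hh_0 [simp]: "hh 0 = 1"
  by (auto simp: complete_sym_def)

lemma ee_neg [simp]: "n < 0 \<Longrightarrow> ee n = 0" and ee_0 [simp]: "ee 0 = 1"
  by (auto simp: ee_def)

lemma homogeneous_hh: "homogeneous (nat n) (hh n)"
  by (auto simp: complete_sym_def homogeneous_Omega)

lemma homogeneous_ee: "homogeneous (nat n) (ee n)"
  by (auto simp: ee_def homogeneous_Omega)

lemma hh_newton: "of_nat n * hh (int n) = (\<Sum>k=1..n. psum k * hh (int n - int k))"
proof -
  have "of_nat n * hh (int n) = (\<Sum>k=1..n. of_nat k * fps_nth (log_Omega XX) k * fps_nth (Omega XX) (n - k))"
    using Omega_newton[of n XX] by (simp add: complete_sym_def)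
  also have "\<dots> = (\<Sum>k=1..n. psum k * hh (int n - int k))"
  proof (intro sum.cong refl)
    fix k assume k: "k \<in> {1..n}"
    then have "of_nat k * fps_nth (log_Omega XX) k = psum k"
      using rat_const_inverse[of k] by (simp add: log_Omega_XX mult_ac) 
    moreover have "nat (int n - int k) = n - k" using k by auto
    ultimately show "of_nat k * fps_nth (log_Omega XX) k * fps_nth (Omega XX) (n - k) = psum k * hh (int n - int k)"
      using k by (simp add: complete_sym_def)
  qed
  finally show ?thesis .
qed

lemma ee_newton: "of_nat n * ee (int n) = - (\<Sum>k=1..n. psum k * ee (int n - int k))"
proof -
  have "of_nat n * ee (int n) = (\<Sum>k=1..n. of_nat k * fps_nth (log_Omega (- XX)) k * fps_nth (Omega (- XX)) (n - k))"
    using Omega_newton[of n "- XX"] by (simp add: ee_def)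
  also have "\<dots> = (\<Sum>k=1..n. - (psum k * ee (int n - int k)))"
  proof (intro sum.cong refl)
    fix k assume k: "k \<in> {1..n}"
    then have "of_nat k * fps_nth (log_Omega (- XX)) k = - psum k"
      using rat_const_inverse[of k] by (simp add: log_Omega_minus log_Omega_XX mult_ac) 
    moreover have "nat (int n - int k) = n - k" using k by auto
    ultimately show "of_nat k * fps_nth (log_Omega (- XX)) k * fps_nth (Omega (- XX)) (n - k) = - (psum k * ee (int n - int k))"
      using k by (simp add: ee_def)
  qed
  finally show ?thesis by (simp add: sum_negf)
qed

lemma D_log_Omega_XX: "k \<ge> 1 \<Longrightarrow> D k (fps_nth (log_Omega XX) j) = (if j = k then 1 else 0)"
  using rat_const_inverse[of k] by (auto simp: log_Omega_XX D_const_mult D_psum)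

lemma D_hh: "k \<ge> 1 \<Longrightarrow> D k (hh n) = hh (n - int k)"
proof (cases "n < 0")
  case False
  assume k: "k \<ge> 1"
  have "D k (hh n) = (\<Sum>j=0..nat n. if j = k then fps_nth (Omega XX) (nat n - j) else 0)"
    using False k unfolding complete_sym_def
    by (simp only: if_False fps_D_nth_Omega) (intro sum.cong refl, simp add: D_log_Omega_XX)
  also have "\<dots> = hh (n - int k)"
    using False by (auto simp: complete_sym_def nat_diff_distrib)
  finally show ?thesis .
qed simp

lemma D_ee: "k \<ge> 1 \<Longrightarrow> D k (ee n) = - ee (n - int k)"
proof (cases "n < 0")
  case False
  assume k: "k \<ge> 1"
  have "D k (ee n) = (\<Sum>j=0..nat n. if j = k then - fps_nth (Omega (- XX)) (nat n - j) else 0)"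
    using False k unfolding ee_def
    by (simp only: if_False fps_D_nth_Omega) (intro sum.cong refl, simp add: log_Omega_minus D_uminus D_log_Omega_XX)
  also have "\<dots> = - ee (n - int k)"
    using False by (auto simp: ee_def nat_diff_distrib)
  finally show ?thesis .
qed simp

lemma sum_ee_hh: "(\<Sum>i=0..n. ee (int i) * hh (int n - int i)) = (if n = 0 then 1 else 0)"
proof -
  have "(\<Sum>i=0..n. ee (int i) * hh (int n - int i)) = fps_nth (Omega (- XX) * Omega XX) n"
    unfolding fps_mult_nth
    by (intro sum.cong) (auto simp: ee_def complete_sym_def nat_diff_distrib)
  then show ?thesis by (simp add: Omega_minus)
qed

section \<open>Skewing by complete and signed elementary functions\<close>

lemma skew_hh_psum: "k \<ge> 1 \<Longrightarrow> skew (hh i) (psum k * P) = psum k * skew (hh i) P + skew (hh (i - int k)) P"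
  by (simp add: skew_psum_mult D_hh)

lemma skew_ee_psum: "k \<ge> 1 \<Longrightarrow> skew (ee i) (psum k * P) = psum k * skew (ee i) P - skew (ee (i - int k)) P"
  by (simp add: skew_psum_mult D_ee skew_uminus_left)

lemma skew_of_nat: "skew (of_nat n * F) P = of_nat n * skew F P"
  using skew_const_mult_left[of "of_nat n" F P] by (simp add: const_of_nat)

lemma skew_hh_newton: "of_nat n * skew (hh (int n)) P = (\<Sum>k=1..n. skew (hh (int n - int k)) (D k P))"
proof -
  have "of_nat n * skew (hh (int n)) P = skew (\<Sum>k=1..n. psum k * hh (int n - int k)) P"
    by (metis hh_newton skew_of_nat)
  also have "\<dots> = (\<Sum>k=1..n. skew (hh (int n - int k)) (D k P))"
    by (simp add: skew_sum_left skew_mult D_skew skew_psum)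
  finally show ?thesis .
qed

lemma skew_ee_newton: "of_nat n * skew (ee (int n)) P = - (\<Sum>k=1..n. skew (ee (int n - int k)) (D k P))"
proof -
  have "of_nat n * skew (ee (int n)) P = skew (- (\<Sum>k=1..n. psum k * ee (int n - int k))) P"
    by (metis ee_newton skew_of_nat)
  also have "\<dots> = - (\<Sum>k=1..n. skew (ee (int n - int k)) (D k P))"
    by (simp add: skew_uminus_left skew_sum_left skew_mult D_skew skew_psum)
  finally show ?thesis .
qed

text \<open>In Newton's formula each of the i summands equals \<open>hh (s - int i)\<close> by
  induction, and the factor i cancels.\<close>

lemma skew_hh_hh_nat: "skew (hh (int i)) (hh s) = hh (s - int i)"
proof (induction i arbitrary: s rule: less_induct)
  case (less i)
  show ?case
  proof (cases "i = 0")
    case False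
    have "of_nat i * skew (hh (int i)) (hh s) = (\<Sum>k=1..i. hh (s - int i))"
      unfolding skew_hh_newton
    proof (intro sum.cong refl)
      fix k assume k: "k \<in> {1..i}"
      then show "skew (hh (int i - int k)) (D k (hh s)) = hh (s - int i)"
        using less[of "i - k" "s - int k"] by (simp add: D_hh of_nat_diff)
    qed
    also have "\<dots> = of_nat i * hh (s - int i)" by simp
    finally show ?thesis using False by simp
  qed simp
qed

lemma skew_hh_hh: "i \<ge> 0 \<Longrightarrow> skew (hh i) (hh s) = hh (s - i)"
  using skew_hh_hh_nat[of "nat i" s] by simp

lemma skew_ee_ee_nat: "skew (ee (int i)) (ee s) = ee (s - int i)"
proof (induction i arbitrary: s rule: less_induct)
  case (less i)
  show ?case
  proof (cases "i = 0")
    case False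
    have "of_nat i * skew (ee (int i)) (ee s) = - (\<Sum>k=1..i. - ee (s - int i))"
      unfolding skew_ee_newton
    proof (intro arg_cong[of _ _ uminus] sum.cong refl)
      fix k assume k: "k \<in> {1..i}"
      then show "skew (ee (int i - int k)) (D k (ee s)) = - ee (s - int i)"
        using less[of "i - k" "s - int k"] by (simp add: D_ee of_nat_diff skew_uminus)
    qed
    also have "\<dots> = of_nat i * ee (s - int i)" by simp
    finally show ?thesis using False by simp
  qed simp
qed

lemma skew_ee_ee: "i \<ge> 0 \<Longrightarrow> skew (ee i) (ee s) = ee (s - i)"
  using skew_ee_ee_nat[of "nat i" s] by simp

lemma skew_ee_1_hh: "skew (ee 1) (hh s) = - hh (s - 1)"
  using skew_ee_newton[of 1 "hh s"] by (simp add: D_hh)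

text \<open>Reflects \<open>h\<^sub>s[X - w] = h\<^sub>s - w h\<^sub>s\<^sub>-\<^sub>1\<close>,
  which is linear in w. In Newton's formula only k = i and k = i - 1 survive, and they
  cancel.\<close>

lemma skew_ee_hh_nat: "i \<ge> 2 \<Longrightarrow> skew (ee (int i)) (hh s) = 0"
proof (induction i arbitrary: s rule: less_induct)
  case (less i)
  have "of_nat i * skew (ee (int i)) (hh s) =
      - (\<Sum>k=1..i. if k = i then hh (s - int i) else if k = i - 1 then - hh (s - int i) else 0)"
    unfolding skew_ee_newton
  proof (intro arg_cong[of _ _ uminus] sum.cong refl)
    fix k assume k: "k \<in> {1..i}"
    consider "k = i" | "k = i - 1" | "k < i - 1" using k by force
    then show "skew (ee (int i - int k)) (D k (hh s)) =
      (if k = i then hh (s - int i) else if k = i - 1 then - hh (s - int i) else 0)"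
    proof cases
      case 3
      have "skew (ee (int (i - k))) (hh (s - int k)) = 0"
        using 3 k less(1)[of "i - k" "s - int k"] by auto
      then show ?thesis using 3 k by (simp add: D_hh of_nat_diff)
    next
      case 2
      then have [simp]: "int i - int k = 1" and "k \<noteq> i" using less.prems k by auto
      then show ?thesis using 2 k skew_ee_1_hh[of "s - int k"] by (simp add: D_hh algebra_simps)
    qed (use k in \<open>simp add: D_hh\<close>)
  qed
  also have "(\<Sum>k=1..i. if k = i then hh (s - int i) else if k = i - 1 then - hh (s - int i) else 0)
    = (\<Sum>k\<in>{i,i-1}. if k = i then hh (s - int i) else if k = i - 1 then - hh (s - int i) else 0)"
    using less.prems by (intro sum.mono_neutral_right) auto
  also have "\<dots> = 0" using less.prems by (simp add: if_distrib)
  finally show ?case using less.prems by simp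
qed

lemma skew_ee_hh: "skew (ee j) (hh s) = (if j = 0 then hh s else if j = 1 then - hh (s - 1) else 0)"
proof -
  consider "j < 0" | "j = 0" | "j = 1" | "j \<ge> 2" by linarith
  then show ?thesis
  proof cases
    case 4
    then show ?thesis using skew_ee_hh_nat[of "nat j" s] by simp
  qed (auto simp: skew_ee_1_hh)
qed

section \<open>Linear operators\<close>

definition linop :: "(sym \<Rightarrow> sym) \<Rightarrow> bool" where
  "linop V \<longleftrightarrow> (\<forall>P Q. V (P + Q) = V P + V Q) \<and> (\<forall>c P. V (const c * P) = const c * V P)"

lemma linop_add: "linop V \<Longrightarrow> V (P + Q) = V P + V Q"
  and linop_const_mult: "linop V \<Longrightarrow> V (const c * P) = const c * V P"
  by (auto simp: linop_def)

lemma linop_0: "linop V \<Longrightarrow> V 0 = 0"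
  using linop_const_mult[of V 0 0] by simp

lemma linop_uminus: "linop V \<Longrightarrow> V (- P) = - V P"
  using linop_const_mult[of V "-1" P] by (simp add: const_minus)

lemma linop_diff: "linop V \<Longrightarrow> V (P - Q) = V P - V Q"
  using linop_add[of V P "- Q"] by (simp add: linop_uminus)

lemma linop_sum: "linop V \<Longrightarrow> V (\<Sum>i\<in>A. f i) = (\<Sum>i\<in>A. V (f i))"
  by (induction A rule: infinite_finite_induct) (auto simp: linop_add linop_0)

lemma linop_comp: "linop V \<Longrightarrow> linop W \<Longrightarrow> linop (V \<circ> W)"
  by (auto simp: linop_def)

lemma dle_common: obtains N where "N \<ge> 0" "dle N (P :: sym)" "dle N (Q :: sym)"
proof
  let ?N = "max (int (sym_degree P)) (int (sym_degree Q))"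
  show "?N \<ge> 0" "dle ?N P" "dle ?N Q" by (auto intro: dle_mono[OF dle_sym_degree])
qed

section \<open>Bernstein's operators and their adjoints\<close>

definition bern :: "int \<Rightarrow> sym \<Rightarrow> sym" where
  "bern r P = (\<Sum>j\<in>{0..int (sym_degree P)}. hh (r + j) * skew (ee j) P)"

text \<open>The adjoint of \<open>bern r\<close>: in each summand multiplication and skewing trade
  places. The upper bound depends on r because terms vanish once r + j exceeds the degree.\<close>

definition bstar :: "int \<Rightarrow> sym \<Rightarrow> sym" where
  "bstar r P = (\<Sum>j\<in>{0..int (sym_degree P) - r}. ee j * skew (hh (r + j)) P)"

lemma skew_ee_eq_0: "dle N P \<Longrightarrow> j < 0 \<or> N < j \<Longrightarrow> skew (ee j) P = 0"
proof (cases "j < 0")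
  case False
  assume "dle N P" "j < 0 \<or> N < j"
  then show ?thesis using False by (intro skew_eq_0[OF homogeneous_ee]) auto
qed simp

lemma skew_hh_eq_0: "dle N P \<Longrightarrow> j < 0 \<or> N < j \<Longrightarrow> skew (hh j) P = 0"
proof (cases "j < 0")
  case False
  assume "dle N P" "j < 0 \<or> N < j"
  then show ?thesis using False by (intro skew_eq_0[OF homogeneous_hh]) auto
qed simp

text \<open>Any finite range containing the nonzero terms may be used, so that sums for different
  arguments can be compared over a common range.\<close>

lemma bern_eq:
  assumes "dle N P" "finite S" "{0..N} \<subseteq> S"
  shows "bern r P = (\<Sum>j\<in>S. hh (r + j) * skew (ee j) P)"
proof -
  let ?f = "\<lambda>j. hh (r + j) * skew (ee j) P" and ?T = "{0..int (sym_degree P)}"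
  have "bern r P = sum ?f (?T \<union> S)"
    unfolding bern_def using assms skew_ee_eq_0[OF dle_sym_degree[of P]]
    by (intro sum.mono_neutral_left) auto
  also have "\<dots> = sum ?f S"
    using assms skew_ee_eq_0[OF assms(1)] by (intro sum.mono_neutral_right) (auto, force)
  finally show ?thesis .
qed

lemma bstar_eq:
  assumes "dle N P" "finite S" "{0..N - r} \<subseteq> S"
  shows "bstar r P = (\<Sum>j\<in>S. ee j * skew (hh (r + j)) P)"
proof -
  let ?f = "\<lambda>j. ee j * skew (hh (r + j)) P" and ?T = "{0..int (sym_degree P) - r}"
  have z: "?f j = 0" if "dle M P" "j \<notin> {0..M - r}" for j M
    using skew_hh_eq_0[OF that(1), of "r + j"] that(2) by (cases "j < 0") auto
  have "bstar r P = sum ?f (?T \<union> S)"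
    unfolding bstar_def using assms z[OF dle_sym_degree[of P]]
    by (intro sum.mono_neutral_left) auto
  also have "\<dots> = sum ?f S"
    using assms z[OF assms(1)] by (intro sum.mono_neutral_right) blast+
  finally show ?thesis .
qed

lemma linop_bern: "linop (bern r)"
  unfolding linop_def
proof safe
  fix P Q :: sym
  obtain N where N: "N \<ge> 0" "dle N P" "dle N Q" by (rule dle_common[of P Q])
  show "bern r (P + Q) = bern r P + bern r Q"
    using N dle_add[OF N(2,3)]
    by (simp add: bern_eq[of N _ "{0..N}"] skew_add distrib_left sum.distrib)
next
  fix c and P :: sym
  obtain N where N: "N \<ge> 0" "dle N P" "dle N (const c * P)" by (rule dle_common[of P "const c * P"])
  show "bern r (const c * P) = const c * bern r P"
    using N by (simp add: bern_eq[of N _ "{0..N}"] skew_const_mult sum_distrib_left mult.left_commute)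
qed

lemma linop_bstar: "linop (bstar r)"
  unfolding linop_def
proof safe
  fix P Q :: sym
  obtain N where N: "N \<ge> 0" "dle N P" "dle N Q" by (rule dle_common[of P Q])
  show "bstar r (P + Q) = bstar r P + bstar r Q"
    using N dle_add[OF N(2,3)]
    by (simp add: bstar_eq[of N _ "{0..N - r}"] skew_add distrib_left sum.distrib)
next
  fix c and P :: sym
  obtain N where N: "N \<ge> 0" "dle N P" "dle N (const c * P)" by (rule dle_common[of P "const c * P"])
  show "bstar r (const c * P) = const c * bstar r P"
    using N by (simp add: bstar_eq[of N _ "{0..N - r}"] skew_const_mult sum_distrib_left mult.left_commute)
qed

lemmas bern_add = linop_add[OF linop_bern] and bern_const_mult = linop_const_mult[OF linop_bern]
  and bern_0 = linop_0[OF linop_bern] and bern_uminus = linop_uminus[OF linop_bern]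
  and bern_diff = linop_diff[OF linop_bern]
  and bstar_add = linop_add[OF linop_bstar] and bstar_const_mult = linop_const_mult[OF linop_bstar]
  and bstar_diff = linop_diff[OF linop_bstar]

lemma sum_shift_int:
  fixes f :: "int \<Rightarrow> 'b::comm_monoid_add"
  shows "(\<Sum>j\<in>{a..b}. f j) = (\<Sum>j\<in>{a - k..b - k}. f (j + k))"
  by (rule sum.reindex_bij_witness[of _ "\<lambda>j. j + k" "\<lambda>j. j - k"]) auto

lemma dle_psum_mult: "k \<ge> 1 \<Longrightarrow> dle N P \<Longrightarrow> dle (int k + N) (psum k * P)"
  by (intro dle_mult homogeneous_dle homogeneous_psum)

lemma bern_psum:
  assumes k: "k \<ge> 1"
  shows "bern r (psum k * P) = psum k * bern r P - bern (r + int k) P"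
proof -
  let ?N = "int (sym_degree P)" let ?k = "int k"
  let ?S = "{- ?k..?N + ?k}" let ?T = "{- ?k - ?k..?N + ?k - ?k}"
  have N: "dle ?N P" "dle (?N + ?k) (psum k * P)"
    using dle_psum_mult[OF k dle_sym_degree[of P]] by (auto simp: dle_sym_degree add.commute)
  have "bern r (psum k * P) = (\<Sum>j\<in>?S. hh (r + j) * skew (ee j) (psum k * P))"
    by (rule bern_eq[OF N(2)]) auto
  also have "\<dots> = psum k * (\<Sum>j\<in>?S. hh (r + j) * skew (ee j) P) - (\<Sum>j\<in>?S. hh (r + j) * skew (ee (j - ?k)) P)"
    using k by (simp add: skew_ee_psum right_diff_distrib sum_subtractf sum_distrib_left mult.left_commute)
  also have "(\<Sum>j\<in>?S. hh (r + j) * skew (ee (j - ?k)) P) = (\<Sum>j\<in>?T. hh (r + ?k + j) * skew (ee j) P)"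
    by (subst sum_shift_int[where k = ?k]) (simp add: add_ac)
  also have "\<dots> = bern (r + ?k) P"
    by (rule bern_eq[OF N(1), symmetric]) auto
  also have "(\<Sum>j\<in>?S. hh (r + j) * skew (ee j) P) = bern r P"
    by (rule bern_eq[OF N(1), symmetric]) auto
  finally show ?thesis .
qed

lemma bstar_psum:
  assumes k: "k \<ge> 1"
  shows "bstar r (psum k * P) = psum k * bstar r P + bstar (r - int k) P"
proof -
  let ?N = "int (sym_degree P)" let ?k = "int k"
  let ?S = "{0..?N + ?k - r}"
  have N: "dle ?N P" "dle (?N + ?k) (psum k * P)"
    using dle_psum_mult[OF k dle_sym_degree[of P]] by (auto simp: dle_sym_degree add.commute)
  have "bstar r (psum k * P) = (\<Sum>j\<in>?S. ee j * skew (hh (r + j)) (psum k * P))"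
    by (rule bstar_eq[OF N(2)]) auto
  also have "\<dots> = psum k * (\<Sum>j\<in>?S. ee j * skew (hh (r + j)) P) + (\<Sum>j\<in>?S. ee j * skew (hh (r - ?k + j)) P)"
    using k by (simp add: skew_hh_psum distrib_left sum.distrib sum_distrib_left mult.left_commute diff_add_eq)
  also have "(\<Sum>j\<in>?S. ee j * skew (hh (r - ?k + j)) P) = bstar (r - ?k) P"
    by (rule bstar_eq[OF N(1), symmetric]) auto
  also have "(\<Sum>j\<in>?S. ee j * skew (hh (r + j)) P) = bstar r P"
    by (rule bstar_eq[OF N(1), symmetric]) auto
  finally show ?thesis .
qed

lemma D_bern:
  assumes k: "k \<ge> 1"
  shows "D k (bern r P) = bern r (D k P) + bern (r - int k) P"
proof -
  obtain N where N: "N \<ge> 0" "dle N P" "dle N (D k P)" by (rule dle_common[of P "D k P"])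
  show ?thesis
    using k by (simp add: bern_eq[OF N(2), of "{0..N}"] bern_eq[OF N(3), of "{0..N}"] D_sum D_mult D_hh
        sum.distrib D_skew algebra_simps)
qed

lemma dle_bern:
  assumes "dle N P"
  shows "dle (N + r) (bern r P)"
  unfolding bern_def
proof (rule dle_sum)
  fix j assume j: "j \<in> {0..int (sym_degree P)}"
  have "dle (N - j) (skew (ee j) P)"
    using dle_skew[OF homogeneous_ee[of j] assms] j by simp
  moreover have "dle (r + j) (hh (r + j))"
    using homogeneous_dle[OF homogeneous_hh[of "r + j"]] by (cases "r + j < 0") auto
  ultimately have "dle (r + j + (N - j)) (hh (r + j) * skew (ee j) P)" by (rule dle_mult[rotated])
  then show "dle (N + r) (hh (r + j) * skew (ee j) P)" by (simp add: add.commute)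
qed

lemma bern_1: "bern r 1 = hh r"
proof -
  have "dle 0 (1 :: sym)" using homogeneous_dle[OF homogeneous_1] by simp
  from bern_eq[OF this, of "{0}"] show ?thesis by simp
qed

lemma skew_hh_1: "skew (hh i) 1 = (if i = 0 then 1 else 0)"
  using skew_hh_hh[of i 0] by (cases "i < 0") auto

lemma bstar_1: "bstar r 1 = ee (- r)"
proof -
  have "dle 0 (1 :: sym)" using homogeneous_dle[OF homogeneous_1] by simp
  from bstar_eq[OF this, of "{0..- r}" r]
  have "bstar r 1 = (\<Sum>j\<in>{0..- r}. ee j * skew (hh (r + j)) 1)" by simp
  also have "\<dots> = (\<Sum>j\<in>{0..- r}. if j = - r then ee (- r) else 0)"
    by (intro sum.cong) (auto simp: skew_hh_1)
  finally show ?thesis by auto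
qed

lemma bern_hh: "bern r (hh s) = hh r * hh s - hh (r + 1) * hh (s - 1)"
proof -
  have "dle (int (nat s)) (hh s)" by (rule homogeneous_dle[OF homogeneous_hh])
  then have "bern r (hh s) = (\<Sum>j\<in>{0..int (nat s)} \<union> {0,1}. hh (r + j) * skew (ee j) (hh s))"
    by (rule bern_eq) auto
  also have "\<dots> = (\<Sum>j\<in>{0,1}. hh (r + j) * skew (ee j) (hh s))"
    by (rule sum.mono_neutral_right) (auto simp: skew_ee_hh)
  finally show ?thesis by (simp add: skew_ee_hh)
qed

text \<open>On constants this is the antisymmetry of a 2 by 2 determinant. Commuting with
  \<open>p\<^sub>k\<close> replaces r or s by itself plus k, compatibly on both sides.\<close>

lemma bern_straight: "bern r (bern s P) = - bern (s - 1) (bern (r + 1) P)"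
proof (induction P arbitrary: r s rule: psum_poly_induct)
  case (const c)
  have e: "bern x (const c) = const c * hh x" for x
    using bern_const_mult[of x c 1] by (simp add: bern_1)
  have 1: "bern r (bern s (const c)) = const c * (hh r * hh s - hh (r + 1) * hh (s - 1))" for r s
    by (simp only: e bern_const_mult bern_hh)
  have 2: "hh r * hh s - hh (r + 1) * hh (s - 1) = - (hh (s - 1) * hh (r + 1) - hh (s - 1 + 1) * hh (r + 1 - 1))"
    by (simp add: mult.commute)
  show ?case
    unfolding 1 by (subst 2) (rule mult_minus_right)
next
  case (add f g)
  show ?case using add(1)[of r s] add(2)[of r s] by (simp add: bern_add)
next
  case (psum k f)
  have "bern r (bern s (psum k * f)) = psum k * bern r (bern s f) - bern (r + int k) (bern s f) - bern r (bern (s + int k) f)"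
    using psum(1) by (simp add: bern_psum bern_diff)
  also have "\<dots> = - (psum k * bern (s - 1) (bern (r + 1) f) - bern (s - 1) (bern (r + int k + 1) f)
      - bern (s + int k - 1) (bern (r + 1) f))"
    using psum(2)[of r s] psum(2)[of "r + int k" s] psum(2)[of r "s + int k"] by simp
  also have "\<dots> = - bern (s - 1) (bern (r + 1) (psum k * f))"
  proof -
    have i: "s - 1 + int k = s + int k - 1" "r + 1 + int k = r + int k + 1" by simp_all
    show ?thesis unfolding bern_psum[OF psum(1)] bern_diff i by simp
  qed
  finally show ?case .
qed

text \<open>The coefficient of \<open>w\<^sup>k z\<^sup>r\<close> in B(z) \<Omega>[wX] = (1 - w/z)
  \<Omega>[wX] B(z). It serves both the spanning property of Schur functions and the Jacobi-Trudi
  formula.\<close>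

lemma hh_bern: "hh k * bern r P = bern r (hh k * P) + hh (k - 1) * bern (r + 1) P"
proof (induction P arbitrary: r rule: psum_poly_induct)
  case (const c)
  show ?case
    using bern_const_mult[of r c 1] bern_const_mult[of "r + 1" c 1] bern_const_mult[of r c "hh k"]
    by (simp add: bern_1 bern_hh algebra_simps)
next
  case (add f g)
  then show ?case by (simp add: bern_add algebra_simps)
next
  case (psum j f)
  have "hh k * bern r (psum j * f) = psum j * (hh k * bern r f) - hh k * bern (r + int j) f"
    using psum by (simp add: bern_psum right_diff_distrib mult.left_commute)
  also have "\<dots> = (psum j * bern r (hh k * f) - bern (r + int j) (hh k * f))
       + hh (k - 1) * (psum j * bern (r + 1) f - bern (r + 1 + int j) f)"
    unfolding psum(2) by (simp add: algebra_simps)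
  also have "\<dots> = bern r (psum j * (hh k * f)) + hh (k - 1) * bern (r + 1) (psum j * f)"
    using psum by (simp add: bern_psum add.commute add.left_commute)
  finally show ?case by (simp add: mult.left_commute)
qed

lemma sum_ee_hh_int:
  assumes "n \<le> M"
  shows "(\<Sum>i\<in>{0..M}. ee i * hh (n - i)) = (if n = 0 then 1 else 0)"
proof (cases "n < 0")
  case False
  have "(\<Sum>i\<in>{0..M}. ee i * hh (n - i)) = (\<Sum>i\<in>{0..n}. ee i * hh (n - i))"
    using assms by (intro sum.mono_neutral_right) auto
  also have "\<dots> = (\<Sum>i\<in>{0..nat n}. ee (int i) * hh (int (nat n) - int i))"
    using False by (intro sum.reindex_bij_witness[of _ int nat]) auto
  finally show ?thesis using False sum_ee_hh[of "nat n"] by simp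
qed auto

lemma bern_ee: "bern s (ee m) = (\<Sum>j\<in>{0..m}. hh (s + j) * ee (m - j))"
proof (cases "m < 0")
  case False
  then have "dle m (ee m)" using homogeneous_dle[OF homogeneous_ee[of m]] by simp
  from bern_eq[OF this, of "{0..m}" s] show ?thesis by (simp add: skew_ee_ee)
qed (simp add: bern_0)

lemma bstar_hh:
  assumes M: "M \<ge> int (nat s) - r"
  shows "bstar r (hh s) = (\<Sum>j\<in>{0..M}. if j \<ge> - r then ee j * hh (s - r - j) else 0)"
proof -
  have "dle (int (nat s)) (hh s)" by (rule homogeneous_dle[OF homogeneous_hh])
  from bstar_eq[OF this, of "{0..M}" r]
  have "bstar r (hh s) = (\<Sum>j\<in>{0..M}. ee j * skew (hh (r + j)) (hh s))"
    using M by auto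
  also have "\<dots> = (\<Sum>j\<in>{0..M}. if j \<ge> - r then ee j * hh (s - r - j) else 0)"
  proof (intro sum.cong refl)
    fix j
    show "ee j * skew (hh (r + j)) (hh s) = (if j \<ge> - r then ee j * hh (s - r - j) else 0)"
      by (cases "r + j \<ge> 0") (auto simp: skew_hh_hh algebra_simps)
  qed
  finally show ?thesis .
qed

text \<open>The two terms are the parts j \<ge> -r and j < -r of one convolution of
  \<open>ee\<close> and \<open>hh\<close>, which vanishes except in degree 0.\<close>

lemma bstar_bern_1: "bstar r (hh s) + bern (s + 1) (ee (- r - 1)) = (if r = s then 1 else 0)"
proof -
  let ?M = "\<bar>s\<bar> + \<bar>r\<bar> + 1" let ?g = "\<lambda>j. ee j * hh (s - r - j)"
  have "bern (s + 1) (ee (- r - 1)) = (\<Sum>j\<in>{0..- r - 1}. ?g j)"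
    unfolding bern_ee
    by (rule sum.reindex_bij_witness[of _ "\<lambda>j. - r - 1 - j" "\<lambda>j. - r - 1 - j"]) (auto simp: algebra_simps)
  also have "\<dots> = (\<Sum>j\<in>{0..?M}. if j < - r then ?g j else 0)"
    by (rule sum.mono_neutral_cong_left) auto
  finally have *: "bern (s + 1) (ee (- r - 1)) = (\<Sum>j\<in>{0..?M}. if j < - r then ?g j else 0)" .
  have "bstar r (hh s) + bern (s + 1) (ee (- r - 1)) = (\<Sum>j\<in>{0..?M}. ?g j)"
  proof -
    have "int (nat s) - r \<le> ?M" by linarith
    from bstar_hh[OF this] show ?thesis
      by (simp only: * sum.distrib[symmetric]) (intro sum.cong, auto)
  qed
  also have "\<dots> = (if r = s then 1 else 0)"
    using sum_ee_hh_int[of "s - r" ?M] by auto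
  finally show ?thesis .
qed

text \<open>The anticommutation relation of the operators and their adjoints. With it, pairings of
  Schur functions are computed by moving \<open>bstar\<close> to the right until it meets 1.\<close>

lemma bstar_bern: "bstar r (bern s P) = (if r = s then P else 0) - bern (s + 1) (bstar (r + 1) P)"
proof -
  have "bstar r (bern s P) + bern (s + 1) (bstar (r + 1) P) = (if r = s then P else 0)"
  proof (induction P arbitrary: r s rule: psum_poly_induct)
    case (const c)
    have "bstar r (bern s (const c)) + bern (s + 1) (bstar (r + 1) (const c)) =
      const c * (bstar r (hh s) + bern (s + 1) (ee (- r - 1)))"
      using bern_const_mult[of s c 1] bstar_const_mult[of "r + 1" c 1]
      by (simp add: bern_1 bstar_1 bern_const_mult bstar_const_mult distrib_left)
    then show ?case by (simp add: bstar_bern_1)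
  next
    case (add f g)
    have "bstar r (bern s (f + g)) + bern (s + 1) (bstar (r + 1) (f + g)) =
      (bstar r (bern s f) + bern (s + 1) (bstar (r + 1) f)) + (bstar r (bern s g) + bern (s + 1) (bstar (r + 1) g))"
      by (simp add: bern_add bstar_add)
    then show ?case unfolding add by simp
  next
    case (psum k f)
    have "bstar r (bern s (psum k * f)) + bern (s + 1) (bstar (r + 1) (psum k * f)) =
      psum k * (bstar r (bern s f) + bern (s + 1) (bstar (r + 1) f))
      + (bstar (r - int k) (bern s f) + bern (s + 1) (bstar (r - int k + 1) f))
      - (bstar r (bern (s + int k) f) + bern (s + int k + 1) (bstar (r + 1) f))"
    proof -
      have i: "r + 1 - int k = r - int k + 1" "s + 1 + int k = s + int k + 1" by simp_all
      show ?thesis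
        unfolding bern_psum[OF psum(1)] bstar_psum[OF psum(1)] bern_add bern_diff bstar_add bstar_diff i
        by (simp add: distrib_left)
    qed
    then show ?case unfolding psum by auto
  qed
  then show ?thesis by (simp only: eq_diff_eq)
qed

lemma form_mult_left: "form (F * P) Q = form P (skew F Q)"
  by (metis form_skew form_sym)

lemma form_bern: "form (bern r P) Q = form P (bstar r Q)"
proof -
  let ?N = "int (sym_degree P)" and ?M = "int (sym_degree Q)"
  let ?S = "{0..?N} \<union> {0..?M - r}"
  have "form (bern r P) Q = (\<Sum>j\<in>?S. form (hh (r + j) * skew (ee j) P) Q)"
    by (subst bern_eq[OF dle_sym_degree[of P], of ?S]) (auto simp: form_sum_left)
  also have "\<dots> = (\<Sum>j\<in>?S. form P (ee j * skew (hh (r + j)) Q))"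
    by (simp add: form_mult_left form_skew)
  also have "\<dots> = form P (bstar r Q)"
    by (subst bstar_eq[OF dle_sym_degree[of Q], of ?S r]) (auto simp: form_sum_right)
  finally show ?thesis .
qed

section \<open>Alternating families\<close>

abbreviation bl :: "int list \<Rightarrow> sym \<Rightarrow> sym" where "bl \<nu> \<equiv> foldr bern \<nu>"

abbreviation sch :: "nat list \<Rightarrow> sym" where "sch \<mu> \<equiv> bl (map int \<mu>) 1"

lemma linop_bl: "linop (bl \<nu>)"
proof (induction \<nu>)
  case (Cons r \<nu>)
  then show ?case using linop_comp[OF linop_bern[of r] Cons] by (simp add: comp_def)
qed (simp add: linop_def)

text \<open>Antisymmetry under exchange of adjacent entries of \<nu> + (n - 1, ..., 1, 0). It is a
  property of families because the operators, their t-analogues and the values at shifted indices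
  are straightened with the same coefficients.\<close>

definition alternating :: "nat \<Rightarrow> (int list \<Rightarrow> sym) \<Rightarrow> bool" where
  "alternating n b \<longleftrightarrow> (\<forall>xs r s ys. length (xs @ r # s # ys) = n \<longrightarrow>
      b (xs @ r # s # ys) = - b (xs @ (s - 1) # (r + 1) # ys))"

lemma alternating_bl: "alternating n (\<lambda>\<nu>. bl \<nu> P)"
  unfolding alternating_def
proof safe
  fix xs r s ys
  show "bl (xs @ r # s # ys) P = - bl (xs @ (s - 1) # (r + 1) # ys) P"
    using bern_straight[of r s "bl ys P"] by (simp add: linop_uminus[OF linop_bl])
qed

lemma not_sorted_adjacent:
  assumes "\<not> sorted_wrt (\<ge>) (\<nu> :: int list)"
  obtains xs r s ys where "\<nu> = xs @ r # s # ys" "r < s"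
  using assms
proof (induction \<nu> arbitrary: thesis)
  case (Cons x \<nu>)
  show ?case
  proof (cases "sorted_wrt (\<ge>) \<nu>")
    case False
    then obtain xs r s ys where "\<nu> = xs @ r # s # ys" "r < s" using Cons.IH by blast
    then show ?thesis using Cons.prems(1)[of "x # xs"] by simp
  next
    case True
    then obtain y ys where y: "\<nu> = y # ys" "x < y" using Cons.prems(2) by (cases \<nu>) force+
    then show ?thesis using Cons.prems(1)[of "[]"] by simp
  qed
qed simp

text \<open>c and \<gamma> are fixed before b, so one straightening serves every alternating family.
  Exchanging r < s lowers the sum of squares of the entries by 2 (s - r - 1), which ensures
  termination unless s = r + 1.\<close>

lemma straighten:
  "\<exists>c \<gamma>. length \<gamma> = length \<nu> \<and> sorted_wrt (\<ge>) \<gamma> \<and>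
     (\<forall>b. alternating (length \<nu>) b \<longrightarrow> b \<nu> = const c * b \<gamma>)"
proof (induction "nat (\<Sum>x\<leftarrow>\<nu>. x ^ 2)" arbitrary: \<nu> rule: less_induct)
  case less
  show ?case
  proof (cases "sorted_wrt (\<ge>) \<nu>")
    case True
    then show ?thesis by (intro exI[of _ 1] exI[of _ \<nu>]) simp
  next
    case False
    then obtain xs r s ys where \<nu>: "\<nu> = xs @ r # s # ys" "r < s" by (rule not_sorted_adjacent)
    let ?\<nu> = "xs @ (s - 1) # (r + 1) # ys"
    have alt: "b \<nu> = - b ?\<nu>" if "alternating (length \<nu>) b" for b
      using that[unfolded alternating_def, rule_format, of xs r s ys] unfolding \<nu>(1) by simp
    show ?thesis
    proof (cases "s = r + 1")
      case True
      \<comment> \<open>The exchanged vector is \<nu> itself, so b \<nu> = - b \<nu>. With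
        coefficient 0 any weakly decreasing vector of this length serves as \<gamma>.\<close>
      have "b \<nu> = 0" if "alternating (length \<nu>) b" for b
        using alt[OF that] True \<nu> by simp
      then show ?thesis
        by (intro exI[of _ 0] exI[of _ "replicate (length \<nu>) 0"]) (simp add: sorted_wrt_iff_nth_less)
    next
      case False
      have pos: "(\<Sum>x\<leftarrow>zs. x ^ 2) \<ge> (0::int)" for zs by (induction zs) auto
      have lt: "(s - 1)^2 + (r + 1)^2 < r^2 + s^2"
      proof -
        have eq: "(s - 1)^2 + (r + 1)^2 = r^2 + s^2 - 2 * (s - r - 1)"
          by (simp add: power2_eq_square algebra_simps)
        show ?thesis unfolding eq using False \<nu>(2) by simp
      qed
      moreover have "0 \<le> (s - 1)^2 + (r + 1)^2" by simp
      ultimately have pos2: "0 < r^2 + s^2" by (rule order.strict_trans1[rotated])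
      have "nat (\<Sum>x\<leftarrow>?\<nu>. x ^ 2) < nat (\<Sum>x\<leftarrow>\<nu>. x ^ 2)"
        using pos[of xs] pos[of ys] pos2 lt
        unfolding \<nu>(1) by simp
      from less[OF this] obtain c \<gamma> where c: "length \<gamma> = length \<nu>" "sorted_wrt (\<ge>) \<gamma>"
        "\<And>b. alternating (length \<nu>) b \<Longrightarrow> b ?\<nu> = const c * b \<gamma>"
        using \<nu> by auto
      then show ?thesis
        using alt by (intro exI[of _ "- c"] exI[of _ \<gamma>]) (auto simp: const_minus)
    qed
  qed
qed

section \<open>The basis of Schur functions\<close>

text \<open>Each step past a \<open>bern\<close> raises r by 1, so r never meets a part, and finally
  \<open>bstar r 1 = ee (- r)\<close> is 0.\<close>

lemma bstar_sch_eq_0: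
  "r > 0 \<Longrightarrow> \<forall>x\<in>set \<mu>. int x < r \<Longrightarrow> bstar r (sch \<mu>) = 0"
proof (induction \<mu> arbitrary: r)
  case (Cons m \<mu>)
  have "bstar (r + 1) (sch \<mu>) = 0" using Cons.prems by (intro Cons.IH) auto
  then show ?case using Cons.prems by (simp add: bstar_bern bern_0)
qed (simp add: bstar_1)

lemma bstar_bern_sch:
  assumes "\<forall>x\<in>set \<mu>. x \<le> m"
  shows "bstar (int m) (bern (int m) (sch \<mu>)) = sch \<mu>"
proof -
  have "bstar (int m + 1) (sch \<mu>) = 0" using assms by (intro bstar_sch_eq_0) auto
  then show ?thesis by (simp add: bstar_bern bern_0)
qed

lemma is_partition_Cons:
  "is_partition (m # \<mu>) \<longleftrightarrow> m > 0 \<and> (\<forall>x\<in>set \<mu>. x \<le> m) \<and> is_partition \<mu>"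
  by (auto simp: is_partition_def)

lemma is_partition_Nil [simp]: "is_partition []"
  by (simp add: is_partition_def)

text \<open>The larger of the two first parts is carried across the form as an adjoint and
  annihilates the other side. Equal first parts cancel by \<open>bstar_bern_sch\<close>.\<close>

lemma form_sch: "is_partition \<mu> \<Longrightarrow> is_partition \<kappa> \<Longrightarrow> form (sch \<mu>) (sch \<kappa>) = (if \<mu> = \<kappa> then 1 else 0)"
proof (induction \<mu> arbitrary: \<kappa>)
  case Nil
  show ?case
  proof (cases \<kappa>)
    case Nil
    have "form 1 1 = 1" using form_single_left[of 0 1 1] by simp
    then show ?thesis using Nil by simp
  next
    case (Cons l \<kappa>')
    have "form (sch \<kappa>) 1 = 0" using Cons Nil by (simp add: form_bern bstar_1 is_partition_Cons)
    then show ?thesis using Cons by (simp add: form_sym[of 1])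
  qed
next
  case (Cons m \<mu>)
  show ?case
  proof (cases \<kappa>)
    case Nil
    then show ?thesis using Cons by (simp add: form_bern bstar_1 is_partition_Cons)
  next
    case l: (Cons l \<kappa>')
    consider "m = l" | "m > l" | "m < l" by linarith
    then show ?thesis
    proof cases
      case 1
      then show ?thesis using Cons l by (simp add: form_bern bstar_bern_sch is_partition_Cons)
    next
      case 2
      have "bstar (int m) (sch \<kappa>) = 0"
        using 2 l Cons.prems by (intro bstar_sch_eq_0) (auto simp: is_partition_Cons)
      then show ?thesis using 2 l by (simp add: form_bern)
    next
      case 3
      have "bstar (int l) (sch (m # \<mu>)) = 0"
        using 3 Cons.prems by (intro bstar_sch_eq_0) (auto simp: is_partition_Cons)
      then have "form (sch \<kappa>) (sch (m # \<mu>)) = 0" using l by (simp add: form_bern)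
      then show ?thesis using 3 form_sym[of "sch (m # \<mu>)" "sch \<kappa>"] l by simp
    qed
  qed
qed

lemma strip_partition:
  assumes "sorted_wrt (\<ge>) \<gamma>" "\<forall>x\<in>set \<gamma>. x \<ge> 0"
  shows "is_partition (strip \<gamma>)" "bl \<gamma> 1 = sch (strip \<gamma>)"
proof -
  have "is_partition (strip \<gamma>) \<and> bl \<gamma> 1 = sch (strip \<gamma>)"
    using assms
  proof (induction \<gamma>)
    case (Cons x \<gamma>)
    then have IH: "is_partition (strip \<gamma>)" "bl \<gamma> 1 = sch (strip \<gamma>)" by auto
    show ?case
    proof (cases "x = 0")
      case True
      then have "strip \<gamma> = []" using Cons.prems by (force simp: strip_def filter_empty_conv)
      then show ?thesis using True IH by (simp add: strip_def bern_1)
    next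
      case False
      then have "strip (x # \<gamma>) = nat x # strip \<gamma>" "x > 0"
        using Cons.prems by (auto simp: strip_def)
      moreover have "\<forall>y\<in>set (strip \<gamma>). y \<le> nat x"
        using Cons.prems by (auto simp: strip_def)
      ultimately show ?thesis using IH by (simp add: is_partition_Cons)
    qed
  qed (simp add: strip_def)
  then show "is_partition (strip \<gamma>)" "bl \<gamma> 1 = sch (strip \<gamma>)" by auto
qed

text \<open>A negative entry forces the last entry to be negative, and the innermost operator then
  gives \<open>hh\<close> at a negative index.\<close>

lemma bl_negative:
  assumes "sorted_wrt (\<ge>) \<gamma>" "\<exists>x\<in>set \<gamma>. x < 0"
  shows "bl \<gamma> 1 = 0"
  using assms
proof (induction \<gamma>)
  case (Cons x \<gamma>)
  show ?case
  proof (cases "\<exists>y\<in>set \<gamma>. y < 0")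
    case True
    then show ?thesis using Cons by (simp add: bern_0)
  next
    case False
    then have "\<gamma> = []" "x < 0" using Cons.prems by (cases \<gamma>; force)+
    then show ?thesis by (simp add: bern_1)
  qed
qed simp

section \<open>Schur functions span\<close>

inductive_set schur_span :: "sym set" where
  sch: "is_partition \<mu> \<Longrightarrow> sch \<mu> \<in> schur_span"
| zero: "0 \<in> schur_span"
| add: "P \<in> schur_span \<Longrightarrow> Q \<in> schur_span \<Longrightarrow> P + Q \<in> schur_span"
| scale: "P \<in> schur_span \<Longrightarrow> const c * P \<in> schur_span"

lemma schur_span_bl: "bl \<nu> 1 \<in> schur_span"
proof -
  obtain c \<gamma> where c: "sorted_wrt (\<ge>) \<gamma>" "bl \<nu> 1 = const c * bl \<gamma> 1"
    using straighten[of \<nu>] alternating_bl by blast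
  have "bl \<gamma> 1 \<in> schur_span"
  proof (cases "\<exists>x\<in>set \<gamma>. x < 0")
    case True
    then show ?thesis using bl_negative c schur_span.zero by simp
  next
    case False
    then show ?thesis using strip_partition[of \<gamma>] c schur_span.sch by force
  qed
  then show ?thesis using c schur_span.scale by simp
qed

lemma schur_span_bern: "P \<in> schur_span \<Longrightarrow> bern r P \<in> schur_span"
proof (induction rule: schur_span.induct)
  case (sch \<mu>)
  then show ?case using schur_span_bl[of "r # map int \<mu>"] by simp
qed (auto simp: bern_0 bern_add bern_const_mult intro: schur_span.intros)

text \<open>By \<open>hh_bern\<close> the product is reduced either to a shorter vector or to a
  smaller k. The second reduction changes the first entry, which is why r is generalised in the
  inner induction.\<close>

lemma schur_span_hh_bl: "hh (int k) * bl \<nu> 1 \<in> schur_span"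
proof (induction \<nu> arbitrary: k)
  case Nil
  show ?case using schur_span_bl[of "[int k]"] by (simp add: bern_1)
next
  case (Cons r \<nu>)
  show ?case
  proof (induction k arbitrary: r)
    case 0
    show ?case using schur_span_bl[of "r # \<nu>"] by simp
  next
    case (Suc k)
    have "hh (int (Suc k)) * bl (r # \<nu>) 1 = bern r (hh (int (Suc k)) * bl \<nu> 1) + hh (int k) * bl ((r + 1) # \<nu>) 1"
      by (simp add: hh_bern[of "1 + int k"])
    then show ?case using Suc Cons by (metis schur_span.add schur_span_bern)
  qed
qed

lemma schur_span_hh: "P \<in> schur_span \<Longrightarrow> hh (int k) * P \<in> schur_span"
proof (induction rule: schur_span.induct)
  case (sch \<mu>)
  show ?case by (rule schur_span_hh_bl)
qed (auto simp: distrib_left mult.left_commute intro: schur_span.intros)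

lemma schur_span_of_nat: "P \<in> schur_span \<Longrightarrow> of_nat n * P \<in> schur_span"
  using schur_span.scale[of P "of_nat n"] by (simp add: const_of_nat)

lemma schur_span_diff: "P \<in> schur_span \<Longrightarrow> Q \<in> schur_span \<Longrightarrow> P - Q \<in> schur_span"
  using schur_span.add[of P "const (-1) * Q"] schur_span.scale[of Q "-1"] by (simp add: const_minus)

lemma schur_span_sum: "(\<And>i. i \<in> A \<Longrightarrow> f i \<in> schur_span) \<Longrightarrow> (\<Sum>i\<in>A. f i) \<in> schur_span"
  by (induction A rule: infinite_finite_induct) (auto intro: schur_span.intros)

text \<open>Newton's identity solved for \<open>p\<^sub>n\<close>: the remaining terms contain only
  \<open>p\<^sub>k\<close> with k < n and complete functions.\<close>

lemma schur_span_psum: "n \<ge> 1 \<Longrightarrow> P \<in> schur_span \<Longrightarrow> psum n * P \<in> schur_span"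
proof (induction n arbitrary: P rule: less_induct)
  case (less n)
  have "{1..n} = insert n {1..n-1}" using less.prems by auto
  then have *: "of_nat n * hh (int n) = psum n + (\<Sum>k=1..n-1. psum k * hh (int n - int k))"
    using less.prems hh_newton[of n] by simp
  have "psum n * P = of_nat n * (hh (int n) * P) - (\<Sum>k=1..n-1. psum k * (hh (int (n - k)) * P))"
  proof -
    have "(\<Sum>k=1..n-1. psum k * (hh (int (n - k)) * P)) = (\<Sum>k=1..n-1. psum k * hh (int n - int k)) * P"
      unfolding sum_distrib_right by (intro sum.cong) (auto simp: of_nat_diff mult.assoc)
    with * show ?thesis by (simp add: algebra_simps)
  qed
  also have "\<dots> \<in> schur_span"
  proof (intro schur_span_diff schur_span_of_nat schur_span_sum schur_span_hh less.prems)
    fix k assume "k \<in> {1..n - 1}"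
    then show "psum k * (hh (int (n - k)) * P) \<in> schur_span"
      by (intro less.IH schur_span_hh less.prems) auto
  qed
  finally show ?case .
qed

lemma schur_span_UNIV: "P \<in> schur_span"
proof (induction P rule: psum_poly_induct)
  case (const c)
  show ?case using schur_span.scale[OF schur_span.sch[of "[]"], of c] by simp
qed (auto intro: schur_span.add schur_span_psum)

section \<open>The Jacobi--Trudi formula\<close>

text \<open>An umbral substitution: for a polynomial in u with symmetric function coefficients,
  \<open>u\<^sup>j\<close> becomes \<open>hh (r + j)\<close>. It is linear over the coefficients but
  not multiplicative.\<close>

definition hh_subst :: "int \<Rightarrow> sym poly \<Rightarrow> sym" where
  "hh_subst r q = (\<Sum>j\<le>degree q. coeff q j * hh (r + int j))"

lemma hh_subst_eq: "degree q \<le> n \<Longrightarrow> hh_subst r q = (\<Sum>j\<le>n. coeff q j * hh (r + int j))"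
  unfolding hh_subst_def by (intro sum.mono_neutral_left) (auto simp: coeff_eq_0)

lemma hh_subst_add: "hh_subst r (p + q) = hh_subst r p + hh_subst r q"
  using degree_add_le_max[of p q]
  by (simp add: hh_subst_eq[of _ "max (degree p) (degree q)"] distrib_right sum.distrib)

lemma hh_subst_0 [simp]: "hh_subst r 0 = 0"
  by (simp add: hh_subst_def)

lemma hh_subst_uminus: "hh_subst r (- p) = - hh_subst r p"
  using hh_subst_add[of r p "-p"] by (simp add: eq_neg_iff_add_eq_0 add.commute)

lemma hh_subst_sum: "hh_subst r (\<Sum>i\<in>A. f i) = (\<Sum>i\<in>A. hh_subst r (f i))"
  by (induction A rule: infinite_finite_induct) (auto simp: hh_subst_add)

lemma hh_subst_smult: "hh_subst r (smult a q) = a * hh_subst r q"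
  using degree_smult_le[of a q] by (simp add: hh_subst_eq[of _ "degree q"] sum_distrib_left mult.assoc)

lemma hh_subst_pCons: "hh_subst r (pCons a q) = a * hh r + hh_subst (r + 1) q"
proof -
  have "hh_subst r (pCons a q) = (\<Sum>j\<le>Suc (degree q). coeff (pCons a q) j * hh (r + int j))"
    by (rule hh_subst_eq) (simp add: degree_pCons_le)
  also have "\<dots> = a * hh r + hh_subst (r + 1) q"
    by (simp only: sum.atMost_Suc_shift) (simp add: hh_subst_def add_ac)
  finally show ?thesis .
qed

lemma hh_subst_linear_mult: "hh_subst r ([:a, b:] * q) = a * hh_subst r q + b * hh_subst (r + 1) q"
  by (simp add: hh_subst_add hh_subst_smult hh_subst_pCons)

lemma hh_subst_monom_mult: "hh_subst r (monom 1 j * [:c:]) = c * hh (r + int j)"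
proof (induction j arbitrary: r)
  case 0
  show ?case by (simp add: hh_subst_pCons)
next
  case (Suc j)
  have "monom 1 (Suc j) * [:c:] = pCons 0 (monom 1 j * [:c:])" by (simp add: monom_Suc)
  then show ?case using Suc[of "r + 1"] by (simp add: hh_subst_pCons add_ac)
qed

text \<open>By \<open>hh_bern\<close>, pulling \<open>hh a\<close> out of B amounts to the factor
  \<open>hh a - u * hh (a - 1)\<close>, where u raises the index of B. At the end B is applied to
  1.\<close>

lemma bern_prod_hh:
  assumes "finite I"
  shows "bern r (\<Prod>i\<in>I. hh (a i)) = hh_subst r (\<Prod>i\<in>I. [:hh (a i), - hh (a i - 1):])"
  using assms
proof (induction I arbitrary: r)
  case empty
  show ?case by (simp add: bern_1 hh_subst_def)
next
  case (insert i I)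
  have "bern r (hh (a i) * P) = hh (a i) * bern r P - hh (a i - 1) * bern (r + 1) P" for P
    using hh_bern[of "a i" r P] by simp
  then show ?case
    unfolding prod.insert[OF insert(1,2)] hh_subst_linear_mult insert(3)[symmetric] by simp
qed

definition jt_matrix :: "int list \<Rightarrow> sym mat" where
  "jt_matrix \<nu> = mat (length \<nu>) (length \<nu>) (\<lambda>(i, j). hh (\<nu> ! i - int i + int j))"

text \<open>In the Leibniz formula \<open>bern_prod_hh\<close> applies to each product, and the
  linear factors depend on row and column only, so they form a determinant again.\<close>

lemma bern_det_jt:
  "bern r (det (jt_matrix \<nu>)) =
    hh_subst r (det (mat (length \<nu>) (length \<nu>)
      (\<lambda>(i, j). [:hh (\<nu> ! i - int i + int j), - hh (\<nu> ! i - int i + int j - 1):])))"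
proof -
  let ?n = "length \<nu>"
  let ?a = "\<lambda>p i. \<nu> ! i - int i + int (p i)"
  have sgn: "bern r (signof p * P) = signof p * bern r P" for p :: "nat \<Rightarrow> nat" and P
    by (simp add: sign_def bern_uminus)
  have sgn': "hh_subst r (signof p * P) = signof p * hh_subst r P" for p :: "nat \<Rightarrow> nat" and P
    by (simp add: sign_def hh_subst_uminus)
  have "det (jt_matrix \<nu>) = (\<Sum>p\<in>{p. p permutes {0..<?n}}. signof p * (\<Prod>i = 0..<?n. hh (?a p i)))"
    by (subst det_def'[of _ ?n]) (auto simp: jt_matrix_def intro!: sum.cong prod.cong arg_cong2[of _ _ _ _ "(*)"])
  moreover have "det (mat ?n ?n (\<lambda>(i, j). [:hh (\<nu> ! i - int i + int j), - hh (\<nu> ! i - int i + int j - 1):]))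
    = (\<Sum>p\<in>{p. p permutes {0..<?n}}. signof p * (\<Prod>i = 0..<?n. [:hh (?a p i), - hh (?a p i - 1):]))"
    by (subst det_def'[of _ ?n]) (auto intro!: sum.cong prod.cong arg_cong2[of _ _ _ _ "(*)"])
  ultimately show ?thesis
    by (simp only: linop_sum[OF linop_bern] hh_subst_sum sgn sgn' bern_prod_hh[OF finite_atLeastLessThan])
qed

text \<open>The matrix \<open>A\<close> below replaces the first row of the Jacobi--Trudi matrix by \<open>1, u, \<dots>, u\<^sup>n\<close>.
  Subtracting \<open>u\<close> times each column from the next one turns it into the matrix of \<open>bern_det_jt\<close>,
  bordered by a unit vector, and expanding along the first row compares both with the bordered
  determinant.\<close>

lemma det_jt_Cons: "det (jt_matrix (r # \<nu>)) = bern r (det (jt_matrix \<nu>))"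
proof -
  let ?n = "length \<nu>" let ?J = "jt_matrix (r # \<nu>)"
  define A where "A = mat (Suc ?n) (Suc ?n) (\<lambda>(i, j). if i = 0 then monom 1 j else [:?J $$ (i, j):])"
  define U where "U = mat (Suc ?n) (Suc ?n)
    (\<lambda>(i, j). if i = j then 1 else if Suc i = j then - monom 1 1 else (0 :: sym poly))"
  define M where "M = mat ?n ?n (\<lambda>(i, j). [:hh (\<nu> ! i - int i + int j), - hh (\<nu> ! i - int i + int j - 1):])"
  have carr: "A \<in> carrier_mat (Suc ?n) (Suc ?n)" "U \<in> carrier_mat (Suc ?n) (Suc ?n)"
    "?J \<in> carrier_mat (Suc ?n) (Suc ?n)"
    by (auto simp: A_def U_def jt_matrix_def)
  have AU: "(A * U) $$ (i, j) = (if j = 0 then A $$ (i, 0) else A $$ (i, j) - monom 1 1 * A $$ (i, j - 1))"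
    if "i < Suc ?n" "j < Suc ?n" for i j
  proof -
    have "(A * U) $$ (i, j) = (\<Sum>l = 0..<Suc ?n. A $$ (i, l) * U $$ (l, j))"
      using that carr by (simp add: Matrix.scalar_prod_def del: sum.op_ivl_Suc)
    also have "\<dots> = (\<Sum>l = 0..<Suc ?n. (if l = j then A $$ (i, j) else 0) +
        (if Suc l = j then - monom 1 1 * A $$ (i, j - 1) else 0))"
      using that by (intro sum.cong) (auto simp: U_def)
    also have "\<dots> = A $$ (i, j) + (\<Sum>l = 0..<Suc ?n. if Suc l = j then - monom 1 1 * A $$ (i, j - 1) else 0)"
      using that by (simp add: sum.distrib)
    also have "(\<Sum>l = 0..<Suc ?n. if Suc l = j then - monom 1 1 * A $$ (i, j - 1) else 0) =
        (if j = 0 then 0 else - monom 1 1 * A $$ (i, j - 1))"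
    proof (cases j)
      case (Suc j')
      then have "(\<Sum>l = 0..<Suc ?n. if Suc l = j then - monom 1 1 * A $$ (i, j - 1) else 0) =
        (\<Sum>l = 0..<Suc ?n. if l = j' then - monom 1 1 * A $$ (i, j - 1) else 0)"
        by (intro sum.cong) auto
      then show ?thesis using Suc that by simp
    qed simp
    finally show ?thesis by simp
  qed
  have AU_row0: "(A * U) $$ (0, j) = (if j = 0 then 1 else 0)" if "j < Suc ?n" for j
    unfolding AU[OF zero_less_Suc that] using that by (cases j) (simp_all add: A_def mult_monom monom_0 plus_1_eq_Suc)
  have del: "mat_delete (A * U) 0 0 = M"
  proof (rule eq_matI)
    fix i j assume "i < dim_row M" "j < dim_col M"
    then have ij: "i < ?n" "j < ?n" by (auto simp: M_def)
    have "mat_delete (A * U) 0 0 $$ (i, j) = (A * U) $$ (Suc i, Suc j)"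
      using ij carr by (simp add: mat_delete_def)
    also have "\<dots> = [:?J $$ (Suc i, Suc j):] - monom 1 1 * [:?J $$ (Suc i, j):]"
    proof -
      have "A $$ (Suc i, l) = [:?J $$ (Suc i, l):]" if "l < Suc ?n" for l
        using that ij by (simp add: A_def)
      then show ?thesis using AU[of "Suc i" "Suc j"] ij by simp
    qed
    also have "\<dots> = M $$ (i, j)"
      using ij by (simp add: M_def jt_matrix_def monom_altdef algebra_simps)
    finally show "mat_delete (A * U) 0 0 $$ (i, j) = M $$ (i, j)" .
  qed (use carr in \<open>auto simp: M_def\<close>)
  have "det (A * U) = (\<Sum>j<Suc ?n. (A * U) $$ (0, j) * cofactor (A * U) 0 j)"
    using carr by (intro laplace_expansion_row) auto
  also have "\<dots> = (\<Sum>j<Suc ?n. if j = 0 then cofactor (A * U) 0 j else 0)"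
    by (intro sum.cong) (auto simp: AU_row0)
  also have "\<dots> = det M" by (simp add: cofactor_def del)
  finally have 1: "det (A * U) = det M" .
  have "det U = prod_list (diag_mat U)"
    by (intro det_upper_triangular[OF _ carr(2)]) (auto simp: upper_triangular_def U_def)
  also have "\<dots> = 1"
    using carr by (simp add: prod_list_diag_prod) (simp add: U_def)
  finally have 2: "det (A * U) = det A" using carr by (simp add: det_mult)
  have cof: "cofactor A 0 j = [:cofactor ?J 0 j:]" if "j < Suc ?n" for j
  proof -
    interpret comm_ring_hom "\<lambda>c. [:c :: sym:]"
      by unfold_locales (auto simp: one_pCons)
    have "mat_delete A 0 j = map_mat (\<lambda>c. [:c:]) (mat_delete ?J 0 j)"
      using that carr by (intro eq_matI) (auto simp: mat_delete_def A_def)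
    then have "det (mat_delete A 0 j) = [:det (mat_delete ?J 0 j):]" by (simp add: hom_det)
    then show ?thesis unfolding cofactor_def by (simp add: hom_distribs)
  qed
  have "det A = (\<Sum>j<Suc ?n. A $$ (0, j) * cofactor A 0 j)"
    using carr by (intro laplace_expansion_row) auto
  also have "\<dots> = (\<Sum>j<Suc ?n. monom 1 j * [:cofactor ?J 0 j:])"
  proof (intro sum.cong refl)
    fix j assume j: "j \<in> {..<Suc ?n}"
    then have "A $$ (0, j) = monom 1 j" by (simp add: A_def)
    then show "A $$ (0, j) * cofactor A 0 j = monom 1 j * [:cofactor ?J 0 j:]"
      using cof j by simp
  qed
  \<comment> \<open>Only now is \<open>u\<^sup>j\<close> replaced by \<open>hh (r + j)\<close>,
    which is the first row of the Jacobi-Trudi matrix. The cofactors contain no u and are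
    untouched.\<close>
  finally have "hh_subst r (det A) = (\<Sum>j<Suc ?n. cofactor ?J 0 j * hh (r + int j))"
    by (simp only: hh_subst_sum hh_subst_monom_mult)
  also have "\<dots> = (\<Sum>j<Suc ?n. ?J $$ (0, j) * cofactor ?J 0 j)"
    by (intro sum.cong) (auto simp: jt_matrix_def)
  also have "\<dots> = det ?J"
    using carr by (intro laplace_expansion_row[symmetric]) auto
  finally show ?thesis using 1 2 by (simp add: bern_det_jt M_def)
qed

lemma det_jt: "det (jt_matrix \<nu>) = bl \<nu> 1"
proof (induction \<nu>)
  case Nil
  show ?case by (simp add: jt_matrix_def)
next
  case (Cons r \<nu>)
  then show ?case by (simp add: det_jt_Cons)
qed

lemma schur_eq_sch: "schur \<mu> = sch \<mu>"
proof -
  have "schur \<mu> = det (jt_matrix (map int \<mu>))"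
    unfolding schur_def jt_matrix_def by (rule arg_cong[of _ _ det]) (auto intro!: eq_matI)
  then show ?thesis by (simp add: det_jt)
qed

section \<open>The scalar product in the power sum basis\<close>

lemma schur_expansion_exists:
  "\<exists>c. Poly_Mapping.keys c \<subseteq> {\<mu>. is_partition \<mu>} \<and>
       f = (\<Sum>\<mu>\<in>Poly_Mapping.keys c. const (Poly_Mapping.lookup c \<mu>) * schur \<mu>)"
proof -
  have "f \<in> schur_span" by (rule schur_span_UNIV)
  then show ?thesis
  proof induction
    case (sch \<mu>)
    then show ?case by (intro exI[of _ "Poly_Mapping.single \<mu> 1"]) (simp add: schur_eq_sch)
  next
    case zero
    show ?case by (intro exI[of _ 0]) simp
  next
    case (add P Q)
    then obtain c d where *: "Poly_Mapping.keys c \<subseteq> {\<mu>. is_partition \<mu>}" "Poly_Mapping.keys d \<subseteq> {\<mu>. is_partition \<mu>}"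
      "P = (\<Sum>\<mu>\<in>Poly_Mapping.keys c. const (Poly_Mapping.lookup c \<mu>) * schur \<mu>)"
      "Q = (\<Sum>\<mu>\<in>Poly_Mapping.keys d. const (Poly_Mapping.lookup d \<mu>) * schur \<mu>)" by blast
    have "(\<Sum>\<mu>\<in>Poly_Mapping.keys (c + d). const (Poly_Mapping.lookup (c + d) \<mu>) * schur \<mu>) = P + Q"
      unfolding *(3,4) by (rule setsum_keys_plus_distrib) (auto simp: const_add distrib_right)
    then show ?case using * keys_add[of c d] by (intro exI[of _ "c + d"]) auto
  next
    case (scale P a)
    then obtain c where *: "Poly_Mapping.keys c \<subseteq> {\<mu>. is_partition \<mu>}"
      "P = (\<Sum>\<mu>\<in>Poly_Mapping.keys c. const (Poly_Mapping.lookup c \<mu>) * schur \<mu>)" by blast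
    let ?d = "Poly_Mapping.map ((*) a) c"
    have l: "Poly_Mapping.lookup ?d \<mu> = a * Poly_Mapping.lookup c \<mu>" for \<mu>
      by (simp add: Poly_Mapping.map.rep_eq when_def)
    then have k: "Poly_Mapping.keys ?d \<subseteq> Poly_Mapping.keys c" by (auto simp: in_keys_iff)
    have "(\<Sum>\<mu>\<in>Poly_Mapping.keys ?d. const (Poly_Mapping.lookup ?d \<mu>) * schur \<mu>)
      = (\<Sum>\<mu>\<in>Poly_Mapping.keys c. const (Poly_Mapping.lookup ?d \<mu>) * schur \<mu>)"
      using k by (intro sum.mono_neutral_left) (auto simp: in_keys_iff)
    also have "\<dots> = const a * P" unfolding *(2) l sum_distrib_left const_mult by (simp only: mult.assoc)
    finally show ?case using * k by (intro exI[of _ ?d]) auto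
  qed
qed

lemma schur_expansion_lookup:
  assumes "Poly_Mapping.keys c \<subseteq> {\<mu>. is_partition \<mu>}"
    "f = (\<Sum>\<mu>\<in>Poly_Mapping.keys c. const (Poly_Mapping.lookup c \<mu>) * schur \<mu>)" "is_partition \<kappa>"
  shows "Poly_Mapping.lookup c \<kappa> = form (sch \<kappa>) f"
proof -
  have "form (sch \<kappa>) f = (\<Sum>\<mu>\<in>Poly_Mapping.keys c. if \<mu> = \<kappa> then Poly_Mapping.lookup c \<kappa> else 0)"
    unfolding assms(2) form_sum_right
    by (intro sum.cong) (use assms in \<open>auto simp: form_const_right schur_eq_sch form_sch\<close>)
  then show ?thesis by (simp add: in_keys_iff)
qed

lemma schur_expansion:
  shows keys_schur_expansion: "Poly_Mapping.keys (schur_expansion f) \<subseteq> {\<mu>. is_partition \<mu>}"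
    and schur_expansion_sum:
      "(\<Sum>\<mu>\<in>Poly_Mapping.keys (schur_expansion f). const (schur_coeff \<mu> f) * schur \<mu>) = f"
proof -
  let ?Q = "\<lambda>c. Poly_Mapping.keys c \<subseteq> {\<mu>. is_partition \<mu>} \<and>
       f = (\<Sum>\<mu>\<in>Poly_Mapping.keys c. const (Poly_Mapping.lookup c \<mu>) * schur \<mu>)"
  have uniq: "c = d" if "?Q c" "?Q d" for c d
  proof (rule poly_mapping_eqI)
    fix \<kappa>
    show "Poly_Mapping.lookup c \<kappa> = Poly_Mapping.lookup d \<kappa>"
    proof (cases "is_partition \<kappa>")
      case True
      then show ?thesis
        using schur_expansion_lookup[of c f \<kappa>] schur_expansion_lookup[of d f \<kappa>] that by simp
    next
      case False
      then have "\<kappa> \<notin> Poly_Mapping.keys c" "\<kappa> \<notin> Poly_Mapping.keys d" using that by auto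
      then show ?thesis by (simp add: in_keys_iff)
    qed
  qed
  have "\<exists>!c. ?Q c" using schur_expansion_exists[of f] uniq by blast
  from theI'[OF this] have "?Q (schur_expansion f)" by (simp add: schur_expansion_def)
  then show "Poly_Mapping.keys (schur_expansion f) \<subseteq> {\<mu>. is_partition \<mu>}"
    "(\<Sum>\<mu>\<in>Poly_Mapping.keys (schur_expansion f). const (schur_coeff \<mu> f) * schur \<mu>) = f"
    by (auto simp: schur_coeff_def)
qed

lemma schur_coeff_eq: "is_partition \<mu> \<Longrightarrow> schur_coeff \<mu> f = form (sch \<mu>) f"
  using schur_expansion_lookup[OF keys_schur_expansion schur_expansion_sum[unfolded schur_coeff_def, symmetric]]
  by (simp add: schur_coeff_def)

lemma scalar_prod_eq_form: "scalar_prod f g = form f g"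
proof -
  have "form f g = form (\<Sum>\<mu>\<in>Poly_Mapping.keys (schur_expansion f). const (schur_coeff \<mu> f) * schur \<mu>) g"
    by (simp only: schur_expansion_sum)
  also have "\<dots> = (\<Sum>\<mu>\<in>Poly_Mapping.keys (schur_expansion f). schur_coeff \<mu> f * schur_coeff \<mu> g)"
    unfolding form_sum_left
  proof (intro sum.cong refl)
    fix \<mu> assume "\<mu> \<in> Poly_Mapping.keys (schur_expansion f)"
    then have "is_partition \<mu>" using keys_schur_expansion by blast
    then show "form (const (schur_coeff \<mu> f) * schur \<mu>) g = schur_coeff \<mu> f * schur_coeff \<mu> g"
      by (simp add: form_const_left schur_coeff_eq schur_eq_sch)
  qed
  finally show ?thesis by (simp add: Defs.scalar_prod_def)
qed

lemma perp_eq_skew: "perp P f = skew P f"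
  by (simp add: perp_def skew_def scalar_prod_eq_form)

lemma bernstein_eq_bern: "bernstein r P = bern r P"
proof -
  have "bernstein r P = (\<Sum>j\<in>{0..int (sym_degree P)}. hh (r + j) * skew (ee j) P)"
    unfolding bernstein_def perp_eq_skew
    by (rule sum.reindex_bij_witness[of _ nat int]) (auto simp: ee_def)
  then show ?thesis by (simp add: bern_def)
qed

lemma B_op_eq: "B_op \<nu> = bl \<nu>"
  using bernstein_eq_bern by (simp add: B_op_def fun_eq_iff cong: foldr_cong)

section \<open>Skewing by graded series\<close>

definition graded :: "sym fps \<Rightarrow> bool" where
  "graded F \<longleftrightarrow> (\<forall>n. homogeneous n (fps_nth F n))"

lemma graded_Omega: "graded (Omega A)"
  by (simp add: graded_def homogeneous_Omega)

lemma graded_mult: "graded F \<Longrightarrow> graded G \<Longrightarrow> graded (F * G)"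
  unfolding graded_def fps_mult_nth
proof (intro allI homogeneous_sum)
  fix n i :: nat assume *: "\<forall>n. homogeneous n (fps_nth F n)" "\<forall>n. homogeneous n (fps_nth G n)" "i \<in> {0..n}"
  then have "homogeneous (i + (n - i)) (fps_nth F i * fps_nth G (n - i))" by (intro homogeneous_mult) auto
  then show "homogeneous n (fps_nth F i * fps_nth G (n - i))" using * by simp
qed

lemma series_perp_eq:
  assumes "graded F" "dle (int N) P" "finite S" "{..N} \<subseteq> S"
  shows "series_perp F P = (\<Sum>n\<in>S. skew (fps_nth F n) P)"
proof -
  have z: "skew (fps_nth F n) P = 0" if "dle (int M) P" "n \<notin> {..M}" for n M
    using that assms(1) by (intro skew_eq_0[of n _ "int M"]) (auto simp: graded_def)
  have "series_perp F P = (\<Sum>n\<in>{..sym_degree P} \<union> S. skew (fps_nth F n) P)"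
    unfolding series_perp_def perp_eq_skew using assms z[OF dle_sym_degree]
    by (intro sum.mono_neutral_left) auto
  also have "\<dots> = (\<Sum>n\<in>S. skew (fps_nth F n) P)"
    using assms z[OF assms(2)] by (intro sum.mono_neutral_right) blast+
  finally show ?thesis .
qed

lemma dle_common_nat: obtains N :: nat where "dle (int N) (P :: sym)" "dle (int N) (Q :: sym)"
proof
  show "dle (int (max (sym_degree P) (sym_degree Q))) P" "dle (int (max (sym_degree P) (sym_degree Q))) Q"
    by (auto intro: dle_mono[OF dle_sym_degree])
qed

lemma linop_series_perp:
  assumes "graded F"
  shows "linop (series_perp F)"
  unfolding linop_def
proof safe
  fix P Q :: sym
  obtain N where N: "dle (int N) P" "dle (int N) Q" by (rule dle_common_nat)
  show "series_perp F (P + Q) = series_perp F P + series_perp F Q"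
    using N dle_add[OF N] assms by (simp add: series_perp_eq[of F N _ "{..N}"] skew_add sum.distrib)
next
  fix c and P :: sym
  obtain N where N: "dle (int N) P" "dle (int N) (const c * P)" by (rule dle_common_nat)
  show "series_perp F (const c * P) = const c * series_perp F P"
    using N assms by (simp add: series_perp_eq[of F N _ "{..N}"] skew_const_mult sum_distrib_left)
qed

lemma dle_skew_le: "homogeneous n F \<Longrightarrow> dle N P \<Longrightarrow> dle N (skew F P)"
  by (rule dle_mono[OF dle_skew]) auto

lemma dle_series_perp: "graded F \<Longrightarrow> dle N P \<Longrightarrow> dle N (series_perp F P)"
  unfolding series_perp_def perp_eq_skew by (intro dle_sum dle_skew_le) (auto simp: graded_def)

lemma series_perp_1 [simp]: "series_perp 1 P = P"
proof -
  have "series_perp 1 P = (\<Sum>n\<le>sym_degree P. if n = 0 then P else 0)"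
    unfolding series_perp_def perp_eq_skew by (intro sum.cong) auto
  then show ?thesis by simp
qed

lemma series_perp_mult:
  assumes "graded F" "graded G"
  shows "series_perp (F * G) P = series_perp F (series_perp G P)"
proof -
  let ?N = "sym_degree P"
  let ?f = "\<lambda>i j. skew (fps_nth F i) (skew (fps_nth G j) P)"
  have d: "dle (int ?N) P" by (rule dle_sym_degree)
  have "series_perp (F * G) P = (\<Sum>n\<le>?N. \<Sum>i\<le>n. ?f i (n - i))"
    using assms d by (subst series_perp_eq[of _ ?N _ "{..?N}"])
      (auto simp: graded_mult fps_mult_nth atLeast0AtMost skew_sum_left skew_mult)
  also have "\<dots> = (\<Sum>(i, j)\<in>{(i, j). i + j \<le> ?N}. ?f i j)"
    by (rule sum.triangle_reindex_eq[symmetric])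
  also have "\<dots> = (\<Sum>(i, j)\<in>{..?N} \<times> {..?N}. ?f i j)"
  proof (rule sum.mono_neutral_left)
    have *: "?f i j = 0" if "i + j > ?N" for i j
    proof -
      have "homogeneous (i + j) (fps_nth F i * fps_nth G j)"
        using assms by (intro homogeneous_mult) (auto simp: graded_def)
      then have "skew (fps_nth F i * fps_nth G j) P = 0"
        using that by (intro skew_eq_0[OF _ d]) auto
      then show ?thesis by (simp add: skew_mult)
    qed
    show "\<forall>x\<in>{..?N} \<times> {..?N} - {(i, j). i + j \<le> ?N}. (case x of (i, j) \<Rightarrow> ?f i j) = 0"
      using * by (metis (no_types, lifting) DiffD2 case_prod_unfold mem_Collect_eq not_le split_beta)
  qed auto
  also have "\<dots> = (\<Sum>i\<le>?N. skew (fps_nth F i) (\<Sum>j\<le>?N. skew (fps_nth G j) P))"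
    by (simp add: sum.cartesian_product skew_sum)
  also have "(\<Sum>j\<le>?N. skew (fps_nth G j) P) = series_perp G P"
    using assms d by (intro series_perp_eq[symmetric]) auto
  also have "(\<Sum>i\<le>?N. skew (fps_nth F i) (series_perp G P)) = series_perp F (series_perp G P)"
    using assms d by (intro series_perp_eq[symmetric] dle_series_perp) auto
  finally show ?thesis .
qed

lemma D_series_perp: "k \<ge> 1 \<Longrightarrow> graded F \<Longrightarrow> D k (series_perp F P) = series_perp F (D k P)"
proof -
  assume *: "k \<ge> 1" "graded F"
  obtain N where N: "dle (int N) P" "dle (int N) (D k P)" by (rule dle_common_nat)
  show ?thesis
    using N * by (simp add: series_perp_eq[of F N _ "{..N}"] D_sum D_skew)
qed

section \<open>Exponentials of quadratic polynomials in the power sums\<close>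

text \<open>The equation \<open>p\<^sub>k\<^sup>\<bottom> F = (a\<^sub>k p\<^sub>k + b\<^sub>k)
  F\<close> in components. As \<open>D k\<close> lowers degrees by k, the components on the right
  are those of degree n - 2k and n - k.\<close>

definition quadratic :: "(nat \<Rightarrow> coeff) \<Rightarrow> (nat \<Rightarrow> coeff) \<Rightarrow> sym fps \<Rightarrow> bool" where
  "quadratic a b F \<longleftrightarrow> graded F \<and> (\<forall>k\<ge>1. \<forall>n. D k (fps_nth F n) =
     (if 2 * k \<le> n then const (a k) * psum k * fps_nth F (n - 2 * k) else 0) +
     (if k \<le> n then const (b k) * fps_nth F (n - k) else 0))"

text \<open>The same condition on the logarithm. It is linear in A and can be checked on
  \<open>p\<^sub>1\<^sup>2\<close>, \<open>p\<^sub>2\<close> and \<open>p\<^sub>1\<close>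
  separately.\<close>

definition log_quadratic :: "(nat \<Rightarrow> coeff) \<Rightarrow> (nat \<Rightarrow> coeff) \<Rightarrow> sym \<Rightarrow> bool" where
  "log_quadratic a b A \<longleftrightarrow> (\<forall>k\<ge>1. \<forall>n. D k (fps_nth (log_Omega A) n) =
     (if n = 2 * k then const (a k) * psum k else 0) + (if n = k then const (b k) else 0))"

lemma log_quadratic_add:
  "log_quadratic a b A \<Longrightarrow> log_quadratic a' b' A' \<Longrightarrow> log_quadratic (\<lambda>k. a k + a' k) (\<lambda>k. b k + b' k) (A + A')"
  by (simp add: log_quadratic_def log_Omega_add D_add const_add algebra_simps)

lemma log_quadratic_uminus:
  "log_quadratic a b A \<Longrightarrow> log_quadratic (\<lambda>k. - a k) (\<lambda>k. - b k) (- A)"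
  by (simp add: log_quadratic_def log_Omega_minus D_uminus const_minus)

lemma log_quadratic_diff:
  "log_quadratic a b A \<Longrightarrow> log_quadratic a' b' A' \<Longrightarrow> log_quadratic (\<lambda>k. a k - a' k) (\<lambda>k. b k - b' k) (A - A')"
  using log_quadratic_add[of a b A _ _ "- A'", OF _ log_quadratic_uminus] by simp

lemma quadratic_Omega:
  assumes "log_quadratic a b A"
  shows "quadratic a b (Omega A)"
  unfolding quadratic_def
proof safe
  fix k n :: nat assume k: "1 \<le> k"
  have "D k (fps_nth (Omega A) n) =
    (\<Sum>j=0..n. ((if j = 2 * k then const (a k) * psum k else 0) + (if j = k then const (b k) else 0)) * fps_nth (Omega A) (n - j))"
    using assms k by (simp add: fps_D_nth_Omega log_quadratic_def)
  also have "\<dots> = (\<Sum>j=0..n. (if j = 2 * k then const (a k) * psum k * fps_nth (Omega A) (n - 2 * k) else 0)) +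
     (\<Sum>j=0..n. if j = k then const (b k) * fps_nth (Omega A) (n - k) else 0)"
    unfolding sum.distrib[symmetric] by (intro sum.cong) (auto simp: distrib_right)
  finally show "D k (fps_nth (Omega A) n) =
     (if 2 * k \<le> n then const (a k) * psum k * fps_nth (Omega A) (n - 2 * k) else 0) +
     (if k \<le> n then const (b k) * fps_nth (Omega A) (n - k) else 0)" by simp
qed (rule graded_Omega)

lemma sum_shift_nat:
  fixes N k :: nat
  shows "(\<Sum>n\<le>N + k. if k \<le> n then f (n - k) else 0) = (\<Sum>n\<le>N. f n :: 'b::comm_monoid_add)"
proof -
  have "(\<Sum>n\<le>N + k. if k \<le> n then f (n - k) else 0) = (\<Sum>n\<in>{k..N + k}. f (n - k))"
    by (rule sum.mono_neutral_cong_right) auto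
  also have "\<dots> = (\<Sum>n\<le>N. f n)"
    by (rule sum.reindex_bij_witness[of _ "\<lambda>n. n + k" "\<lambda>n. n - k"]) auto
  finally show ?thesis .
qed

text \<open>The commutator with \<open>p\<^sub>k\<close> is skewing by \<open>D k F\<close>, that is
  by \<open>(a\<^sub>k p\<^sub>k + b\<^sub>k) F\<close>, and skewing by \<open>p\<^sub>k\<close> is
  again \<open>D k\<close>.\<close>

lemma quadratic_psum:
  assumes q: "quadratic a b F" and k: "k \<ge> 1"
  shows "series_perp F (psum k * P) =
    psum k * series_perp F P + const (a k) * series_perp F (D k P) + const (b k) * series_perp F P"
proof -
  let ?N = "sym_degree P"
  have g: "graded F" using q by (simp add: quadratic_def)
  have d: "dle (int ?N) P" by (rule dle_sym_degree)
  have d': "dle (int (?N + 2 * k)) (psum k * P)"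
    using dle_psum_mult[OF k d] by (rule dle_mono) auto
  have dD: "dle (int ?N) (D k P)"
    using dle_skew_le[OF homogeneous_psum[OF k] d] k by (simp add: skew_psum)
  let ?a = "\<lambda>n. const (a k) * skew (fps_nth F n) (D k P)"
  let ?b = "\<lambda>n. const (b k) * skew (fps_nth F n) P"
  have "skew (D k (fps_nth F n)) P = (if 2 * k \<le> n then ?a (n - 2 * k) else 0) + (if k \<le> n then ?b (n - k) else 0)" for n
    using q k by (simp add: quadratic_def skew_add_left skew_const_mult_left mult.assoc skew_mult skew_psum D_skew)
  then have "series_perp F (psum k * P) = psum k * (\<Sum>n\<le>?N + 2 * k. skew (fps_nth F n) P) +
      ((\<Sum>n\<le>?N + 2 * k. if 2 * k \<le> n then ?a (n - 2 * k) else 0) +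
       (\<Sum>n\<le>(?N + k) + k. if k \<le> n then ?b (n - k) else 0))"
    using k by (subst series_perp_eq[OF g d', of "{..?N + 2 * k}"])
      (auto simp: skew_psum_mult sum.distrib sum_distrib_left mult_2 add.assoc)
  also have "\<dots> = psum k * (\<Sum>n\<le>?N + 2 * k. skew (fps_nth F n) P) + ((\<Sum>n\<le>?N. ?a n) + (\<Sum>n\<le>?N + k. ?b n))"
    by (simp only: sum_shift_nat[where f = ?a] sum_shift_nat[where f = ?b])
  also have "(\<Sum>n\<le>?N + 2 * k. skew (fps_nth F n) P) = series_perp F P"
    by (rule series_perp_eq[OF g d, symmetric]) auto
  also have "(\<Sum>n\<le>?N. ?a n) = const (a k) * series_perp F (D k P)"
    unfolding sum_distrib_left[symmetric] by (rule arg_cong[OF series_perp_eq[OF g dD, symmetric]]) auto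
  also have "(\<Sum>n\<le>?N + k. ?b n) = const (b k) * series_perp F P"
    unfolding sum_distrib_left[symmetric] by (rule arg_cong[OF series_perp_eq[OF g d, symmetric]]) auto
  finally show ?thesis by (simp only: add.assoc)
qed

text \<open>For A of degree w the element \<open>p\<^sub>j[A]\<close> has degree w j, so a given
  degree n meets at most one j.\<close>

lemma log_Omega_homogeneous:
  assumes "\<And>j. j \<ge> 1 \<Longrightarrow> homogeneous (w * j) (adams j A)" "w \<ge> 1"
  shows "fps_nth (log_Omega A) n =
    (if w dvd n \<and> n > 0 then rat_const (1 / of_nat (n div w)) * adams (n div w) A else 0)"
proof -
  have "fps_nth (log_Omega A) n = (\<Sum>j=1..n. if n = w * j then rat_const (1 / of_nat j) * adams j A else 0)"
    unfolding log_Omega_def fps_nth_Abs_fps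
    by (intro sum.cong refl) (auto simp: homog_homogeneous[OF assms(1)])
  also have "\<dots> = (if w dvd n \<and> n > 0 then rat_const (1 / of_nat (n div w)) * adams (n div w) A else 0)"
  proof (cases "w dvd n \<and> n > 0")
    case True
    then have e: "n = w * j \<longleftrightarrow> j = n div w" for j using assms(2) by auto
    have "n div w \<in> {1..n}" using True assms(2) by (auto elim!: dvdE)
    then show ?thesis using True by (simp add: e)
  next
    case False
    then show ?thesis by (auto intro!: sum.neutral)
  qed
  finally show ?thesis .
qed

lemma log_quadratic_psum_1: "log_quadratic (\<lambda>k. 0) (\<lambda>k. adams_coeff k c) (const c * psum 1)"
proof -
  have *: "adams j (const c * psum 1) = const (adams_coeff j c) * psum j" for j
    by (simp add: adams_mult adams_const adams_psum)
  have "fps_nth (log_Omega (const c * psum 1)) n =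
    (if 1 dvd n \<and> n > 0 then rat_const (1 / of_nat (n div 1)) * adams (n div 1) (const c * psum 1) else 0)" for n
    by (rule log_Omega_homogeneous) (auto simp: * intro!: homogeneous_const_mult homogeneous_psum)
  then have L: "fps_nth (log_Omega (const c * psum 1)) n =
    (if n > 0 then rat_const (1 / of_nat n) * (const (adams_coeff n c) * psum n) else 0)" for n
    by (simp add: *)
  show ?thesis
    unfolding log_quadratic_def
  proof (intro allI impI)
    fix k n :: nat assume k: "1 \<le> k"
    have "rat_const (1 / of_nat k) * (const (adams_coeff k c) * of_nat k) = const (adams_coeff k c)"
    proof -
      have "rat_const (1 / of_nat k) * (const (adams_coeff k c) * of_nat k)
        = rat_const (1 / of_nat k) * of_nat k * const (adams_coeff k c)"
        by (simp only: mult_ac)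
      then show ?thesis using k by (simp only: rat_const_inverse) simp
    qed
    then show "D k (fps_nth (log_Omega (const c * psum 1)) n) =
       (if n = 2 * k then const 0 * psum k else 0) + (if n = k then const (adams_coeff k c) else 0)"
      using k by (simp add: L D_const_mult D_psum)
  qed
qed

text \<open>\<open>p\<^sub>j[p\<^sub>2] = p\<^sub>2\<^sub>j\<close> contains
  \<open>p\<^sub>k\<close> only for j = k/2. The factor 2 is k, from the derivation, divided by j,
  from the logarithm.\<close>

lemma log_quadratic_psum_2:
  "log_quadratic (\<lambda>k. 0) (\<lambda>k. if even k then 2 * adams_coeff (k div 2) c else 0) (const c * psum 2)"
proof -
  have *: "adams j (const c * psum 2) = const (adams_coeff j c) * psum (j * 2)" for j
    by (simp add: adams_mult adams_const adams_psum)
  have L: "fps_nth (log_Omega (const c * psum 2)) n =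
    (if 2 dvd n \<and> n > 0 then rat_const (1 / of_nat (n div 2)) * adams (n div 2) (const c * psum 2) else 0)" for n
  proof (rule log_Omega_homogeneous)
    fix j :: nat assume "j \<ge> 1"
    then have "homogeneous (j * 2) (psum (j * 2) :: sym)" by (intro homogeneous_psum) simp
    then show "homogeneous (2 * j) (adams j (const c * psum 2))"
      by (simp add: * homogeneous_const_mult mult.commute[of j])
  qed simp
  show ?thesis
    unfolding log_quadratic_def
  proof (intro allI impI)
    fix k n :: nat assume k: "1 \<le> k"
    have "rat_const (1 / of_nat (k div 2)) * (const (adams_coeff (k div 2) c) * of_nat k) = const (2 * adams_coeff (k div 2) c)"
      if "even k"
    proof -
      have "of_nat k = (2 :: sym) * of_nat (k div 2)"
        using that by (metis dvd_mult_div_cancel of_nat_mult of_nat_numeral)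
      moreover have "rat_const (1 / of_nat (k div 2)) * of_nat (k div 2) = 1"
        using that k by (intro rat_const_inverse) auto
      moreover have "rat_const (1 / of_nat (k div 2)) * (const (adams_coeff (k div 2) c) * (2 * of_nat (k div 2)))
        = rat_const (1 / of_nat (k div 2)) * of_nat (k div 2) * (2 * const (adams_coeff (k div 2) c))"
        by (simp only: mult_ac)
      ultimately show ?thesis by (simp only: mult_2 const_add mult_1)
    qed
    then show "D k (fps_nth (log_Omega (const c * psum 2)) n) =
       (if n = 2 * k then const 0 * psum k else 0) +
       (if n = k then const (if even k then 2 * adams_coeff (k div 2) c else 0) else 0)"
      using k by (auto simp: L * D_const_mult D_psum)
  qed
qed

lemma log_quadratic_psum_sq:
  "log_quadratic (\<lambda>k. 2 * adams_coeff k c) (\<lambda>k. 0) (const c * (psum 1 * psum 1))"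
proof -
  have *: "adams j (const c * (psum 1 * psum 1)) = const (adams_coeff j c) * (psum j * psum j)" for j
    by (simp add: adams_mult adams_const adams_psum)
  have L: "fps_nth (log_Omega (const c * (psum 1 * psum 1))) n =
    (if 2 dvd n \<and> n > 0 then rat_const (1 / of_nat (n div 2)) * adams (n div 2) (const c * (psum 1 * psum 1)) else 0)" for n
  proof (rule log_Omega_homogeneous)
    fix j :: nat assume "j \<ge> 1"
    then have "homogeneous (j + j) (psum j * psum j :: sym)" by (intro homogeneous_mult homogeneous_psum)
    then show "homogeneous (2 * j) (adams j (const c * (psum 1 * psum 1)))"
      by (simp add: * homogeneous_const_mult mult_2)
  qed simp
  show ?thesis
    unfolding log_quadratic_def
  proof (intro allI impI)
    fix k n :: nat assume k: "1 \<le> k"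
    have "rat_const (1 / of_nat k) * (const (adams_coeff k c) * (of_nat k * psum k + psum k * of_nat k))
      = (rat_const (1 / of_nat k) * of_nat k) * (const (adams_coeff k c) * (psum k + psum k))"
      by (simp only: distrib_left mult_ac)
    also have "\<dots> = const (adams_coeff k c + adams_coeff k c) * psum k"
      using k by (simp only: rat_const_inverse const_add distrib_left distrib_right) simp
    also have "\<dots> = const (2 * adams_coeff k c) * psum k" by (simp only: mult_2)
    finally show "D k (fps_nth (log_Omega (const c * (psum 1 * psum 1))) n) =
       (if n = 2 * k then const (2 * adams_coeff k c) * psum k else 0) + (if n = k then const 0 else 0)"
      using k by (auto simp: L * D_const_mult D_mult D_psum)
  qed
qed

section \<open>The four series\<close>

text \<open>\<open>fa\<close>, \<open>fb\<close>, \<open>fc\<close> are the coefficients of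
  \<open>p\<^sub>1\<^sup>2\<close>, \<open>p\<^sub>2\<close>, \<open>p\<^sub>1\<close> in f, from
  \<open>s\<^sub>2 = (p\<^sub>1\<^sup>2 + p\<^sub>2)/2\<close>,
  \<open>s\<^sub>1\<^sub>1 = (p\<^sub>1\<^sup>2 - p\<^sub>2)/2\<close> and
  \<open>s\<^sub>1 = p\<^sub>1\<close>.\<close>

definition fa :: "symb \<Rightarrow> rat" where
  "fa d = (if d = Empty then 0 else 1 / 2)"

definition fb :: "symb \<Rightarrow> rat" where
  "fb d = (case d of Empty \<Rightarrow> 0 | HDomino \<Rightarrow> 1 / 2 | _ \<Rightarrow> - 1 / 2)"

definition fc :: "symb \<Rightarrow> rat" where
  "fc d = (if d = Cell then 1 else 0)"

text \<open>The expansion of \<open>f[qX]\<close> in power sums.\<close>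

definition quad_f :: "coeff \<Rightarrow> symb \<Rightarrow> sym" where
  "quad_f q d = const ([:fa d:] * q ^ 2) * (psum 1 * psum 1) + const ([:fb d:] * q ^ 2) * psum 2
      + const ([:fc d:] * q) * psum 1"

text \<open>\<open>aa\<close> and \<open>bb\<close> are the data a and \<open>b\<^sub>k\<close> of
  f: a is 2 \<open>fa\<close>, and \<open>b\<^sub>k\<close> is \<open>fc\<close> plus, for even k, 2
  \<open>fb\<close>. For the cell the two contributions cancel at even k.\<close>

definition aa :: "symb \<Rightarrow> coeff" where
  "aa d = (if d = Empty then 0 else 1)"

definition bb :: "symb \<Rightarrow> nat \<Rightarrow> coeff" where
  "bb d k = (case d of Empty \<Rightarrow> 0 | Cell \<Rightarrow> if odd k then 1 else 0 | HDomino \<Rightarrow> if even k then 1 else 0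
      | VDomino \<Rightarrow> if even k then - 1 else 0)"

lemma adams_coeff_mult: "adams_coeff k (a * b) = adams_coeff k a * adams_coeff k b"
  by (simp add: adams_coeff_def pcompose_mult)

lemma adams_coeff_rat [simp]: "adams_coeff k [:r:] = [:r:]"
  by (simp add: adams_coeff_def)

lemma adams_coeff_1 [simp]: "adams_coeff k 1 = 1"
  by (simp add: adams_coeff_def pcompose_1)

lemma adams_coeff_tt: "adams_coeff k tt = tt ^ k"
proof -
  have "pcompose tt q = q" for q :: coeff by (simp add: monom_altdef pcompose_pCons)
  moreover have "tt ^ k = monom 1 k" by (simp add: monom_power)
  ultimately show ?thesis by (simp add: adams_coeff_def)
qed

lemma adams_coeff_power: "adams_coeff k (a ^ n) = adams_coeff k a ^ n"
  by (induction n) (auto simp: adams_coeff_mult)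

text \<open>The hypothesis says \<open>p\<^sub>k[q] = q\<^sup>k\<close>, as for a monomial with
  coefficient 1. It is applied with q = 1 and q = t.\<close>

lemma log_quadratic_quad_f:
  assumes "\<And>k. adams_coeff k q = q ^ k"
  shows "log_quadratic (\<lambda>k. aa d * q ^ (2 * k)) (\<lambda>k. bb d k * q ^ k) (quad_f q d)"
proof -
  have e: "adams_coeff (k div 2) (q ^ 2) = q ^ k" if "even k" for k
    using that by (simp add: adams_coeff_power assms flip: power_mult)
  have "log_quadratic (\<lambda>k. 2 * adams_coeff k ([:fa d:] * q ^ 2) + 0 + 0)
     (\<lambda>k. 0 + (if even k then 2 * adams_coeff (k div 2) ([:fb d:] * q ^ 2) else 0) + adams_coeff k ([:fc d:] * q))
     (quad_f q d)"
    unfolding quad_f_def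
    by (intro log_quadratic_add log_quadratic_psum_sq log_quadratic_psum_2 log_quadratic_psum_1)
  moreover have "2 * adams_coeff k ([:fa d:] * q ^ 2) + 0 + 0 = aa d * q ^ (2 * k)" for k
  proof (cases "d = Empty")
    case False
    have "[:1 / 2:] * 2 = (1 :: coeff)" by (simp add: numeral_poly one_pCons)
    moreover have "2 * adams_coeff k ([:fa d:] * q ^ 2) = [:1 / 2:] * 2 * q ^ (k * 2)"
      unfolding adams_coeff_mult adams_coeff_power assms adams_coeff_rat power_mult[symmetric]
      by (simp only: fa_def False if_False mult_ac)
    ultimately show ?thesis using False by (simp add: aa_def mult.commute[of k])
  qed (simp add: fa_def aa_def adams_coeff_def)
  moreover have "0 + (if even k then 2 * adams_coeff (k div 2) ([:fb d:] * q ^ 2) else 0) + adams_coeff k ([:fc d:] * q)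
      = bb d k * q ^ k" for k
    unfolding adams_coeff_mult assms adams_coeff_rat
  proof -
    have "Polynomial.smult (1 / 2) (2 * x) = x" for x :: coeff by (simp add: numeral_poly)
    then show "0 + (if even k then 2 * ([:fb d:] * adams_coeff (k div 2) (q ^ 2)) else 0) + [:fc d:] * q ^ k = bb d k * q ^ k"
      by (cases d) (auto simp: e fb_def fc_def bb_def)
  qed
  ultimately show ?thesis by (simp only:)
qed

lemma hh_1: "hh 1 = psum 1"
  using hh_newton[of 1] by simp

lemma hh_2: "hh 2 = rat_const (1 / 2) * (psum 1 * psum 1 + psum 2)"
proof -
  have s: "{1..2::nat} = {1,2}" by auto
  have "2 * hh 2 = psum 1 * psum 1 + psum 2"
    using hh_newton[of 2] by (simp add: s hh_1)
  moreover have "hh 2 = rat_const (1 / 2) * 2 * hh 2"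
    using rat_const_inverse[of 2] by simp
  ultimately show ?thesis by (simp only: mult.assoc)
qed

lemma f_symb_eq: "f_symb d = quad_f 1 d"
proof -
  have 1: "schur [1] = psum 1" "schur [2] = hh 2" "schur [1, 1] = psum 1 * psum 1 - hh 2"
    using bern_hh[of 1 1] by (simp_all add: schur_eq_sch bern_1 hh_1)
  have "psum 1 * psum 1 = rat_const (1 / 2) * (psum 1 * psum 1) + rat_const (1 / 2) * (psum 1 * psum 1)"
    by (simp flip: distrib_right const_add add: one_pCons[symmetric])
  then have 2: "psum 1 * psum 1 - hh 2 = rat_const (1 / 2) * (psum 1 * psum 1) - rat_const (1 / 2) * psum 2"
    by (simp add: hh_2 algebra_simps)
  have 3: "rat_const (- 1 / 2) = - rat_const (1 / 2)"
    by (simp flip: const_minus)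
  show ?thesis
    by (cases d) (simp_all only: f_symb.simps 1 2, simp_all add: quad_f_def fa_def fb_def fc_def hh_2 3[simplified]
        distrib_left one_pCons[symmetric])
qed

lemma pleth_f_symb: "pleth (f_symb d) (const tt * XX) = quad_f tt d"
proof -
  have X: "adams k (const tt * XX) = const (tt ^ k) * psum k" for k
    by (simp add: adams_mult adams_const adams_psum adams_coeff_tt)
  show ?thesis
    unfolding f_symb_eq pleth_def quad_f_def
    by (simp only: psubst_add psubst_mult psubst_const psubst_psum const_ring_hom X order.refl
        one_le_numeral power_one)
      (simp only: const_mult power2_eq_square power_one_right mult_1_left mult_1_right const_1 mult_ac)
qed

section \<open>Littlewood's identities\<close>

text \<open>The coefficient of \<open>z\<^sup>r\<close> in \<open>\<Omega>[(z - z\<^sup>-\<^sup>1)X]\<^sup>\<bottom>\<close>.\<close>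

definition aop :: "int \<Rightarrow> sym \<Rightarrow> sym" where
  "aop r P = (\<Sum>j\<in>{0..int (sym_degree P)}. skew (ee j) (skew (hh (r + j)) P))"

lemma aop_eq:
  assumes "dle N P" "finite S" "{0..N} \<subseteq> S"
  shows "aop r P = (\<Sum>j\<in>S. skew (ee j) (skew (hh (r + j)) P))"
proof -
  let ?f = "\<lambda>j. skew (ee j) (skew (hh (r + j)) P)" and ?T = "{0..int (sym_degree P)}"
  have z: "?f j = 0" if "dle M P" "j \<notin> {0..M}" for j M
    using that dle_skew_le[OF homogeneous_hh that(1), of "r + j"] by (intro skew_ee_eq_0[of M]) auto
  have "aop r P = sum ?f (?T \<union> S)"
    unfolding aop_def using assms z[OF dle_sym_degree[of P]]
    by (intro sum.mono_neutral_left) auto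
  also have "\<dots> = sum ?f S"
    using assms z[OF assms(1)] by (intro sum.mono_neutral_right) blast+
  finally show ?thesis .
qed

lemma linop_aop: "linop (aop r)"
  unfolding linop_def
proof safe
  fix P Q :: sym
  obtain N where N: "N \<ge> 0" "dle N P" "dle N Q" by (rule dle_common[of P Q])
  show "aop r (P + Q) = aop r P + aop r Q"
    using N dle_add[OF N(2,3)]
    by (simp add: aop_eq[of N _ "{0..N}"] skew_add sum.distrib)
next
  fix c and P :: sym
  obtain N where N: "N \<ge> 0" "dle N P" "dle N (const c * P)" by (rule dle_common[of P "const c * P"])
  show "aop r (const c * P) = const c * aop r P"
    using N by (simp add: aop_eq[of N _ "{0..N}"] skew_const_mult sum_distrib_left)
qed

lemma aop_psum:
  assumes k: "k \<ge> 1"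
  shows "aop r (psum k * P) = psum k * aop r P + aop (r - int k) P - aop (r + int k) P"
proof -
  let ?N = "int (sym_degree P)" let ?k = "int k"
  let ?S = "{- ?k..?N + ?k}" let ?T = "{- ?k - ?k..?N + ?k - ?k}"
  have N: "dle ?N P" "dle (?N + ?k) (psum k * P)"
    using dle_psum_mult[OF k dle_sym_degree[of P]] by (auto simp: dle_sym_degree add.commute)
  have "aop r (psum k * P) = (\<Sum>j\<in>?S. skew (ee j) (skew (hh (r + j)) (psum k * P)))"
    by (rule aop_eq[OF N(2)]) auto
  also have "\<dots> = psum k * (\<Sum>j\<in>?S. skew (ee j) (skew (hh (r + j)) P))
      + (\<Sum>j\<in>?S. skew (ee j) (skew (hh (r - ?k + j)) P)) - (\<Sum>j\<in>?S. skew (ee (j - ?k)) (skew (hh (r + j)) P))"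
    unfolding skew_hh_psum[OF k] skew_add skew_ee_psum[OF k] sum_distrib_left sum.distrib[symmetric]
      sum_subtractf[symmetric]
    by (intro sum.cong) (auto simp: algebra_simps)
  also have "(\<Sum>j\<in>?S. skew (ee (j - ?k)) (skew (hh (r + j)) P)) = (\<Sum>j\<in>?T. skew (ee j) (skew (hh (r + ?k + j)) P))"
    by (subst sum_shift_int[where k = ?k]) (simp add: add_ac)
  also have "\<dots> = aop (r + ?k) P"
    by (rule aop_eq[OF N(1), symmetric]) auto
  also have "(\<Sum>j\<in>?S. skew (ee j) (skew (hh (r + j)) P)) = aop r P"
    by (rule aop_eq[OF N(1), symmetric]) auto
  also have "(\<Sum>j\<in>?S. skew (ee j) (skew (hh (r - ?k + j)) P)) = aop (r - ?k) P"
    by (rule aop_eq[OF N(1), symmetric]) auto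
  finally show ?thesis .
qed

lemma D_aop: "k \<ge> 1 \<Longrightarrow> D k (aop r P) = aop r (D k P)"
proof -
  assume k: "k \<ge> 1"
  obtain N where N: "N \<ge> 0" "dle N P" "dle N (D k P)" by (rule dle_common[of P "D k P"])
  show ?thesis
    using k by (simp add: aop_eq[OF N(2), of "{0..N}"] aop_eq[OF N(3), of "{0..N}"] D_sum D_skew)
qed

lemma aop_1: "aop r 1 = (if r = 0 then 1 else 0)"
proof -
  have "dle 0 (1 :: sym)" using homogeneous_dle[OF homogeneous_1] by simp
  from aop_eq[OF this, of "{0}"] show ?thesis by (simp add: skew_hh_1)
qed

text \<open>From \<open>\<Omega>[wX]\<^sup>\<bottom> = \<Omega>[w\<^sup>-\<^sup>1X] B\<^sup>*(w)\<close>, where \<open>B\<^sup>*\<close> is the generating series of \<^const>\<open>bstar\<close>.\<close>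

lemma skew_hh_bstar:
  assumes d: "dle (int N) P" and i: "i \<ge> 0"
  shows "skew (hh i) P = (\<Sum>j\<le>N. hh (int j) * bstar (i + int j) P)"
proof -
  let ?f = "\<lambda>l j. ee (int l) * hh (int j) * skew (hh (i + int (l + j))) P"
  have b: "bstar (i + int j) P = (\<Sum>l\<le>N. ee (int l) * skew (hh (i + int (l + j))) P)" for j
  proof -
    have "bstar (i + int j) P = (\<Sum>l\<in>{0..int N}. ee l * skew (hh (i + int j + l)) P)"
      using i by (intro bstar_eq[OF d]) auto
    also have "\<dots> = (\<Sum>l\<le>N. ee (int l) * skew (hh (i + int (l + j))) P)"
      by (rule sum.reindex_bij_witness[of _ int nat]) (auto simp: algebra_simps)
    finally show ?thesis .
  qed
  have "(\<Sum>j\<le>N. hh (int j) * bstar (i + int j) P) = (\<Sum>j\<le>N. \<Sum>l\<le>N. ?f l j)"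
    unfolding b sum_distrib_left by (simp only: mult_ac)
  also have "\<dots> = (\<Sum>l\<le>N. \<Sum>j\<le>N. ?f l j)" by (rule sum.swap)
  also have "\<dots> = (\<Sum>(l, j)\<in>{..N} \<times> {..N}. ?f l j)" by (simp add: sum.cartesian_product)
  also have "\<dots> = (\<Sum>(l, j)\<in>{(l, j). l + j \<le> N}. ?f l j)"
  proof (rule sum.mono_neutral_right)
    show "\<forall>x\<in>{..N} \<times> {..N} - {(l, j). l + j \<le> N}. (case x of (l, j) \<Rightarrow> ?f l j) = 0"
    proof (rule ballI)
      fix x assume "x \<in> {..N} \<times> {..N} - {(l, j). l + j \<le> N}"
      then have "skew (hh (i + int (fst x + snd x))) P = 0"
        using i by (intro skew_hh_eq_0[OF d]) auto
      then show "(case x of (l, j) \<Rightarrow> ?f l j) = 0" by (simp add: split_beta)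
    qed
  qed auto
  also have "\<dots> = (\<Sum>n\<le>N. \<Sum>l\<le>n. ?f l (n - l))" by (rule sum.triangle_reindex_eq)
  also have "\<dots> = (\<Sum>n\<le>N. (\<Sum>l=0..n. ee (int l) * hh (int n - int l)) * skew (hh (i + int n)) P)"
    unfolding sum_distrib_right by (intro sum.cong) (auto simp: of_nat_diff)
  also have "\<dots> = (\<Sum>n\<le>N. if n = 0 then skew (hh i) P else 0)"
    by (intro sum.cong) (auto simp: sum_ee_hh)
  also have "\<dots> = skew (hh i) P" by simp
  finally show ?thesis by simp
qed

lemma skew_hh_sch_eq_0:
  assumes "i > 0" "\<forall>x\<in>set \<mu>. int x < i"
  shows "skew (hh i) (sch \<mu>) = 0"
proof -
  have "bstar (i + int j) (sch \<mu>) = 0" for j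
    using assms by (intro bstar_sch_eq_0) force+
  then show ?thesis using skew_hh_bstar[OF dle_sym_degree[of "sch \<mu>"], of i] assms by simp
qed

lemma skew_hh_sch_Cons:
  assumes "\<forall>x\<in>set \<mu>. x \<le> m"
  shows "skew (hh (int m)) (sch (m # \<mu>)) = sch \<mu>"
proof -
  let ?N = "sym_degree (sch (m # \<mu>))"
  have "bstar (int m + int j) (sch (m # \<mu>)) = (if j = 0 then sch \<mu> else 0)" for j
  proof (cases "j = 0")
    case True
    then show ?thesis using bstar_bern_sch[OF assms] by simp
  next
    case False
    then show ?thesis using assms bstar_sch_eq_0[of "int m + int j" "m # \<mu>"] by force
  qed
  then have "skew (hh (int m)) (sch (m # \<mu>)) = (\<Sum>j\<le>?N. if j = 0 then sch \<mu> else 0)"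
    unfolding skew_hh_bstar[OF dle_sym_degree[of "sch (m # \<mu>)"], of "int m", OF of_nat_0_le_iff]
    by (intro sum.cong) auto
  then show ?thesis by simp
qed

lemma aop_sch_eq_0:
  assumes "i > 0" "\<forall>x\<in>set \<mu>. int x < i"
  shows "aop i (sch \<mu>) = 0"
  unfolding aop_def
proof (rule sum.neutral, rule ballI)
  fix j assume "j \<in> {0..int (sym_degree (sch \<mu>))}"
  then show "skew (ee j) (skew (hh (i + j)) (sch \<mu>)) = 0"
    using assms skew_hh_sch_eq_0[of "i + j" \<mu>] by force
qed

lemma aop_sch_Cons:
  assumes "\<forall>x\<in>set \<mu>. x \<le> m" "m > 0"
  shows "aop (int m) (sch (m # \<mu>)) = sch \<mu>"
proof -
  let ?N = "int (sym_degree (sch (m # \<mu>)))"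
  have "aop (int m) (sch (m # \<mu>)) = (\<Sum>j\<in>{0..?N}. if j = 0 then sch \<mu> else 0)"
    unfolding aop_def
  proof (intro sum.cong refl)
    fix j assume j: "j \<in> {0..?N}"
    show "skew (ee j) (skew (hh (int m + j)) (sch (m # \<mu>))) = (if j = 0 then sch \<mu> else 0)"
    proof (cases "j = 0")
      case True
      then show ?thesis using skew_hh_sch_Cons[OF assms(1)] by simp
    next
      case False
      then have "skew (hh (int m + j)) (sch (m # \<mu>)) = 0"
        using assms j by (intro skew_hh_sch_eq_0) force+
      then show ?thesis using False by (simp only: skew_0 if_False)
    qed
  qed
  then show ?thesis by simp
qed

text \<open>A pairing with \<Omega>[f], written as a constant term since \<Omega>[f] exists only in
  the completion.\<close>

definition phi :: "symb \<Rightarrow> sym \<Rightarrow> coeff" where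
  "phi d P = form (series_perp (Omega (f_symb d)) P) 1"

lemma phi_add: "phi d (P + Q) = phi d P + phi d Q"
  by (simp add: phi_def linop_add[OF linop_series_perp] graded_Omega form_add_left)

lemma phi_const_mult: "phi d (const c * P) = c * phi d P"
  by (simp add: phi_def linop_const_mult[OF linop_series_perp] graded_Omega form_const_left)

lemma phi_0 [simp]: "phi d 0 = 0"
  using phi_const_mult[of d 0 0] by simp

lemma phi_uminus: "phi d (- P) = - phi d P"
  using phi_const_mult[of d "-1" P] by (simp add: const_minus)

lemma phi_diff: "phi d (P - Q) = phi d P - phi d Q"
  using phi_add[of d P "-Q"] by (simp add: phi_uminus)

lemma phi_of_nat: "phi d (of_nat n * P) = of_nat n * phi d P"
  using phi_const_mult[of d "of_nat n" P] by (simp add: const_of_nat)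

lemma phi_sum: "phi d (\<Sum>i\<in>A. f i) = (\<Sum>i\<in>A. phi d (f i))"
  by (induction A rule: infinite_finite_induct) (auto simp: phi_add)

lemma quadratic_Omega_f: "quadratic (\<lambda>k. aa d) (bb d) (Omega (f_symb d))"
proof -
  have "log_quadratic (\<lambda>k. aa d * 1 ^ (2 * k)) (\<lambda>k. bb d k * 1 ^ k) (quad_f 1 d)"
    by (rule log_quadratic_quad_f) simp
  then show ?thesis by (intro quadratic_Omega) (simp add: f_symb_eq)
qed

lemma form_1_1: "form 1 1 = 1"
  using form_single_left[of 0 1 1] by simp

lemma phi_psum: "k \<ge> 1 \<Longrightarrow> phi d (psum k * P) = aa d * phi d (D k P) + bb d k * phi d P"
proof -
  assume k: "k \<ge> 1"
  have "form (psum k * Q) 1 = 0" for Q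
    using k form_mult_left[of "psum k" Q 1] by (simp add: skew_psum)
  then show ?thesis
    using quadratic_psum[OF quadratic_Omega_f k, of d P]
    by (simp add: phi_def form_add_left form_const_left)
qed

lemma phi_1: "phi d 1 = 1"
proof -
  have "series_perp (Omega (f_symb d)) 1 = 1"
    using homogeneous_dle[OF homogeneous_1] by (subst series_perp_eq[of _ 0 _ "{0}"]) (auto simp: graded_Omega)
  then show ?thesis by (simp add: phi_def form_1_1)
qed

text \<open>1 if the one-row partition of n belongs to the symbol and 0 otherwise. These are the
  coefficients of \<Omega>[f[z]].\<close>

definition hh_val :: "symb \<Rightarrow> int \<Rightarrow> coeff" where
  "hh_val d n = (if n < 0 then 0 else case d of Cell \<Rightarrow> 1 | HDomino \<Rightarrow> if even n then 1 else 0
     | _ \<Rightarrow> if n = 0 then 1 else 0)"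

lemma sum_even: "(\<Sum>j=1..2 * m. if even j then (2 :: coeff) else 0) = of_nat (2 * m)"
  by (induction m) simp_all

text \<open>Under \<open>phi_psum\<close>, Newton's identity becomes a recursion in which
  \<open>hh (n - j)\<close> has the coefficient \<open>b\<^sub>j\<close>, plus 1 if j is even. For
  the cell this is 1, for the vertical domino 0, and for the horizontal domino 2 at even j and 0 at
  odd j.\<close>

lemma phi_hh_nat:
  assumes "d \<noteq> Empty"
  shows "phi d (hh (int n)) = hh_val d (int n)"
proof (induction n rule: less_induct)
  case (less n)
  show ?case
  proof (cases "n = 0")
    case True
    then show ?thesis by (auto simp: phi_1 hh_val_def split: symb.splits)
  next
    case n: False
    let ?x = "\<lambda>j. phi d (hh (int n - int j))"
    have "of_nat n * phi d (hh (int n)) = (\<Sum>k=1..n. ?x (2 * k) + bb d k * ?x k)"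
      using assms unfolding phi_of_nat[symmetric] hh_newton phi_sum
      by (intro sum.cong) (auto simp: phi_psum D_hh aa_def algebra_simps)
    also have "\<dots> = (\<Sum>k=1..n. ?x (2 * k)) + (\<Sum>k=1..n. bb d k * ?x k)"
      by (rule sum.distrib)
    \<comment> \<open>With j = 2k; the summands with 2k > n vanish because their index is
      negative.\<close>
    also have "(\<Sum>k=1..n. ?x (2 * k)) = (\<Sum>j=1..n. if even j then ?x j else 0)"
      by (rule sum.reindex_bij_witness_not_neutral[where i = "\<lambda>j. j div 2" and j = "\<lambda>k. 2 * k"
            and S' = "{k \<in> {1..n}. n < 2 * k}" and T' = "{j \<in> {1..n}. odd j}"]) auto
    also have "\<dots> + (\<Sum>k=1..n. bb d k * ?x k) = (\<Sum>j=1..n. ((if even j then 1 else 0) + bb d j) * ?x j)"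
      unfolding sum.distrib[symmetric] by (intro sum.cong) (auto simp: distrib_right)
    also have "\<dots> = (\<Sum>j=1..n. ((if even j then 1 else 0) + bb d j) * hh_val d (int (n - j)))"
    proof (intro sum.cong refl)
      fix j assume "j \<in> {1..n}"
      then show "((if even j then 1 else 0) + bb d j) * ?x j = ((if even j then 1 else 0) + bb d j) * hh_val d (int (n - j))"
        using less[of "n - j"] by (simp add: of_nat_diff)
    qed
    also have "\<dots> = of_nat n * hh_val d (int n)"
    proof (cases d)
      case Empty
      then show ?thesis using assms by simp
    next
      case Cell
      then have "(\<Sum>j=1..n. ((if even j then 1 else 0) + bb d j) * hh_val d (int (n - j))) = (\<Sum>j=1..n. 1)"
        by (intro sum.cong) (auto simp: bb_def hh_val_def)
      then show ?thesis using Cell by (simp add: hh_val_def)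
    next
      case VDomino
      then have "((if even j then 1 else 0) + bb d j) * hh_val d (int (n - j)) = 0" for j
        by (simp add: bb_def)
      moreover have "hh_val d (int n) = 0" using n VDomino by (simp add: hh_val_def)
      ultimately show ?thesis by (simp only: sum.neutral_const mult_zero_right)
    next
      case HDomino
      show ?thesis
      proof (cases "even n")
        case True
        then obtain m where m: "n = 2 * m" by (rule evenE)
        have "(\<Sum>j=1..n. ((if even j then 1 else 0) + bb d j) * hh_val d (int (n - j)))
          = (\<Sum>j=1..2 * m. if even j then (2 :: coeff) else 0)"
          using HDomino True m by (intro sum.cong) (auto simp: bb_def hh_val_def of_nat_diff)
        then show ?thesis using sum_even[of m] HDomino True m by (simp add: hh_val_def)
      next
        case False
        then show ?thesis using HDomino
          by (auto simp: bb_def hh_val_def of_nat_diff intro!: sum.neutral)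
      qed
    qed
    finally show ?thesis using n by simp
  qed
qed

lemma phi_hh: "d \<noteq> Empty \<Longrightarrow> phi d (hh n) = hh_val d n"
  using phi_hh_nat[of d "nat n"] by (cases "n < 0") (auto simp: hh_val_def)

text \<open>\<open>phi\<close> is the scalar product with \<open>\<Omega>[f]\<close>, and \<open>phi_bern\<close> below is a coefficient of
  \<open>\<Omega>[f[z]]\<^sup>-\<^sup>1 \<phi>(B(z) P)\<close>, where \<open>\<Omega>[f[z]]\<^sup>-\<^sup>1\<close> is \<open>1 - z\<close>, \<open>1 - z\<^sup>2\<close>, \<open>1\<close> for the cell, the
  horizontal and the vertical domino.\<close>

definition phi_bern :: "symb \<Rightarrow> int \<Rightarrow> sym \<Rightarrow> coeff" where
  "phi_bern d r P = phi d (bern r P) - (case d of Cell \<Rightarrow> phi d (bern (r - 1) P)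
      | HDomino \<Rightarrow> phi d (bern (r - 2) P) | _ \<Rightarrow> 0)"

lemma phi_bern_add: "phi_bern d r (P + Q) = phi_bern d r P + phi_bern d r Q"
  by (auto simp: phi_bern_def bern_add phi_add split: symb.splits)

lemma phi_bern_const_mult: "phi_bern d r (const c * P) = c * phi_bern d r P"
  by (auto simp: phi_bern_def bern_const_mult phi_const_mult right_diff_distrib split: symb.splits)

lemma phi_bern_psum:
  assumes "k \<ge> 1" "d \<noteq> Empty"
  shows "phi_bern d r (psum k * P) = phi_bern d r (D k P) + bb d k * phi_bern d r P
     + phi_bern d (r - int k) P - phi_bern d (r + int k) P"
proof -
  have *: "phi d (bern r (psum k * P)) = phi d (bern r (D k P)) + bb d k * phi d (bern r P)
     + phi d (bern (r - int k) P) - phi d (bern (r + int k) P)" for r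
    using assms by (simp add: bern_psum phi_diff phi_psum D_bern phi_add aa_def)
  have i: "r - 1 - int k = r - int k - 1" "r - 1 + int k = r + int k - 1"
    "r - 2 - int k = r - int k - 2" "r - 2 + int k = r + int k - 2" by auto
  show ?thesis
    using assms unfolding phi_bern_def * by (cases d) (simp_all add: i right_diff_distrib)
qed

lemma skew_const_const: "\<exists>g. skew G (const c) = const g"
proof (induction G rule: psum_poly_induct)
  case (add f g)
  then obtain a b where "skew f (const c) = const a" "skew g (const c) = const b" by blast
  then show ?case by (intro exI[of _ "a + b"]) (simp add: skew_add_left const_add)
next
  case (psum k f)
  then obtain a where "skew f (const c) = const a" by blast
  with psum show ?case by (intro exI[of _ 0]) (simp add: skew_mult skew_psum)
qed (metis skew_const const_mult)

text \<open>The reason is f[X + z] = f[X] + f[z] + zX for d \<noteq> \<open>Empty\<close>: under the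
  pairing with \<Omega>[f], multiplication by \<Omega>[zX] becomes skewing by it, times
  \<Omega>[f[z]]. The proof compares recursions in the \<open>p\<^sub>k\<close>. They involve
  \<open>D k P\<close>, which is no smaller case, hence the statement for all
  \<open>skew G P\<close>.\<close>

lemma phi_bern_eq_skew: "d \<noteq> Empty \<Longrightarrow> phi_bern d r (skew G P) = phi d (aop r (skew G P))"
proof (induction P arbitrary: G r rule: psum_poly_induct)
  case (const c)
  obtain g where g: "skew G (const c) = const g * 1" using skew_const_const[of G c] by auto
  have "phi_bern d r 1 = phi d (aop r 1)"
    using const
    by (cases d) (auto simp: phi_bern_def bern_1 phi_hh aop_1 phi_1 hh_val_def)
  then show ?case
    unfolding g phi_bern_const_mult linop_const_mult[OF linop_aop] phi_const_mult by simp
next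
  case (add f g)
  then show ?case by (simp add: skew_add phi_bern_add linop_add[OF linop_aop] phi_add)
next
  case (psum k P)
  note IH = psum(2)[OF psum(3)] and k = psum(1)
  let ?Q = "skew G P"
  have D: "D k ?Q = skew (psum k * G) P" using k by (simp add: skew_mult skew_psum)
  have "phi_bern d r (psum k * ?Q) = phi d (aop r (D k ?Q)) + bb d k * phi d (aop r ?Q)
     + phi d (aop (r - int k) ?Q) - phi d (aop (r + int k) ?Q)"
    unfolding phi_bern_psum[OF k psum(3)] D IH ..
  also have "\<dots> = phi d (aop r (psum k * ?Q))"
    using k psum(3) by (simp add: aop_psum phi_diff phi_add phi_psum D_aop aa_def)
  finally show ?case
    using IH[of r "D k G"] k
    by (simp add: skew_psum_mult phi_bern_add linop_add[OF linop_aop] phi_add)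
qed

lemma phi_bern_eq: "d \<noteq> Empty \<Longrightarrow> phi_bern d r P = phi d (aop r P)"
  using phi_bern_eq_skew[of d r 1 P] by simp

section \<open>The pairing with Schur functions, shape by shape\<close>

lemma bern_pred_bern: "bern (r - 1) (bern r P) = 0"
  using bern_straight[of "r - 1" r P] by simp

text \<open>For r above m the operator \<open>aop r\<close> gives 0, so lowering r by 1 preserves
  the value. At r = m the correction term vanishes by \<open>bern_pred_bern\<close>, and
  \<open>aop\<close> removes both copies of m.\<close>

lemma phi_sch_Cell: "is_partition \<mu> \<Longrightarrow> phi Cell (sch \<mu>) = 1"
proof (induction \<mu> rule: induct_list012)
  case (2 r)
  then show ?case by (simp add: bern_1 phi_hh hh_val_def)
next
  case (3 r m \<mu>)
  have p: "\<forall>x\<in>set \<mu>. x \<le> m" "m > 0" "is_partition \<mu>" "r \<ge> m" using "3.prems" by (auto simp: is_partition_Cons)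
  from p(4) have "phi Cell (bern (int r) (sch (m # \<mu>))) = 1"
  proof (induction r rule: dec_induct)
    case base
    show ?case
      using phi_bern_eq[of Cell "int m" "sch (m # \<mu>)"] "3.IH"(1)[OF p(3)]
        aop_sch_Cons[OF p(1,2)] bern_pred_bern[of "int m" "sch \<mu>"] by (simp add: phi_bern_def)
  next
    case (step r)
    have "aop (int (Suc r)) (sch (m # \<mu>)) = 0"
      using step p by (intro aop_sch_eq_0) auto
    then show ?case
      using phi_bern_eq[of Cell "int (Suc r)" "sch (m # \<mu>)"] step by (simp add: phi_bern_def)
  qed
  then show ?case by simp
qed (simp add: phi_1)

text \<open>All columns are even exactly if the rows, taken from the top, form pairs of equal
  length.\<close>

lemma VDomino_partitions:
  "[] \<in> symb_partitions VDomino" "[r] \<notin> symb_partitions VDomino"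
  "r # m # \<mu> \<in> symb_partitions VDomino \<longleftrightarrow> r = m \<and> r > 0 \<and> (\<forall>x\<in>set \<mu>. x \<le> r) \<and> \<mu> \<in> symb_partitions VDomino"
proof -
  show "[] \<in> symb_partitions VDomino" by simp
  show "[r] \<notin> symb_partitions VDomino"
    by (auto simp: is_partition_Cons intro!: exI[of _ 0])
  have eq: "r = m" if "is_partition (r # m # \<mu>)" "\<forall>j. even (length (filter (\<lambda>x. j < x) (r # m # \<mu>)))"
  proof (rule ccontr)
    assume "r \<noteq> m"
    then have "r > m" using that(1) by (auto simp: is_partition_Cons)
    moreover have "filter (\<lambda>x. m < x) \<mu> = []"
      using that(1) by (auto simp: is_partition_Cons filter_empty_conv not_less)
    \<comment> \<open>The column with index m meets only the first row, so it has length 1.\<close>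
    ultimately show False using that(2)[rule_format, of m] by simp
  qed
  have ev: "even (length (filter (\<lambda>x. j < x) (r # r # \<mu>))) \<longleftrightarrow> even (length (filter (\<lambda>x. j < x) \<mu>))" for j
    by simp
  show "r # m # \<mu> \<in> symb_partitions VDomino \<longleftrightarrow> r = m \<and> r > 0 \<and> (\<forall>x\<in>set \<mu>. x \<le> r) \<and> \<mu> \<in> symb_partitions VDomino"
  proof (cases "r = m")
    case True
    then show ?thesis by (simp only: symb_partitions.simps mem_Collect_eq is_partition_Cons ev) auto
  next
    case False
    then have "\<not> (is_partition (r # m # \<mu>) \<and> (\<forall>j. even (length (filter (\<lambda>x. j < x) (r # m # \<mu>)))))"
      using eq by blast
    then show ?thesis using False by (simp only: symb_partitions.simps mem_Collect_eq simp_thms)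
  qed
qed

text \<open>There is no correction term here, so the value is that of \<open>aop r\<close>: it
  removes a pair of equal first rows and annihilates if the first row is longer than the
  second.\<close>

lemma phi_sch_VDomino: "is_partition \<mu> \<Longrightarrow> phi VDomino (sch \<mu>) = (if \<mu> \<in> symb_partitions VDomino then 1 else 0)"
proof (induction \<mu> rule: induct_list012)
  case 1
  then show ?case using VDomino_partitions(1) by (simp add: phi_1)
next
  case (2 r)
  then show ?case using VDomino_partitions(2)[of r] by (simp add: bern_1 phi_hh hh_val_def is_partition_Cons)
next
  case (3 r m \<mu>)
  have p: "\<forall>x\<in>set \<mu>. x \<le> m" "m > 0" "is_partition \<mu>" "r \<ge> m" using "3.prems" by (auto simp: is_partition_Cons)
  show ?case
  proof (cases "r = m")
    case True
    have "phi VDomino (sch (r # m # \<mu>)) = phi VDomino (sch \<mu>)"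
      using phi_bern_eq[of VDomino "int m" "sch (m # \<mu>)"] aop_sch_Cons[OF p(1,2)] True by (simp add: phi_bern_def)
    then show ?thesis using "3.IH"(1)[OF p(3)] p True by (simp only: VDomino_partitions(3)) auto
  next
    case False
    have "aop (int r) (sch (m # \<mu>)) = 0" using False p by (intro aop_sch_eq_0) auto
    then have "phi VDomino (sch (r # m # \<mu>)) = 0"
      using phi_bern_eq[of VDomino "int r" "sch (m # \<mu>)"] by (simp add: phi_bern_def)
    then show ?thesis using False by (simp only: VDomino_partitions(3)) auto
  qed
qed

text \<open>The correction term has first entries m - 2 and m, and straightening turns them into m -
  1 and m - 1 with a sign. So a pair of equal rows is compared with the next smaller pair.\<close>

lemma phi_HDomino_square:
  assumes "\<forall>x\<in>set \<mu>. x \<le> m" "m > 0"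
  shows "phi HDomino (bern (int m) (sch (m # \<mu>))) =
    phi HDomino (sch \<mu>) - phi HDomino (bern (int m - 1) (bern (int m - 1) (sch \<mu>)))"
  using phi_bern_eq[of HDomino "int m" "sch (m # \<mu>)"] aop_sch_Cons[OF assms]
    bern_straight[of "int m - 2" "int m" "sch \<mu>"]
  by (simp add: phi_bern_def phi_uminus algebra_simps)

text \<open>By \<open>phi_HDomino_square\<close> the values for m and m - 1 add up to that of \<mu>.
  At m = l, the first part of \<mu>, the other term is 0 by \<open>bern_pred_bern\<close>, so the
  values alternate from there on.\<close>

lemma phi_HDomino_square_val:
  assumes "is_partition \<mu>" "\<forall>x\<in>set \<mu>. x \<le> m"
  shows "phi HDomino (bern (int m) (sch (m # \<mu>))) =
    (if even (m - (if \<mu> = [] then 0 else hd \<mu>)) then phi HDomino (sch \<mu>) else 0)"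
proof -
  define l where "l = (if \<mu> = [] then 0 else hd \<mu>)"
  have "l \<le> m" using assms unfolding l_def by (cases \<mu>) auto
  then have "phi HDomino (bern (int m) (sch (m # \<mu>))) = (if even (m - l) then phi HDomino (sch \<mu>) else 0)"
  proof (induction m rule: dec_induct)
    case base
    show ?case
    proof (cases \<mu>)
      case Nil
      then show ?thesis by (simp add: l_def bern_1)
    next
      case (Cons l' \<kappa>)
      then have *: "\<forall>x\<in>set \<mu>. x \<le> l" "l > 0" "sch \<mu> = bern (int l) (sch \<kappa>)"
        using assms by (auto simp: l_def is_partition_Cons)
      have "bern (int l - 1) (bern (int l - 1) (sch \<mu>)) = 0"
        unfolding *(3) bern_pred_bern by (rule bern_0)
      then show ?thesis using phi_HDomino_square[OF *(1,2)] by simp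
    qed
  next
    case (step m)
    have "\<forall>x\<in>set \<mu>. x \<le> Suc m"
    proof (cases \<mu>)
      case (Cons l' \<kappa>)
      then show ?thesis using assms(1) step(1) by (auto simp: l_def is_partition_Cons)
    qed simp
    from phi_HDomino_square[OF this] step show ?case by (simp add: Suc_diff_le)
  qed
  then show ?thesis by (simp add: l_def)
qed

lemma HDomino_partitions:
  "[] \<in> symb_partitions HDomino"
  "r # \<mu> \<in> symb_partitions HDomino \<longleftrightarrow> is_partition (r # \<mu>) \<and> even r \<and> \<mu> \<in> symb_partitions HDomino"
  by (auto simp: is_partition_Cons)

text \<open>Above m the value is periodic in r with period 2 since \<open>aop r\<close> gives 0. It
  vanishes at r = m + 1 by \<open>bern_pred_bern\<close>, and at r = m it is the value for a pair of
  equal rows.\<close>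

lemma phi_sch_HDomino: "is_partition \<mu> \<Longrightarrow> phi HDomino (sch \<mu>) = (if \<mu> \<in> symb_partitions HDomino then 1 else 0)"
proof (induction \<mu> rule: induct_list012)
  case 1
  then show ?case by (simp add: phi_1)
next
  case (2 r)
  then show ?case by (simp add: bern_1 phi_hh hh_val_def is_partition_Cons)
next
  case (3 r m \<mu>)
  let ?x = "phi HDomino (bern (int m) (sch (m # \<mu>)))"
  have p: "\<forall>x\<in>set \<mu>. x \<le> m" "m > 0" "is_partition \<mu>" "r \<ge> m" using "3.prems" by (auto simp: is_partition_Cons)
  from p(4) have r: "phi HDomino (bern (int r) (sch (m # \<mu>))) = (if even (r - m) then ?x else 0)"
  proof (induction r rule: less_induct)
    case (less r)
    have z: "aop (int r) (sch (m # \<mu>)) = 0" if "r > m"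
      using that p by (intro aop_sch_eq_0) auto
    consider "r = m" | "r = Suc m" | "r \<ge> m + 2" using less.prems by linarith
    then show ?case
    proof cases
      case 2
      have "phi_bern HDomino (int r) (sch (m # \<mu>)) = 0"
        using z 2 by (simp add: phi_bern_eq)
      then show ?thesis using 2 bern_pred_bern[of "int m" "sch \<mu>"] by (simp add: phi_bern_def)
    next
      case 3
      have "phi_bern HDomino (int r) (sch (m # \<mu>)) = 0"
        using z 3 by (simp add: phi_bern_eq)
      then have "phi HDomino (bern (int r) (sch (m # \<mu>))) = phi HDomino (bern (int (r - 2)) (sch (m # \<mu>)))"
        using 3 by (simp add: phi_bern_def of_nat_diff)
      then show ?thesis using less.IH[of "r - 2"] 3 by (simp add: diff_right_commute)
    qed simp
  qed
  have "?x = (if even (m - (if \<mu> = [] then 0 else hd \<mu>)) then phi HDomino (sch \<mu>) else 0)"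
    by (rule phi_HDomino_square_val[OF p(3,1)])
  also have "\<dots> = (if even m \<and> \<mu> \<in> symb_partitions HDomino then 1 else 0)"
  proof (cases \<mu>)
    case Nil
    then show ?thesis by (simp add: phi_1)
  next
    case (Cons l \<kappa>)
    then show ?thesis using "3.IH"(1)[OF p(3)] p by (auto simp: is_partition_Cons)
  qed
  finally have x: "?x = (if even m \<and> \<mu> \<in> symb_partitions HDomino then 1 else 0)" .
  have "phi HDomino (sch (r # m # \<mu>)) = (if even (r - m) then ?x else 0)"
    using r by simp
  also have "\<dots> = (if r # m # \<mu> \<in> symb_partitions HDomino then 1 else 0)"
    unfolding x HDomino_partitions(2) using "3.prems" p by (auto simp: is_partition_Cons)
  finally show ?case .
qed

lemma symb_partitions_partition: "\<mu> \<in> symb_partitions d \<Longrightarrow> is_partition \<mu>"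
  by (cases d) auto

lemma phi_sch: "is_partition \<mu> \<Longrightarrow> phi d (sch \<mu>) = (if \<mu> \<in> symb_partitions d then 1 else 0)"
proof (cases d)
  case Empty
  assume \<mu>: "is_partition \<mu>"
  have "phi d (sch \<mu>) = form (sch \<mu>) (sch [])" using Empty by (simp add: phi_def)
  also have "\<dots> = (if \<mu> \<in> symb_partitions d then 1 else 0)"
    by (subst form_sch[OF \<mu>]) (use Empty in auto)
  finally show ?thesis .
qed (auto simp: phi_sch_Cell phi_sch_HDomino phi_sch_VDomino simp del: foldr.simps)

lemma homogeneous_skew:
  assumes "homogeneous n F" "homogeneous (n + k) P"
  shows "homogeneous k (skew F P)"
  unfolding homogeneous_def
proof
  fix m assume "m \<in> Poly_Mapping.keys (skew F P)"
  then have "form P (F * Poly_Mapping.single m 1) \<noteq> 0"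
    by (simp add: keys_form form_skew)
  moreover have "homogeneous (n + weight m) (F * Poly_Mapping.single m 1)"
    by (intro homogeneous_mult assms) (auto simp: homogeneous_def)
  ultimately show "weight m = k" using form_homogeneous[OF assms(2)] by force
qed

lemma homogeneous_bern:
  assumes "homogeneous n P"
  shows "homogeneous (r + n) (bern (int r) P)"
  unfolding bern_eq[OF homogeneous_dle[OF assms] finite_atLeastAtMost_int order.refl]
proof (intro homogeneous_sum)
  fix j assume j: "j \<in> {0..int n}"
  then have "homogeneous (n - nat j) (skew (ee j) P)"
    using assms by (intro homogeneous_skew[OF homogeneous_ee]) auto
  from homogeneous_mult[OF homogeneous_hh[of "int r + j"] this]
  show "homogeneous (r + n) (hh (int r + j) * skew (ee j) P)" using j by (simp add: nat_add_distrib add.assoc) (metis nat_le_iff le_add_diff_inverse)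
qed

lemma homogeneous_sch: "homogeneous (sum_list \<mu>) (sch \<mu>)"
  by (induction \<mu>) (auto simp: homogeneous_bern)

lemma finite_partitions: "finite {\<mu>. is_partition \<mu> \<and> sum_list \<mu> = n}"
proof (rule finite_subset)
  show "{\<mu>. is_partition \<mu> \<and> sum_list \<mu> = n} \<subseteq> {\<mu>. set \<mu> \<subseteq> {..n} \<and> length \<mu> \<le> n}"
  proof safe
    fix \<mu> :: "nat list"
    assume "is_partition \<mu>"
    then show "length \<mu> \<le> sum_list \<mu>"
      by (induction \<mu>) (auto simp: is_partition_Cons)
    show "x \<le> sum_list \<mu>" if "x \<in> set \<mu>" for x using that by (intro member_le_sum_list) auto
  qed
qed (rule finite_lists_length_le, simp)

lemma form_eqI_sch:
  assumes "\<And>\<kappa>. is_partition \<kappa> \<Longrightarrow> form f (sch \<kappa>) = form g (sch \<kappa>)"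
  shows "f = g"
proof (rule form_nondegenerate)
  fix u
  have "u \<in> schur_span" by (rule schur_span_UNIV)
  then show "form f u = form g u"
    by induction (auto simp: assms form_add_right form_const_right)
qed

definition symb_partitions_of :: "symb \<Rightarrow> nat \<Rightarrow> nat list set" where
  "symb_partitions_of d n = {\<mu> \<in> symb_partitions d. sum_list \<mu> = n}"

lemma finite_symb_partitions_of: "finite (symb_partitions_of d n)"
  by (rule finite_subset[OF _ finite_partitions[of n]])
    (auto simp: symb_partitions_of_def symb_partitions_partition)

text \<open>Compared by pairing with all Schur functions. By degree,
  \<open>phi d (sch \<kappa>)\<close> sees only the component of \<Omega>[f] of degree
  |\<kappa>|.\<close>

lemma littlewood: "fps_nth (Omega (f_symb d)) n = (\<Sum>\<mu>\<in>symb_partitions_of d n. sch \<mu>)"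
proof (rule form_eqI_sch)
  fix \<kappa> assume \<kappa>: "is_partition \<kappa>"
  let ?F = "Omega (f_symb d)" and ?w = "sum_list \<kappa>"
  have h: "form (fps_nth ?F m) (sch \<kappa>) = 0" if "m \<noteq> ?w" for m
    using form_homogeneous[OF homogeneous_Omega homogeneous_sch] that by blast
  have "phi d (sch \<kappa>) = (\<Sum>m\<le>?w. form (fps_nth ?F m) (sch \<kappa>))"
    unfolding phi_def
    by (subst series_perp_eq[OF graded_Omega homogeneous_dle[OF homogeneous_sch], of "{..?w}"])
      (auto simp: form_sum_left form_skew form_sym[of "sch \<kappa>"])
  also have "\<dots> = (\<Sum>m\<le>?w. if m = ?w then form (fps_nth ?F m) (sch \<kappa>) else 0)"
    by (intro sum.cong) (auto simp: h)
  finally have 1: "form (fps_nth ?F ?w) (sch \<kappa>) = (if \<kappa> \<in> symb_partitions d then 1 else 0)"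
    using phi_sch[OF \<kappa>, of d] by simp
  have "form (\<Sum>\<mu>\<in>symb_partitions_of d n. sch \<mu>) (sch \<kappa>)
    = (\<Sum>\<mu>\<in>symb_partitions_of d n. if \<mu> = \<kappa> then 1 else 0)"
    unfolding form_sum_left
    by (intro sum.cong refl form_sch \<kappa>) (auto simp: symb_partitions_of_def symb_partitions_partition)
  also have "\<dots> = (if \<kappa> \<in> symb_partitions_of d n then 1 else 0)"
    using finite_symb_partitions_of by simp
  finally show "form (fps_nth ?F n) (sch \<kappa>) = form (\<Sum>\<mu>\<in>symb_partitions_of d n. sch \<mu>) (sch \<kappa>)"
    using 1 h[of n] by (cases "n = ?w") (auto simp: symb_partitions_of_def)
qed

section \<open>The t-analogue of an operator\<close>

text \<open>\<open>act_Y\<close> followed by Y := X in a single step, so that the result of V stays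
  in one alphabet.\<close>

definition act_lin :: "(sym \<Rightarrow> sym) \<Rightarrow> sym2 \<Rightarrow> sym" where
  "act_lin V F = (\<Sum>m\<in>Poly_Mapping.keys F. Poly_Mapping.lookup F m * V (Poly_Mapping.single m 1))"

lemma id_ring_hom: "comm_ring_hom (\<lambda>f :: 'a::comm_ring_1. f)"
  by unfold_locales auto

lemma const_const_ring_hom: "comm_ring_hom (\<lambda>c :: 'a::comm_ring_1. const (const c))"
  by unfold_locales (auto simp: const_add const_mult)

lemma Y_to_X_Y_part: "Y_to_X (Y_part f) = f"
  by (induction f rule: psum_poly_induct)
    (simp_all add: Y_to_X_def Y_part_def X_part_def psubst_const psubst_add psubst_psum_mult
      const_const_ring_hom id_ring_hom)

lemma Y_to_X_act_Y: "Y_to_X (act_Y V F) = act_lin V F"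
proof -
  interpret comm_ring_hom Y_to_X unfolding Y_to_X_def by (rule psubst_hom[OF id_ring_hom])
  have "Y_to_X (X_part f) = f" for f by (simp add: Y_to_X_def X_part_def psubst_const id_ring_hom)
  then show ?thesis by (simp add: act_Y_def act_lin_def hom_sum hom_mult Y_to_X_Y_part)
qed

lemma act_lin_add: "act_lin V (F + G) = act_lin V F + act_lin V G"
  unfolding act_lin_def by (rule setsum_keys_plus_distrib) (auto simp: distrib_right)

lemma act_lin_single: "act_lin V (Poly_Mapping.single m f) = f * V (Poly_Mapping.single m 1)"
  by (cases "f = 0") (auto simp: act_lin_def)

lemma act_lin_0 [simp]: "act_lin V 0 = 0"
  by (simp add: act_lin_def)

lemma act_lin_const: "act_lin V (const f) = f * V 1"
  by (simp add: const_def act_lin_single)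

lemma act_lin_const_mult: "act_lin V (const f * F) = f * act_lin V F"
  by (rule additive_single_induct[of "\<lambda>F. act_lin V (const f * F)" "\<lambda>F. f * act_lin V F"])
    (auto simp: distrib_left act_lin_add const_mult_single act_lin_single)

lemma act_lin_psum_mult: "act_lin V (psum k * F) = act_lin (\<lambda>P. V (psum k * P)) F"
  by (rule additive_single_induct[of "\<lambda>F. act_lin V (psum k * F)" "\<lambda>F. act_lin (\<lambda>P. V (psum k * P)) F"])
    (auto simp: distrib_left act_lin_add psum_mult_single act_lin_single)

abbreviation qq :: coeff where "qq \<equiv> tt ^ 2"

definition Delta :: "sym \<Rightarrow> sym2" where
  "Delta P = pleth2 P (X_part (const qq * XX) + Y_part (const (1 - qq) * XX))"

abbreviation TA :: "(sym \<Rightarrow> sym) \<Rightarrow> sym \<Rightarrow> sym" where "TA \<equiv> t_analogue qq"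

lemma TA_eq: "TA V P = act_lin V (Delta P)"
  by (simp add: t_analogue_def Y_to_X_act_Y Delta_def)

lemma adams_coeff_qq: "adams_coeff k qq = qq ^ k"
  by (simp add: adams_coeff_power adams_coeff_tt power_mult[symmetric] mult.commute)

lemma adams2_Delta_arg:
  "adams2 k (X_part (const qq * XX) + Y_part (const (1 - qq) * XX)) =
     const (const (qq ^ k) * psum k) + const (const (1 - qq ^ k)) * psum k"
proof -
  have Y: "Y_part (const (1 - qq) * XX) = const (const (1 - qq)) * psum 1"
    by (simp add: Y_part_def X_part_def psubst_mult psubst_const psubst_psum const_const_ring_hom)
  have h: "comm_ring_hom (\<lambda>f. const (adams k f))"
  proof -
    interpret comm_ring_hom "adams k" by (rule adams_hom)
    show ?thesis by unfold_locales (auto simp: hom_add hom_mult const_add const_mult)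
  qed
  interpret comm_ring_hom "adams_coeff k" by (rule adams_coeff_hom)
  have q: "adams_coeff k (1 - qq) = 1 - qq ^ k"
    using hom_minus[of 1 qq] by (simp add: adams_coeff_qq)
  show ?thesis
    unfolding adams2_def Y X_part_def
    by (simp add: psubst_add[OF h] psubst_mult[OF h] psubst_psum[OF h]
        psubst_const[OF h] adams_mult adams_const adams_psum adams_coeff_qq q)
qed

lemma Delta_const: "Delta (const c) = const (const c)"
  by (simp add: Delta_def pleth2_def X_part_def psubst_const const_const_ring_hom)

lemma Delta_add: "Delta (P + Q) = Delta P + Delta Q"
  by (simp add: Delta_def pleth2_def X_part_def psubst_add const_const_ring_hom)

lemma Delta_const_mult: "Delta (const c * P) = const (const c) * Delta P"
  by (simp add: Delta_def pleth2_def X_part_def psubst_const_mult const_const_ring_hom)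

lemma Delta_psum_mult:
  "k \<ge> 1 \<Longrightarrow> Delta (psum k * P) =
     (const (const (qq ^ k) * psum k) + const (const (1 - qq ^ k)) * psum k) * Delta P"
  unfolding adams2_Delta_arg[symmetric]
  by (simp add: Delta_def pleth2_def X_part_def psubst_psum_mult const_const_ring_hom)

text \<open>From \<open>p\<^sub>k[qX + (1-q)Y] = q\<^sup>k p\<^sub>k[X] + (1 - q\<^sup>k)
  p\<^sub>k[Y]\<close>: the first part stays outside V, the second is passed to V. Hence a
  commutator with \<open>p\<^sub>k\<close> gets multiplied by \<open>1 - q\<^sup>k\<close>.\<close>

lemma TA_psum:
  "k \<ge> 1 \<Longrightarrow> TA V (psum k * P) = const (qq ^ k) * psum k * TA V P + const (1 - qq ^ k) * TA (\<lambda>P. V (psum k * P)) P"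
  by (simp only: TA_eq Delta_psum_mult distrib_right act_lin_add act_lin_const_mult mult.assoc act_lin_psum_mult)

lemma linop_TA: "linop (TA V)"
  by (simp add: linop_def TA_eq Delta_add act_lin_add Delta_const_mult act_lin_const_mult)

lemma TA_1: "TA V 1 = V 1"
  using Delta_const[of 1] act_lin_const[of V 1] by (simp add: TA_eq)

lemma TA_op_add: "TA (\<lambda>P. V P + W P) P = TA V P + TA W P"
  by (simp add: TA_eq act_lin_def distrib_left sum.distrib)

lemma TA_op_mult: "TA (\<lambda>P. f * V P) P = f * TA V P"
  by (simp add: TA_eq act_lin_def sum_distrib_left mult.left_commute)

lemma TA_op_0: "TA (\<lambda>P. 0) P = 0"
  by (simp add: TA_eq act_lin_def)

lemma TA_op_uminus: "TA (\<lambda>P. - V P) P = - TA V P"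
  by (simp add: TA_eq act_lin_def sum_negf)

lemma TA_op_diff: "TA (\<lambda>P. V P - W P) P = TA V P - TA W P"
  by (simp add: TA_eq act_lin_def right_diff_distrib sum_subtractf)

lemma TA_op_sum: "TA (\<lambda>P. \<Sum>i\<in>A. V i P) P = (\<Sum>i\<in>A. TA (V i) P)"
  by (induction A rule: infinite_finite_induct) (auto simp: TA_op_0 TA_op_add)

section \<open>Commutation with multiplication by power sums\<close>

abbreviation bump :: "int list \<Rightarrow> nat \<Rightarrow> int \<Rightarrow> int list" where
  "bump \<nu> i k \<equiv> \<nu>[i := \<nu> ! i + k]"

text \<open>For the generating series \<open>W(Z)\<close> of the family, \<open>commutes\<close> says
  \<open>W(Z) p\<^sub>k = (p\<^sub>k - x\<^sub>k p\<^sub>k[Z\<^sup>-\<^sup>1] - y\<^sub>k p\<^sub>k[Z]) W(Z)\<close>, and \<open>covariant\<close> says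
  \<open>p\<^sub>k\<^sup>\<bottom> W(Z) = W(Z) (p\<^sub>k\<^sup>\<bottom> + p\<^sub>k[Z])\<close>.\<close>

definition commutes :: "nat \<Rightarrow> (nat \<Rightarrow> coeff) \<Rightarrow> (nat \<Rightarrow> coeff) \<Rightarrow> (int list \<Rightarrow> sym \<Rightarrow> sym) \<Rightarrow> bool" where
  "commutes n x y W \<longleftrightarrow> (\<forall>k\<ge>1. \<forall>\<nu> P. length \<nu> = n \<longrightarrow>
     W \<nu> (psum k * P) = psum k * W \<nu> P - const (x k) * (\<Sum>i<n. W (bump \<nu> i (int k)) P)
       - const (y k) * (\<Sum>i<n. W (bump \<nu> i (- int k)) P))"

definition covariant :: "nat \<Rightarrow> (int list \<Rightarrow> sym \<Rightarrow> sym) \<Rightarrow> bool" where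
  "covariant n W \<longleftrightarrow> (\<forall>k\<ge>1. \<forall>\<nu> P. length \<nu> = n \<longrightarrow>
     D k (W \<nu> P) = W \<nu> (D k P) + (\<Sum>i<n. W (bump \<nu> i (- int k)) P))"

lemma bl_psum: "k \<ge> 1 \<Longrightarrow> bl \<nu> (psum k * P) = psum k * bl \<nu> P - (\<Sum>i<length \<nu>. bl (bump \<nu> i (int k)) P)"
proof (induction \<nu>)
  case (Cons r \<nu>)
  have "bl (r # \<nu>) (psum k * P) = psum k * bl (r # \<nu>) P - bern (r + int k) (bl \<nu> P)
      - (\<Sum>i<length \<nu>. bern r (bl (bump \<nu> i (int k)) P))"
    using Cons by (simp add: bern_diff bern_psum linop_sum[OF linop_bern])
  then show ?case by (simp add: sum.lessThan_Suc_shift del: sum.lessThan_Suc)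
qed simp

lemma D_bl: "k \<ge> 1 \<Longrightarrow> D k (bl \<nu> P) = bl \<nu> (D k P) + (\<Sum>i<length \<nu>. bl (bump \<nu> i (- int k)) P)"
proof (induction \<nu>)
  case (Cons r \<nu>)
  have "D k (bl (r # \<nu>) P) = bl (r # \<nu>) (D k P) + bern (r - int k) (bl \<nu> P)
      + (\<Sum>i<length \<nu>. bern r (bl (bump \<nu> i (- int k)) P))"
    using Cons by (simp add: bern_add D_bern linop_sum[OF linop_bern])
  then show ?case by (simp add: sum.lessThan_Suc_shift del: sum.lessThan_Suc)
qed simp

lemma commutes_bl: "commutes n (\<lambda>k. 1) (\<lambda>k. 0) bl"
  by (auto simp: commutes_def bl_psum)

lemma covariant_bl: "covariant n bl"
  by (auto simp: covariant_def D_bl)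

lemma commutes_TA:
  assumes "commutes n x y W"
  shows "commutes n (\<lambda>k. (1 - qq ^ k) * x k) (\<lambda>k. (1 - qq ^ k) * y k) (\<lambda>\<nu>. TA (W \<nu>))"
  unfolding commutes_def
proof (intro allI impI)
  fix k :: nat and \<nu> :: "int list" and P
  assume k: "1 \<le> k" and n: "length \<nu> = n"
  have "(\<lambda>P. W \<nu> (psum k * P)) = (\<lambda>P. psum k * W \<nu> P - const (x k) * (\<Sum>i<n. W (bump \<nu> i (int k)) P)
       - const (y k) * (\<Sum>i<n. W (bump \<nu> i (- int k)) P))"
    using assms k n by (simp add: commutes_def)
  then have t: "TA (\<lambda>P. W \<nu> (psum k * P)) P = psum k * TA (W \<nu>) P - const (x k) * (\<Sum>i<n. TA (W (bump \<nu> i (int k))) P)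
       - const (y k) * (\<Sum>i<n. TA (W (bump \<nu> i (- int k))) P)"
    by (simp only: TA_op_diff TA_op_mult TA_op_sum)
  show "TA (W \<nu>) (psum k * P) = psum k * TA (W \<nu>) P
      - const ((1 - qq ^ k) * x k) * (\<Sum>i<n. TA (W (bump \<nu> i (int k))) P)
      - const ((1 - qq ^ k) * y k) * (\<Sum>i<n. TA (W (bump \<nu> i (- int k))) P)"
    unfolding TA_psum[OF k] t by (simp add: const_diff const_mult algebra_simps)
qed

text \<open>Passing F, \<open>p\<^sub>k\<close> acquires a \<open>D k\<close> + b. Passing W, the
  derivation leaves behind -a \<open>p\<^sub>k[Z]\<close>. Passing F', \<open>p\<^sub>k\<close>
  acquires -a \<open>D k\<close> - b. The derivations and the constants cancel, and the term in
  \<open>p\<^sub>k[Z]\<close> stays.\<close>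

lemma commutes_conj:
  assumes W: "commutes n x (\<lambda>k. 0) W" "covariant n W" "\<And>\<nu>. linop (W \<nu>)"
    and F: "quadratic a b F" and F': "quadratic (\<lambda>k. - a k) (\<lambda>k. - b k) F'"
  shows "commutes n x a (\<lambda>\<nu>. series_perp F' \<circ> W \<nu> \<circ> series_perp F)"
  unfolding commutes_def
proof (intro allI impI)
  fix k :: nat and \<nu> :: "int list" and P
  assume k: "1 \<le> k" and n: "length \<nu> = n"
  let ?Q = "series_perp F P"
  have g: "graded F" "graded F'" using F F' by (auto simp: quadratic_def)
  note lin = linop_add[OF linop_series_perp[OF g(2)]] linop_diff[OF linop_series_perp[OF g(2)]]
    linop_const_mult[OF linop_series_perp[OF g(2)]] linop_sum[OF linop_series_perp[OF g(2)]]
  have 1: "series_perp F (psum k * P) = psum k * ?Q + const (a k) * D k ?Q + const (b k) * ?Q"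
    using quadratic_psum[OF F k] D_series_perp[OF k g(1)] by simp
  have 2: "W \<nu> (psum k * ?Q) = psum k * W \<nu> ?Q - const (x k) * (\<Sum>i<n. W (bump \<nu> i (int k)) ?Q)"
    using W(1) k n by (simp add: commutes_def)
  have 3: "W \<nu> (D k ?Q) = D k (W \<nu> ?Q) - (\<Sum>i<n. W (bump \<nu> i (- int k)) ?Q)"
    using W(2) k n by (simp add: covariant_def)
  have 4: "series_perp F' (psum k * R) = psum k * series_perp F' R - const (a k) * series_perp F' (D k R)
      - const (b k) * series_perp F' R" for R
    using quadratic_psum[OF F' k, of R] by (simp add: const_minus)
  show "(series_perp F' \<circ> W \<nu> \<circ> series_perp F) (psum k * P) =
      psum k * (series_perp F' \<circ> W \<nu> \<circ> series_perp F) P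
      - const (x k) * (\<Sum>i<n. (series_perp F' \<circ> W (bump \<nu> i (int k)) \<circ> series_perp F) P)
      - const (a k) * (\<Sum>i<n. (series_perp F' \<circ> W (bump \<nu> i (- int k)) \<circ> series_perp F) P)"
    unfolding comp_def 1
    by (simp only: linop_add[OF W(3)] linop_const_mult[OF W(3)] 2 3 lin 4 right_diff_distrib) simp
qed

lemma bump_commute: "bump (bump \<nu> i a) l b = bump (bump \<nu> l b) i a"
proof (cases "i = l")
  case True
  then show ?thesis by (cases "l < length \<nu>") (auto simp: list_update_beyond add_ac)
next
  case False
  then show ?thesis by (simp add: list_update_swap)
qed

text \<open>The value at 1 propagates to all arguments: raising an entry by j (from
  \<open>p\<^sub>j\<close>) commutes with lowering an entry by k (from \<open>D k\<close>), and the
  commutator of \<open>D k\<close> and \<open>p\<^sub>k\<close> is a number, which the linear W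
  respects.\<close>

lemma covariant_of_commutes:
  assumes W: "commutes n x (\<lambda>k. 0) W" "\<And>\<nu>. linop (W \<nu>)"
    and 1: "\<And>k \<nu>. k \<ge> 1 \<Longrightarrow> length \<nu> = n \<Longrightarrow> D k (W \<nu> 1) = (\<Sum>i<n. W (bump \<nu> i (- int k)) 1)"
  shows "covariant n W"
proof -
  have "D k (W \<nu> P) = W \<nu> (D k P) + (\<Sum>i<n. W (bump \<nu> i (- int k)) P)"
    if k: "k \<ge> 1" and "length \<nu> = n" for k \<nu> P
    using that(2)
  proof (induction P arbitrary: \<nu> rule: psum_poly_induct)
    case (const c)
    have "W \<mu> (const c) = const c * W \<mu> 1" for \<mu>
      using linop_const_mult[OF W(2), of _ c 1] by simp
    then show ?case using 1[OF k const] by (simp add: D_const_mult linop_0[OF W(2)] sum_distrib_left[symmetric])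
  next
    case (add f g)
    then show ?case by (simp add: D_add linop_add[OF W(2)] sum.distrib)
  next
    case (psum j P)
    let ?c = "const (x j)"
    let ?S = "\<lambda>Q. \<Sum>i<n. W (bump \<nu> i (int j)) Q"
    have Wj: "W \<mu> (psum j * Q) = psum j * W \<mu> Q - ?c * (\<Sum>i<n. W (bump \<mu> i (int j)) Q)" if "length \<mu> = n" for \<mu> Q
      using W(1) psum(1) that by (simp add: commutes_def)
    have IH: "D k (W \<mu> P) = W \<mu> (D k P) + (\<Sum>i<n. W (bump \<mu> i (- int k)) P)" if "length \<mu> = n" for \<mu>
      using psum(2) that by blast
    have "D k (W \<nu> (psum j * P)) = (if j = k then of_nat k * W \<nu> P else 0) + psum j * D k (W \<nu> P)
        - ?c * (\<Sum>i<n. D k (W (bump \<nu> i (int j)) P))"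
      using psum(1,3) k by (simp add: Wj D_diff D_psum_mult D_const_mult D_sum)
    also have "\<dots> = (if j = k then of_nat k * W \<nu> P else 0) + psum j * W \<nu> (D k P)
        + psum j * (\<Sum>l<n. W (bump \<nu> l (- int k)) P) - ?c * ?S (D k P)
        - ?c * (\<Sum>i<n. \<Sum>l<n. W (bump (bump \<nu> i (int j)) l (- int k)) P)"
      using psum(3) by (simp add: IH sum.distrib algebra_simps)
    also have "(\<Sum>i<n. \<Sum>l<n. W (bump (bump \<nu> i (int j)) l (- int k)) P)
        = (\<Sum>l<n. \<Sum>i<n. W (bump (bump \<nu> l (- int k)) i (int j)) P)"
      by (subst sum.swap) (simp only: bump_commute)
    also have "(if j = k then of_nat k * W \<nu> P else 0) + psum j * W \<nu> (D k P)
        + psum j * (\<Sum>l<n. W (bump \<nu> l (- int k)) P) - ?c * ?S (D k P)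
        - ?c * (\<Sum>l<n. \<Sum>i<n. W (bump (bump \<nu> l (- int k)) i (int j)) P)
      = ((if j = k then of_nat k * W \<nu> P else 0) + W \<nu> (psum j * D k P))
        + (\<Sum>l<n. W (bump \<nu> l (- int k)) (psum j * P))"
    proof -
      have "(\<Sum>l<n. W (bump \<nu> l (- int k)) (psum j * P)) = (\<Sum>l<n. psum j * W (bump \<nu> l (- int k)) P
          - ?c * (\<Sum>i<n. W (bump (bump \<nu> l (- int k)) i (int j)) P))"
        by (intro sum.cong refl Wj) (simp add: psum(3))
      then show ?thesis
        unfolding Wj[OF psum(3)] sum_subtractf sum_distrib_left[symmetric] by simp
    qed
    also have "(if j = k then of_nat k * W \<nu> P else 0) + W \<nu> (psum j * D k P) = W \<nu> (D k (psum j * P))"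
      using psum(1) k linop_const_mult[OF W(2), of \<nu> "of_nat k" P]
      by (auto simp: D_psum_mult linop_add[OF W(2)] linop_0[OF W(2)] const_of_nat)
    finally show ?case .
  qed
  then show ?thesis by (simp add: covariant_def)
qed

lemma linop_H_op: "linop (H_op d \<nu>)"
  unfolding H_op_def Let_def
  by (intro linop_comp linop_series_perp graded_Omega linop_TA)

lemma log_quadratic_f: "log_quadratic (\<lambda>k. aa d) (bb d) (f_symb d)"
  using log_quadratic_quad_f[of 1 d] by (simp add: f_symb_eq)

lemma log_quadratic_ft: "log_quadratic (\<lambda>k. aa d * qq ^ k) (\<lambda>k. bb d k * tt ^ k) (quad_f tt d)"
  using log_quadratic_quad_f[OF adams_coeff_tt, of d] by (simp add: power_mult)

lemma commutes_TA_B_symb: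
  "commutes n (\<lambda>k. 1 - qq ^ k) (\<lambda>k. (1 - qq ^ k) * aa d) (\<lambda>\<nu>. TA (B_symb d \<nu>))"
proof -
  have "commutes n (\<lambda>k. 1) (\<lambda>k. aa d) (B_symb d)"
    unfolding B_symb_def[abs_def] B_op_eq
    by (rule commutes_conj[OF commutes_bl covariant_bl linop_bl quadratic_Omega[OF log_quadratic_f]
          quadratic_Omega[OF log_quadratic_uminus[OF log_quadratic_f]]])
  from commutes_TA[OF this] show ?thesis by simp
qed

lemma commutes_H_op: "commutes n (\<lambda>k. 1 - qq ^ k) (\<lambda>k. (1 - qq ^ k) * aa d) (H_op d)"
proof -
  let ?f = "f_symb d" and ?ft = "quad_f tt d"
  have 1: "commutes n (\<lambda>k. 1 - qq ^ k) (\<lambda>k. 0) (\<lambda>\<nu>. TA (bl \<nu>))"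
    using commutes_TA[OF commutes_bl[of n]] by simp
  \<comment> \<open>\<open>D k\<close> acts after Y has become X and does not pass to the operator
    in Y. Covariance is therefore recovered from the value at 1, where \<open>TA V\<close> and V
    agree.\<close>
  have 2: "covariant n (\<lambda>\<nu>. TA (bl \<nu>))"
    by (rule covariant_of_commutes[OF 1 linop_TA]) (simp add: TA_1 D_bl linop_0[OF linop_bl])
  have q: "quadratic (\<lambda>k. aa d - aa d * qq ^ k) (\<lambda>k. bb d k - bb d k * tt ^ k) (Omega (?f - ?ft))"
    by (intro quadratic_Omega log_quadratic_diff log_quadratic_f log_quadratic_ft)
  have "quadratic (\<lambda>k. aa d * qq ^ k - aa d) (\<lambda>k. bb d k * tt ^ k - bb d k) (Omega (?ft - ?f))"
    by (intro quadratic_Omega log_quadratic_diff log_quadratic_f log_quadratic_ft)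
  then have q': "quadratic (\<lambda>k. - (aa d - aa d * qq ^ k)) (\<lambda>k. - (bb d k - bb d k * tt ^ k)) (Omega (?ft - ?f))"
    by (simp only: minus_diff_eq)
  have "commutes n (\<lambda>k. 1 - qq ^ k) (\<lambda>k. aa d - aa d * qq ^ k) (H_op d)"
    unfolding H_op_def[abs_def] Let_def pleth_f_symb B_op_eq
    by (rule commutes_conj[OF 1 2 linop_TA q q'])
  then show ?thesis by (simp add: algebra_simps)
qed

section \<open>Skewing as a combination of shifts\<close>

definition sub :: "int list \<Rightarrow> int list \<Rightarrow> int list" where
  "sub \<nu> \<alpha> = map2 (-) \<nu> \<alpha>"

lemma length_sub [simp]: "length (sub \<nu> \<alpha>) = min (length \<nu>) (length \<alpha>)"
  by (simp add: sub_def)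

lemma sub_bump: "length \<alpha> = length \<nu> \<Longrightarrow> i < length \<nu> \<Longrightarrow> bump (sub \<nu> \<alpha>) i k = sub (bump \<nu> i k) \<alpha>"
  by (intro nth_equalityI) (auto simp: sub_def nth_list_update)

lemma sub_bump_right:
  "length \<alpha> = length \<nu> \<Longrightarrow> i < length \<nu> \<Longrightarrow> bump (sub \<nu> \<alpha>) i (- k) = sub \<nu> (bump \<alpha> i k)"
  by (intro nth_equalityI) (auto simp: sub_def nth_list_update)

text \<open>The coefficient at \<nu> of g(Z) b(Z), where C lists the terms c
  \<open>Z\<^sup>\<alpha>\<close> of g and b(Z) is the generating series of the family b.\<close>

definition shifts :: "(coeff \<times> int list) list \<Rightarrow> (int list \<Rightarrow> sym) \<Rightarrow> int list \<Rightarrow> sym" where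
  "shifts C b \<nu> = (\<Sum>(c, \<alpha>)\<leftarrow>C. const c * b (sub \<nu> \<alpha>))"

lemma shifts_simps [simp]:
  "shifts [] b \<nu> = 0" "shifts ((c, \<alpha>) # C) b \<nu> = const c * b (sub \<nu> \<alpha>) + shifts C b \<nu>"
  by (simp_all add: shifts_def)

lemma shifts_append: "shifts (C @ C') b \<nu> = shifts C b \<nu> + shifts C' b \<nu>"
  by (simp add: shifts_def)

lemma linop_shifts: "linop V \<Longrightarrow> V (shifts C b \<nu>) = shifts C (\<lambda>\<nu>. V (b \<nu>)) \<nu>"
  by (induction C) (auto simp: linop_0 linop_add linop_const_mult)

text \<open>By \<open>D_bl\<close> the derivation \<open>D k\<close> acts on
  \<open>bl \<nu> 1\<close> by lowering single entries by k, that is as multiplication by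
  \<open>p\<^sub>k[Z]\<close>. So skewing by G becomes multiplication by G[Z].\<close>

lemma skew_shifts:
  "\<exists>C. (\<forall>(c, \<alpha>)\<in>set C. length \<alpha> = n) \<and>
       (\<forall>\<nu>. length \<nu> = n \<longrightarrow> skew G (bl \<nu> 1) = shifts C (\<lambda>\<nu>. bl \<nu> 1) \<nu>)"
proof (induction G rule: psum_poly_induct)
  case (const c)
  have "sub \<nu> (replicate (length \<nu>) 0) = \<nu>" for \<nu>
    by (intro nth_equalityI) (auto simp: sub_def)
  then show ?case by (intro exI[of _ "[(c, replicate n 0)]"]) auto
next
  case (add f g)
  then obtain C C' where "\<forall>(c, \<alpha>)\<in>set C. length \<alpha> = n" "\<forall>(c, \<alpha>)\<in>set C'. length \<alpha> = n"
    "\<And>\<nu>. length \<nu> = n \<Longrightarrow> skew f (bl \<nu> 1) = shifts C (\<lambda>\<nu>. bl \<nu> 1) \<nu>"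
    "\<And>\<nu>. length \<nu> = n \<Longrightarrow> skew g (bl \<nu> 1) = shifts C' (\<lambda>\<nu>. bl \<nu> 1) \<nu>" by blast
  then show ?case by (intro exI[of _ "C @ C'"]) (auto simp: skew_add_left shifts_append)
next
  case (psum k f)
  then obtain C where C: "\<forall>(c, \<alpha>)\<in>set C. length \<alpha> = n"
    "\<And>\<nu>. length \<nu> = n \<Longrightarrow> skew f (bl \<nu> 1) = shifts C (\<lambda>\<nu>. bl \<nu> 1) \<nu>" by blast
  let ?C = "concat (map (\<lambda>(c, \<alpha>). map (\<lambda>i. (c, bump \<alpha> i (int k))) [0..<n]) C)"
  have "D k (shifts C' (\<lambda>\<nu>. bl \<nu> 1) \<nu>) =
      shifts (concat (map (\<lambda>(c, \<alpha>). map (\<lambda>i. (c, bump \<alpha> i (int k))) [0..<n]) C')) (\<lambda>\<nu>. bl \<nu> 1) \<nu>"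
    if "\<forall>(c, \<alpha>)\<in>set C'. length \<alpha> = n" "length \<nu> = n" for C' \<nu>
    using that
  proof (induction C')
    case (Cons x C')
    obtain c \<alpha> where x: "x = (c, \<alpha>)" by (cases x)
    have l: "length \<alpha> = n" using Cons.prems x by auto
    have "D k (bl (sub \<nu> \<alpha>) 1) = (\<Sum>i<n. bl (bump (sub \<nu> \<alpha>) i (- int k)) 1)"
      using psum(1) l Cons.prems by (simp add: D_bl linop_0[OF linop_bl])
    also have "\<dots> = (\<Sum>i<n. bl (sub \<nu> (bump \<alpha> i (int k))) 1)"
      by (intro sum.cong refl) (subst sub_bump_right, use l Cons.prems in auto)
    finally have "D k (bl (sub \<nu> \<alpha>) 1) = (\<Sum>i<n. bl (sub \<nu> (bump \<alpha> i (int k))) 1)" .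
    moreover have "shifts (map (\<lambda>i. (c, bump \<alpha> i (int k))) [0..<n]) (\<lambda>\<nu>. bl \<nu> 1) \<nu>
        = const c * (\<Sum>i<n. bl (sub \<nu> (bump \<alpha> i (int k))) 1)"
      by (simp add: shifts_def comp_def sum_list_const_mult interv_sum_list_conv_sum_set_nat atLeast0LessThan
          sum_distrib_left)
    ultimately show ?case using Cons x by (simp add: D_add D_const_mult shifts_append)
  qed simp
  moreover have "\<forall>(c, \<alpha>)\<in>set ?C. length \<alpha> = n" using C(1) by auto
  ultimately show ?case
    using psum(1) C by (intro exI[of _ ?C]) (simp add: skew_mult skew_psum)
qed

text \<open>Plays the role of G[Z] in n variables. It does not depend on \<nu>, so it can be applied
  to operator families as well.\<close>

definition skew_comb :: "nat \<Rightarrow> sym \<Rightarrow> (coeff \<times> int list) list" where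
  "skew_comb n G = (SOME C. (\<forall>(c, \<alpha>)\<in>set C. length \<alpha> = n) \<and>
       (\<forall>\<nu>. length \<nu> = n \<longrightarrow> skew G (bl \<nu> 1) = shifts C (\<lambda>\<nu>. bl \<nu> 1) \<nu>))"

lemma skew_comb:
  "\<forall>(c, \<alpha>)\<in>set (skew_comb n G). length \<alpha> = n"
  "length \<nu> = n \<Longrightarrow> skew G (bl \<nu> 1) = shifts (skew_comb n G) (\<lambda>\<nu>. bl \<nu> 1) \<nu>"
  using someI_ex[OF skew_shifts[of n G]] unfolding skew_comb_def by blast+

text \<open>Multiplying the generating series by a polynomial in Z commutes with
  \<open>p\<^sub>k[X]\<close>, \<open>p\<^sub>k[Z]\<close> and
  \<open>p\<^sub>k[Z\<^sup>-\<^sup>1]\<close>.\<close>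

lemma commutes_shifts:
  assumes "commutes n x y W" "\<forall>(c, \<alpha>)\<in>set C. length \<alpha> = n"
  shows "commutes n x y (\<lambda>\<nu> P. shifts C (\<lambda>\<nu>. W \<nu> P) \<nu>)"
  using assms(2)
proof (induction C)
  case Nil
  show ?case by (simp add: commutes_def)
next
  case (Cons z C)
  obtain c \<alpha> where z: "z = (c, \<alpha>)" by (cases z)
  have l: "length \<alpha> = n" using Cons.prems z by auto
  have IH: "commutes n x y (\<lambda>\<nu> P. shifts C (\<lambda>\<nu>. W \<nu> P) \<nu>)" using Cons by auto
  show ?case
    unfolding commutes_def
  proof (intro allI impI)
    fix k :: nat and \<nu> :: "int list" and P
    assume k: "1 \<le> k" and n: "length \<nu> = n"
    have f1: "W (sub \<nu> \<alpha>) (psum k * P) = psum k * W (sub \<nu> \<alpha>) P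
      - const (x k) * (\<Sum>i<n. W (sub (bump \<nu> i (int k)) \<alpha>) P)
       - const (y k) * (\<Sum>i<n. W (sub (bump \<nu> i (- int k)) \<alpha>) P)"
    proof -
      have "(\<Sum>i<n. W (bump (sub \<nu> \<alpha>) i a) P) = (\<Sum>i<n. W (sub (bump \<nu> i a) \<alpha>) P)" for a
        by (intro sum.cong refl) (subst sub_bump, use l n in auto)
      moreover have "length (sub \<nu> \<alpha>) = n" using l n by simp
      ultimately show ?thesis
        using assms(1)[unfolded commutes_def, rule_format, OF k, of "sub \<nu> \<alpha>" P] by (simp only:)
    qed
    have f2: "shifts C (\<lambda>\<nu>. W \<nu> (psum k * P)) \<nu> = psum k * shifts C (\<lambda>\<nu>. W \<nu> P) \<nu>
      - const (x k) * (\<Sum>i<n. shifts C (\<lambda>\<nu>. W \<nu> P) (bump \<nu> i (int k)))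
      - const (y k) * (\<Sum>i<n. shifts C (\<lambda>\<nu>. W \<nu> P) (bump \<nu> i (- int k)))"
      using IH k n unfolding commutes_def by blast
    show "shifts (z # C) (\<lambda>\<nu>. W \<nu> (psum k * P)) \<nu> = psum k * shifts (z # C) (\<lambda>\<nu>. W \<nu> P) \<nu>
      - const (x k) * (\<Sum>i<n. shifts (z # C) (\<lambda>\<nu>. W \<nu> P) (bump \<nu> i (int k)))
      - const (y k) * (\<Sum>i<n. shifts (z # C) (\<lambda>\<nu>. W \<nu> P) (bump \<nu> i (- int k)))"
      unfolding z shifts_simps sum.distrib sum_distrib_left[symmetric] f1 f2 by (simp add: algebra_simps)
  qed
qed

lemma commutes_scale:
  "commutes n x y W \<Longrightarrow> commutes n x y (\<lambda>\<nu> P. const c * W \<nu> P)"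
  unfolding commutes_def
proof (intro allI impI)
  fix k :: nat and \<nu> :: "int list" and P
  assume W: "\<forall>k\<ge>1. \<forall>\<nu> P. length \<nu> = n \<longrightarrow> W \<nu> (psum k * P) = psum k * W \<nu> P - const (x k) * (\<Sum>i<n. W (bump \<nu> i (int k)) P)
       - const (y k) * (\<Sum>i<n. W (bump \<nu> i (- int k)) P)" and k: "1 \<le> k" and n: "length \<nu> = n"
  have "W \<nu> (psum k * P) = psum k * W \<nu> P - const (x k) * (\<Sum>i<n. W (bump \<nu> i (int k)) P)
       - const (y k) * (\<Sum>i<n. W (bump \<nu> i (- int k)) P)" using W k n by blast
  then show "const c * W \<nu> (psum k * P) = psum k * (const c * W \<nu> P) - const (x k) * (\<Sum>i<n. const c * W (bump \<nu> i (int k)) P)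
       - const (y k) * (\<Sum>i<n. const c * W (bump \<nu> i (- int k)) P)"
    by (simp only: sum_distrib_left[symmetric] right_diff_distrib mult.left_commute)
qed

lemma commutes_sum:
  assumes "\<And>l. l \<in> A \<Longrightarrow> commutes n x y (W l)"
  shows "commutes n x y (\<lambda>\<nu> P. \<Sum>l\<in>A. W l \<nu> P)"
  unfolding commutes_def
proof (intro allI impI)
  fix k :: nat and \<nu> :: "int list" and P
  assume k: "1 \<le> k" and n: "length \<nu> = n"
  have "(\<Sum>l\<in>A. W l \<nu> (psum k * P)) = (\<Sum>l\<in>A. psum k * W l \<nu> P - const (x k) * (\<Sum>i<n. W l (bump \<nu> i (int k)) P)
       - const (y k) * (\<Sum>i<n. W l (bump \<nu> i (- int k)) P))"
    using assms k n unfolding commutes_def by (intro sum.cong) blast+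
  also have "\<dots> = psum k * (\<Sum>l\<in>A. W l \<nu> P) - const (x k) * (\<Sum>l\<in>A. \<Sum>i<n. W l (bump \<nu> i (int k)) P)
       - const (y k) * (\<Sum>l\<in>A. \<Sum>i<n. W l (bump \<nu> i (- int k)) P)"
    by (simp add: sum_subtractf sum_distrib_left)
  finally show "(\<Sum>l\<in>A. W l \<nu> (psum k * P)) = psum k * (\<Sum>l\<in>A. W l \<nu> P)
       - const (x k) * (\<Sum>i<n. \<Sum>l\<in>A. W l (bump \<nu> i (int k)) P)
       - const (y k) * (\<Sum>i<n. \<Sum>l\<in>A. W l (bump \<nu> i (- int k)) P)"
    by (simp only: sum.swap[of _ _ A])
qed

section \<open>The operator identity\<close>

lemma D_eq_0_imp:
  fixes f :: sym
  assumes "homogeneous n f" "n > 0" "\<And>k. k \<ge> 1 \<Longrightarrow> D k f = 0"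
  shows "f = 0"
proof (rule form_nondegenerate)
  fix u show "form f u = form 0 u"
    by (induction u rule: psum_poly_induct)
      (use assms form_homogeneous[OF assms(1) homogeneous_const] in
        \<open>auto simp: form_add_right form_D[symmetric]\<close>)
qed

text \<open>The substitution of tX for X, by degree. Both sides have the same image under every
  \<open>D k\<close> by induction, and a homogeneous element of positive degree annihilated by all
  \<open>D k\<close> is 0.\<close>

lemma Omega_ft: "fps_nth (Omega (quad_f tt d)) n = const (tt ^ n) * fps_nth (Omega (f_symb d)) n"
proof (induction n rule: less_induct)
  case (less n)
  let ?F = "Omega (quad_f tt d)" and ?G = "Omega (f_symb d)"
  show ?case
  proof (cases "n = 0")
    case False
    have "fps_nth ?F n - const (tt ^ n) * fps_nth ?G n = 0"
    proof (rule D_eq_0_imp)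
      have "homogeneous n (fps_nth ?F n + const (- (tt ^ n)) * fps_nth ?G n)"
        by (intro homogeneous_add homogeneous_const_mult homogeneous_Omega)
      then show "homogeneous n (fps_nth ?F n - const (tt ^ n) * fps_nth ?G n)" by (simp add: const_minus)
      fix k :: nat assume k: "k \<ge> 1"
      have "D k (fps_nth ?F n) = (if 2 * k \<le> n then const (aa d * qq ^ k) * psum k * fps_nth ?F (n - 2 * k) else 0) +
         (if k \<le> n then const (bb d k * tt ^ k) * fps_nth ?F (n - k) else 0)"
        using quadratic_Omega[OF log_quadratic_ft] k by (simp add: quadratic_def)
      also have "\<dots> = (if 2 * k \<le> n then const (aa d * qq ^ k * tt ^ (n - 2 * k)) * (psum k * fps_nth ?G (n - 2 * k)) else 0) +
         (if k \<le> n then const (bb d k * tt ^ k * tt ^ (n - k)) * fps_nth ?G (n - k) else 0)"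
        using k less[of "n - k"] less[of "n - 2 * k"] by (simp add: const_mult mult_ac)
      also have "\<dots> = const (tt ^ n) * ((if 2 * k \<le> n then const (aa d) * psum k * fps_nth ?G (n - 2 * k) else 0) +
         (if k \<le> n then const (bb d k) * fps_nth ?G (n - k) else 0))"
      proof -
        have "aa d * qq ^ k * tt ^ (n - 2 * k) = tt ^ n * aa d" if "2 * k \<le> n"
          using that by (simp add: power_mult[symmetric] mult.assoc power_add[symmetric] mult.commute)
        then have A: "const (aa d * qq ^ k * tt ^ (n - 2 * k)) * (psum k * X) = const (tt ^ n) * (const (aa d) * psum k * X)"
          if "2 * k \<le> n" for X using that by (simp only: const_mult mult.assoc)
        have "bb d k * tt ^ k * tt ^ (n - k) = tt ^ n * bb d k" if "k \<le> n"
          using that by (simp add: mult.assoc power_add[symmetric] mult.commute)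
        then have B: "const (bb d k * tt ^ k * tt ^ (n - k)) * X = const (tt ^ n) * (const (bb d k) * X)"
          if "k \<le> n" for X using that by (simp only: const_mult mult.assoc)
        show ?thesis
          by (cases "2 * k \<le> n"; cases "k \<le> n"; simp only: A B if_True if_False distrib_left mult_zero_right)
      qed
      also have "\<dots> = const (tt ^ n) * D k (fps_nth ?G n)"
        using quadratic_Omega_f[of d] k by (simp add: quadratic_def)
      finally show "D k (fps_nth ?F n - const (tt ^ n) * fps_nth ?G n) = 0"
        by (simp add: D_diff D_const_mult)
    qed (use False in simp)
    then show ?thesis by simp
  qed simp
qed

definition symb_partitions_upto :: "symb \<Rightarrow> nat \<Rightarrow> nat list set" where
  "symb_partitions_upto d M = {\<mu> \<in> symb_partitions d. sum_list \<mu> \<le> M}"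

lemma symb_partitions_upto_eq: "symb_partitions_upto d M = (\<Union>m\<le>M. symb_partitions_of d m)"
  by (auto simp: symb_partitions_upto_def symb_partitions_of_def)

lemma finite_symb_partitions_upto: "finite (symb_partitions_upto d M)"
  by (simp add: symb_partitions_upto_eq finite_symb_partitions_of)

text \<open>The coefficient with index \<open>\<nu>\<close> of \<open>\<Omega>[f[tZ]]\<close> times the generating series of the
  \<open>t\<close>-analogues of \<open>B\<^sup>d\<close>, truncated at degree \<open>M\<close> in \<open>Z\<close>.\<close>

definition H_sum :: "symb \<Rightarrow> nat \<Rightarrow> nat \<Rightarrow> int list \<Rightarrow> sym \<Rightarrow> sym" where
  "H_sum d n M \<nu> P = (\<Sum>\<mu>\<in>symb_partitions_upto d M. const (tt ^ sum_list \<mu>) *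
      shifts (skew_comb n (sch \<mu>)) (\<lambda>\<nu>. TA (B_symb d \<nu>) P) \<nu>)"

lemma commutes_H_sum: "commutes n (\<lambda>k. 1 - qq ^ k) (\<lambda>k. (1 - qq ^ k) * aa d) (H_sum d n M)"
  unfolding H_sum_def[abs_def]
  by (intro commutes_sum commutes_scale commutes_shifts commutes_TA_B_symb skew_comb(1))

lemma series_perp_Omega_1: "series_perp (Omega A) 1 = 1"
  using homogeneous_dle[OF homogeneous_1] by (subst series_perp_eq[of _ 0 _ "{0}"]) (auto simp: graded_Omega)

lemma dle_bl: "dle N P \<Longrightarrow> dle (N + sum_list \<nu>) (bl \<nu> P)"
proof (induction \<nu>)
  case (Cons r \<nu>)
  from dle_bern[OF Cons.IH[OF Cons.prems], of r] show ?case by (simp add: add_ac)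
qed simp

text \<open>At 1 only the left conjugating series is felt. It is split so that \<Omega>[f[tX]] meets
  \<open>bl \<nu> 1\<close> first, where skewing is a combination of shifts; \<Omega>[-f] then
  produces the values of the operators \<open>B_symb\<close>. The bound on M is the degree of
  \<open>bl \<nu> 1\<close>.\<close>

lemma H_op_1:
  assumes n: "length \<nu> = n" and M: "int M \<ge> sum_list \<nu>"
  shows "H_op d \<nu> 1 = H_sum d n M \<nu> 1"
proof -
  let ?f = "f_symb d" and ?ft = "quad_f tt d"
  let ?b = "\<lambda>\<nu>. bl \<nu> 1"
  have B1: "TA (B_symb d \<nu>) 1 = series_perp (Omega (- ?f)) (?b \<nu>)" for \<nu>
    by (simp add: TA_1 B_symb_def B_op_eq series_perp_Omega_1)
  have "dle (sum_list \<nu>) (?b \<nu>)"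
    using dle_bl[OF homogeneous_dle[OF homogeneous_1], of \<nu>] by simp
  then have d: "dle (int M) (?b \<nu>)" using M by (rule dle_mono)
  have "H_op d \<nu> 1 = series_perp (Omega (?ft - ?f)) (?b \<nu>)"
    by (simp add: H_op_def Let_def pleth_f_symb B_op_eq series_perp_Omega_1 TA_1)
  also have "Omega (?ft - ?f) = Omega (- ?f) * Omega ?ft"
    using Omega_add[of "- ?f" ?ft] by simp
  also have "series_perp (Omega (- ?f) * Omega ?ft) (?b \<nu>) = series_perp (Omega (- ?f)) (series_perp (Omega ?ft) (?b \<nu>))"
    by (intro series_perp_mult graded_Omega)
  also have "series_perp (Omega ?ft) (?b \<nu>) = (\<Sum>m\<le>M. skew (fps_nth (Omega ?ft) m) (?b \<nu>))"
    by (rule series_perp_eq[OF graded_Omega d]) auto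
  also have "\<dots> = (\<Sum>m\<le>M. \<Sum>\<mu>\<in>symb_partitions_of d m. const (tt ^ sum_list \<mu>) * skew (sch \<mu>) (?b \<nu>))"
    unfolding Omega_ft littlewood skew_const_mult_left skew_sum_left sum_distrib_left
    by (intro sum.cong) (auto simp: symb_partitions_of_def)
  also have "\<dots> = (\<Sum>\<mu>\<in>symb_partitions_upto d M. const (tt ^ sum_list \<mu>) * skew (sch \<mu>) (?b \<nu>))"
    unfolding symb_partitions_upto_eq
    by (rule sum.UNION_disjoint[symmetric])
      (simp_all add: finite_symb_partitions_of, auto simp: symb_partitions_of_def)
  also have "\<dots> = (\<Sum>\<mu>\<in>symb_partitions_upto d M. const (tt ^ sum_list \<mu>) * shifts (skew_comb n (sch \<mu>)) ?b \<nu>)"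
    using skew_comb(2)[OF n] by simp
  also have "series_perp (Omega (- ?f)) \<dots> = H_sum d n M \<nu> 1"
    unfolding H_sum_def B1
    by (simp only: linop_sum[OF linop_series_perp[OF graded_Omega]]
        linop_const_mult[OF linop_series_perp[OF graded_Omega]]
        linop_shifts[OF linop_series_perp[OF graded_Omega]])
  finally show ?thesis .
qed

lemma sum_list_bump: "i < length \<nu> \<Longrightarrow> sum_list (bump \<nu> i k) = sum_list \<nu> + k"
  by (induction \<nu> arbitrary: i) (auto simp: nth_Cons split: nat.splits)

lemma linop_H_sum: "linop (H_sum d n M \<nu>)"
proof -
  have "shifts C (\<lambda>\<nu>. TA (B_symb d \<nu>) (P + Q)) \<nu> = shifts C (\<lambda>\<nu>. TA (B_symb d \<nu>) P) \<nu> + shifts C (\<lambda>\<nu>. TA (B_symb d \<nu>) Q) \<nu>"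
    "shifts C (\<lambda>\<nu>. TA (B_symb d \<nu>) (const c * P)) \<nu> = const c * shifts C (\<lambda>\<nu>. TA (B_symb d \<nu>) P) \<nu>" for C P Q c
    by (induction C) (auto simp: linop_add[OF linop_TA] linop_const_mult[OF linop_TA] distrib_left mult.left_commute)
  then show ?thesis
    by (simp add: linop_def H_sum_def distrib_left sum.distrib sum_distrib_left mult.left_commute)
qed

text \<open>N depends on P but not on \<nu>. Commuting with \<open>p\<^sub>k\<close> changes |\<nu>|
  by k in either direction, so N grows by k.\<close>

lemma H_op_eq_H_sum:
  "\<exists>N. \<forall>\<nu> M. length \<nu> = n \<longrightarrow> int M \<ge> sum_list \<nu> + N \<longrightarrow> H_op d \<nu> P = H_sum d n M \<nu> P"
proof (induction P rule: psum_poly_induct)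
  case (const c)
  show ?case
  proof (intro exI[of _ 0] allI impI)
    fix \<nu> M assume "length \<nu> = n" "int M \<ge> sum_list \<nu> + 0"
    then have "H_op d \<nu> 1 = H_sum d n M \<nu> 1" by (intro H_op_1) auto
    then show "H_op d \<nu> (const c) = H_sum d n M \<nu> (const c)"
      using linop_const_mult[OF linop_H_op, of d \<nu> c 1] linop_const_mult[OF linop_H_sum, of d n M \<nu> c 1] by simp
  qed
next
  case (add P Q)
  then obtain N N' where *: "\<And>\<nu> M. length \<nu> = n \<Longrightarrow> int M \<ge> sum_list \<nu> + N \<Longrightarrow> H_op d \<nu> P = H_sum d n M \<nu> P"
    "\<And>\<nu> M. length \<nu> = n \<Longrightarrow> int M \<ge> sum_list \<nu> + N' \<Longrightarrow> H_op d \<nu> Q = H_sum d n M \<nu> Q" by blast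
  then show ?case
    unfolding linop_add[OF linop_H_op] linop_add[OF linop_H_sum]
  proof (intro exI[of _ "max N N'"] allI impI)
    fix \<nu> M assume "length \<nu> = n" "int M \<ge> sum_list \<nu> + max N N'"
    then show "H_op d \<nu> P + H_op d \<nu> Q = H_sum d n M \<nu> P + H_sum d n M \<nu> Q"
      using *(1)[of \<nu> M] *(2)[of \<nu> M] by simp
  qed
next
  case (psum k P)
  then obtain N where N: "\<And>\<nu> M. length \<nu> = n \<Longrightarrow> int M \<ge> sum_list \<nu> + N \<Longrightarrow> H_op d \<nu> P = H_sum d n M \<nu> P" by blast
  show ?case
  proof (intro exI[of _ "N + int k"] allI impI)
    fix \<nu> :: "int list" and M assume n: "length \<nu> = n" and M: "int M \<ge> sum_list \<nu> + (N + int k)"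
    have "H_op d (bump \<nu> i (int k)) P = H_sum d n M (bump \<nu> i (int k)) P"
      "H_op d (bump \<nu> i (- int k)) P = H_sum d n M (bump \<nu> i (- int k)) P" if "i < n" for i
      using that n M sum_list_bump[of i \<nu> "int k"] sum_list_bump[of i \<nu> "- int k"] by (intro N; simp)+
    then have "(\<Sum>i<n. H_op d (bump \<nu> i (int k)) P) = (\<Sum>i<n. H_sum d n M (bump \<nu> i (int k)) P)"
      "(\<Sum>i<n. H_op d (bump \<nu> i (- int k)) P) = (\<Sum>i<n. H_sum d n M (bump \<nu> i (- int k)) P)"
      by (auto intro: sum.cong)
    moreover have "H_op d \<nu> P = H_sum d n M \<nu> P" using n M by (intro N) auto
    ultimately show "H_op d \<nu> (psum k * P) = H_sum d n M \<nu> (psum k * P)"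
      by (simp only: commutes_H_op[of n d, unfolded commutes_def, rule_format, OF psum(1) n]
          commutes_H_sum[of n d M, unfolded commutes_def, rule_format, OF psum(1) n])
  qed
qed

section \<open>Littlewood--Richardson coefficients\<close>

lemma alternating_TA_B_symb: "alternating n (\<lambda>\<nu>. TA (B_symb d \<nu>) P)"
  unfolding alternating_def
proof safe
  fix xs r s ys
  have "bl (xs @ r # s # ys) Q = - bl (xs @ (s - 1) # (r + 1) # ys) Q" for Q
    using alternating_bl[of "length (xs @ r # s # ys)" Q] unfolding alternating_def by blast
  then have "B_symb d (xs @ r # s # ys) = (\<lambda>P. - B_symb d (xs @ (s - 1) # (r + 1) # ys) P)"
    by (simp only: B_symb_def B_op_eq comp_def linop_uminus[OF linop_series_perp[OF graded_Omega]])
  then show "TA (B_symb d (xs @ r # s # ys)) P = - TA (B_symb d (xs @ (s - 1) # (r + 1) # ys)) P"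
    by (simp only: TA_op_uminus)
qed

abbreviation lower :: "int \<Rightarrow> int list \<Rightarrow> int list" where
  "lower a \<equiv> map (\<lambda>x. x - a)"

lemma alternating_lower_bl: "alternating n (\<lambda>\<nu>. bl (lower a \<nu>) 1)"
  unfolding alternating_def
proof safe
  fix xs r s ys
  show "bl (lower a (xs @ r # s # ys)) 1 = - bl (lower a (xs @ (s - 1) # (r + 1) # ys)) 1"
    using alternating_bl[of "length (xs @ r # s # ys)" 1, unfolded alternating_def, rule_format,
        of "lower a xs" "r - a" "s - a" "lower a ys"]
    by (simp add: algebra_simps)
qed

lemma shifts_straighten:
  assumes "\<forall>(c, \<alpha>)\<in>set C. length \<alpha> = n" "length \<nu> = n"
  shows "\<exists>C'. (\<forall>(c, \<gamma>)\<in>set C'. length \<gamma> = n \<and> sorted_wrt (\<ge>) \<gamma>) \<and>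
     (\<forall>b. alternating n b \<longrightarrow> shifts C b \<nu> = (\<Sum>(c, \<gamma>)\<leftarrow>C'. const c * b \<gamma>))"
  using assms(1)
proof (induction C)
  case Nil
  show ?case by (intro exI[of _ "[]"]) simp
next
  case (Cons z C)
  obtain c \<alpha> where z: "z = (c, \<alpha>)" by (cases z)
  from Cons obtain C' where C': "\<forall>(c, \<gamma>)\<in>set C'. length \<gamma> = n \<and> sorted_wrt (\<ge>) \<gamma>"
    "\<And>b. alternating n b \<Longrightarrow> shifts C b \<nu> = (\<Sum>(c, \<gamma>)\<leftarrow>C'. const c * b \<gamma>)" by auto
  have l: "length (sub \<nu> \<alpha>) = n" using Cons.prems z assms(2) by auto
  obtain e \<gamma> where e: "length \<gamma> = n" "sorted_wrt (\<ge>) \<gamma>" "\<And>b. alternating n b \<Longrightarrow> b (sub \<nu> \<alpha>) = const e * b \<gamma>"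
    using straighten[of "sub \<nu> \<alpha>"] unfolding l by blast
  show ?case
    by (intro exI[of _ "(c * e, \<gamma>) # C'"]) (use C' e z in \<open>auto simp: const_mult mult.assoc\<close>)
qed

lemma sum_list_collect:
  assumes "finite S" "snd ` set C \<subseteq> S"
  shows "(\<Sum>(c, \<gamma>)\<leftarrow>C. const c * b \<gamma>) =
    (\<Sum>\<gamma>\<in>S. const (\<Sum>(c, \<gamma>')\<leftarrow>C. if \<gamma>' = \<gamma> then c else 0) * (b \<gamma> :: sym))"
  using assms(2)
proof (induction C)
  case (Cons z C)
  obtain c \<delta> where z: "z = (c, \<delta>)" by (cases z)
  have "(\<Sum>\<gamma>\<in>S. const (if \<delta> = \<gamma> then c else 0) * b \<gamma>) = (\<Sum>\<gamma>\<in>S. if \<delta> = \<gamma> then const c * b \<delta> else 0)"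
    by (intro sum.cong) auto
  also have "\<dots> = const c * b \<delta>" using assms(1) Cons.prems z by simp
  finally show ?case using Cons z by (simp add: const_add distrib_right sum.distrib)
qed simp

lemma sorted_lower: "sorted_wrt (\<ge>) \<gamma> \<Longrightarrow> sorted_wrt (\<ge>) (lower a \<gamma>)"
  by (simp add: sorted_wrt_map)

lemma sorted_last_le: "sorted_wrt (\<ge>) \<gamma> \<Longrightarrow> x \<in> set \<gamma> \<Longrightarrow> last \<gamma> \<le> (x :: int)"
  by (induction \<gamma>) auto

lemma strip_inject:
  assumes "length \<gamma> = length \<delta>" "\<forall>x\<in>set \<gamma>. x \<ge> 0" "\<forall>x\<in>set \<delta>. x \<ge> 0"
    "sorted_wrt (\<ge>) \<gamma>" "sorted_wrt (\<ge>) \<delta>" "strip \<gamma> = strip \<delta>"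
  shows "\<gamma> = (\<delta> :: int list)"
  using assms
proof (induction \<gamma> \<delta> rule: list_induct2)
  case (Cons x \<gamma> y \<delta>)
  have z: "strip \<mu> = []" if "\<forall>z\<in>set \<mu>. (0::int) \<le> z \<and> z \<le> 0" for \<mu>
    using that by (auto simp: strip_def filter_empty_conv)
  consider "x = 0" "y = 0" | "x = 0" "y > 0" | "x > 0" "y = 0" | "x > 0" "y > 0"
    using Cons.prems by force
  then show ?case
  proof cases
    case 1
    then show ?thesis using Cons by (simp add: strip_def)
  next
    case 2
    then have "strip (x # \<gamma>) = []" using Cons.prems by (intro z) auto
    then show ?thesis using 2 Cons.prems by (simp add: strip_def)
  next
    case 3
    then have "strip (y # \<delta>) = []" using Cons.prems by (intro z) auto
    then show ?thesis using 3 Cons.prems by (simp add: strip_def)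
  next
    case 4
    then show ?thesis using Cons by (simp add: strip_def)
  qed
qed simp

lemma form_bl_dominant:
  assumes "length \<gamma> = length \<delta>" "sorted_wrt (\<ge>) \<gamma>" "sorted_wrt (\<ge>) \<delta>" "\<forall>x\<in>set \<delta>. x \<ge> 0"
  shows "form (bl \<gamma> 1) (bl \<delta> 1) = (if \<gamma> = \<delta> then 1 else 0)"
proof (cases "\<forall>x\<in>set \<gamma>. x \<ge> 0")
  case True
  then show ?thesis
    using assms strip_partition[of \<gamma>] strip_partition[of \<delta>] strip_inject[of \<gamma> \<delta>] form_sch by auto
next
  case False
  then show ?thesis using assms bl_negative[of \<gamma>] by (auto simp: not_le)
qed

lemma lower_inject: "lower a \<gamma> = lower a \<delta> \<longleftrightarrow> \<gamma> = \<delta>"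
  by (auto simp: inj_map_eq_map inj_def)

lemma sub_lower: "length \<alpha> = length \<nu> \<Longrightarrow> sub (lower a \<nu>) \<alpha> = lower a (sub \<nu> \<alpha>)"
  by (intro nth_equalityI) (auto simp: sub_def)

definition LRc :: "nat list \<Rightarrow> nat list \<Rightarrow> int list \<Rightarrow> coeff" where
  "LRc \<mu> \<kappa> \<gamma> = LR (shift_last \<gamma> (map int \<mu>)) \<kappa> (shift_last \<gamma> \<gamma>)"

lemma sorted_partition: "is_partition \<mu> \<Longrightarrow> sorted_wrt (\<ge>) (map int \<mu>)"
  by (simp add: is_partition_def sorted_wrt_map)

text \<open>Skewing moves the factor \<open>sch \<kappa>\<close> to the other side of the form. If a
  lowered entry of \<mu> is negative, \<open>bl\<close> at the lowered \<mu> is 0, in agreement with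
  the convention for the coefficient.\<close>

lemma LRc_eq_form:
  assumes \<mu>: "is_partition \<mu>" and \<gamma>: "sorted_wrt (\<ge>) \<gamma>"
  shows "LRc \<mu> \<kappa> \<gamma> = form (skew (sch \<kappa>) (bl (lower (last \<gamma>) (map int \<mu>)) 1)) (bl (lower (last \<gamma>) \<gamma>) 1)"
proof -
  let ?a = "last \<gamma>" let ?\<mu> = "lower ?a (map int \<mu>)" let ?\<gamma> = "lower ?a \<gamma>"
  have s: "sorted_wrt (\<ge>) ?\<mu>" "sorted_wrt (\<ge>) ?\<gamma>"
    using sorted_lower[OF sorted_partition[OF \<mu>]] sorted_lower[OF \<gamma>] by auto
  have "\<forall>x\<in>set ?\<gamma>. x \<ge> 0" using sorted_last_le[OF \<gamma>] by auto
  then have g: "bl ?\<gamma> 1 = sch (strip ?\<gamma>)" using strip_partition[OF s(2)] by simp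
  show ?thesis
  proof (cases "\<exists>x\<in>set ?\<mu>. x < 0")
    case True
    then show ?thesis using bl_negative[OF s(1)] by (simp add: LRc_def LR_def shift_last_def)
  next
    case False
    then have "is_partition (strip ?\<mu>)" "bl ?\<mu> 1 = sch (strip ?\<mu>)"
      using strip_partition[OF s(1)] by (auto simp: not_less)
    then show ?thesis
      using False g by (simp add: LRc_def LR_def shift_last_def schur_coeff_eq schur_eq_sch form_skew)
  qed
qed

text \<open>The straightening coefficients are the same for all b. They are tested on the family
  \<open>bl (lower a \<nu>) 1\<close> with a = \<open>last \<gamma>\<close>: the lowered \<gamma>
  has nonnegative entries, so orthonormality isolates its coefficient as the pairing in
  \<open>LRc_eq_form\<close>.\<close>

lemma LR_expansion:
  assumes \<mu>: "is_partition \<mu>" "length \<mu> = n"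
  shows finite_LRc: "finite {\<gamma>. length \<gamma> = n \<and> sorted_wrt (\<ge>) \<gamma> \<and> LRc \<mu> \<kappa> \<gamma> \<noteq> 0}"
    and shifts_LRc: "alternating n b \<Longrightarrow> shifts (skew_comb n (sch \<kappa>)) b (map int \<mu>) =
      (\<Sum>\<gamma>\<in>{\<gamma>. length \<gamma> = n \<and> sorted_wrt (\<ge>) \<gamma> \<and> LRc \<mu> \<kappa> \<gamma> \<noteq> 0}. const (LRc \<mu> \<kappa> \<gamma>) * b \<gamma>)"
proof -
  let ?C = "skew_comb n (sch \<kappa>)" and ?G = "{\<gamma>. length \<gamma> = n \<and> sorted_wrt (\<ge>) \<gamma> \<and> LRc \<mu> \<kappa> \<gamma> \<noteq> 0}"
  obtain C' where C': "\<forall>(c, \<gamma>)\<in>set C'. length \<gamma> = n \<and> sorted_wrt (\<ge>) \<gamma>"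
    "\<And>b. alternating n b \<Longrightarrow> shifts ?C b (map int \<mu>) = (\<Sum>(c, \<gamma>)\<leftarrow>C'. const c * b \<gamma>)"
    using shifts_straighten[OF skew_comb(1)[of n "sch \<kappa>"], of "map int \<mu>"] \<mu>(2) by auto
  define d where "d \<gamma> = (\<Sum>(c, \<gamma>')\<leftarrow>C'. if \<gamma>' = \<gamma> then c else 0)" for \<gamma>
  have d_eq: "d \<gamma> = LRc \<mu> \<kappa> \<gamma>" if \<gamma>: "length \<gamma> = n" "sorted_wrt (\<ge>) \<gamma>" for \<gamma>
  proof -
    let ?a = "last \<gamma>" let ?b = "\<lambda>\<nu>. bl (lower ?a \<nu>) 1"
    \<comment> \<open>Including \<gamma> covers the case that it does not occur in the list, where
      its coefficient d is 0.\<close>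
    let ?S = "insert \<gamma> (snd ` set C')"
    have "skew (sch \<kappa>) (?b (map int \<mu>)) = shifts ?C (\<lambda>\<nu>. bl \<nu> 1) (lower ?a (map int \<mu>))"
      using \<mu>(2) by (intro skew_comb(2)) simp
    also have "\<dots> = shifts ?C ?b (map int \<mu>)"
      unfolding shifts_def
      using skew_comb(1)[of n "sch \<kappa>"] \<mu>(2)
      by (intro arg_cong[of _ _ sum_list] map_cong) (auto simp: sub_lower simp del: map_map)
    also have "\<dots> = (\<Sum>(c, \<gamma>)\<leftarrow>C'. const c * ?b \<gamma>)" by (rule C'(2)[OF alternating_lower_bl])
    also have "\<dots> = (\<Sum>\<delta>\<in>?S. const (d \<delta>) * ?b \<delta>)"
      unfolding d_def by (rule sum_list_collect) auto
    finally have "LRc \<mu> \<kappa> \<gamma> = (\<Sum>\<delta>\<in>?S. d \<delta> * form (?b \<delta>) (?b \<gamma>))"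
      by (simp add: LRc_eq_form[OF \<mu>(1) \<gamma>(2)] form_sum_left form_const_left del: map_map)
    also have "\<dots> = (\<Sum>\<delta>\<in>?S. if \<delta> = \<gamma> then d \<gamma> else 0)"
    proof (intro sum.cong refl)
      fix \<delta> assume "\<delta> \<in> ?S"
      then have "length \<delta> = n" "sorted_wrt (\<ge>) \<delta>" using C'(1) \<gamma> by auto
      then have "form (?b \<delta>) (?b \<gamma>) = (if lower ?a \<delta> = lower ?a \<gamma> then 1 else 0)"
        using \<gamma> sorted_last_le[OF \<gamma>(2)] by (intro form_bl_dominant sorted_lower) auto
      then show "d \<delta> * form (?b \<delta>) (?b \<gamma>) = (if \<delta> = \<gamma> then d \<gamma> else 0)"
        by (simp only: lower_inject) auto
    qed
    also have "\<dots> = d \<gamma>" by simp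
    finally show ?thesis by simp
  qed
  have d_0: "d \<gamma> = 0" if "\<gamma> \<notin> snd ` set C'" for \<gamma>
  proof -
    have "map (\<lambda>(c, \<gamma>'). if \<gamma>' = \<gamma> then c else 0) C' = map (\<lambda>_. 0) C'"
      using that by (intro map_cong) force+
    then show ?thesis unfolding d_def by (simp only: sum_list_0)
  qed
  have sub: "?G \<subseteq> snd ` set C'"
  proof
    fix \<gamma> assume "\<gamma> \<in> ?G"
    then have "d \<gamma> \<noteq> 0" using d_eq by simp
    then show "\<gamma> \<in> snd ` set C'" using d_0 by blast
  qed
  then show "finite ?G" by (rule finite_subset) simp
  assume b: "alternating n b"
  have "shifts ?C b (map int \<mu>) = (\<Sum>\<gamma>\<in>snd ` set C'. const (d \<gamma>) * b \<gamma>)"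
    unfolding C'(2)[OF b] d_def by (rule sum_list_collect) auto
  also have "\<dots> = (\<Sum>\<gamma>\<in>?G. const (d \<gamma>) * b \<gamma>)"
  proof (rule sum.mono_neutral_right)
    show "\<forall>\<gamma>\<in>snd ` set C' - ?G. const (d \<gamma>) * b \<gamma> = 0"
    proof
      fix \<gamma> assume \<gamma>: "\<gamma> \<in> snd ` set C' - ?G"
      then have "length \<gamma> = n" "sorted_wrt (\<ge>) \<gamma>" using C'(1) by auto
      then show "const (d \<gamma>) * b \<gamma> = 0" using \<gamma> d_eq[of \<gamma>] by simp
    qed
  qed (use sub in simp_all)
  also have "\<dots> = (\<Sum>\<gamma>\<in>?G. const (LRc \<mu> \<kappa> \<gamma>) * b \<gamma>)"
    by (intro sum.cong) (auto simp: d_eq)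
  finally show "shifts ?C b (map int \<mu>) = (\<Sum>\<gamma>\<in>?G. const (LRc \<mu> \<kappa> \<gamma>) * b \<gamma>)" .
qed

lemma sum_list_strip: "\<forall>x\<in>set v. x \<ge> 0 \<Longrightarrow> int (sum_list (strip v)) = sum_list v"
  by (induction v) (auto simp: strip_def)

lemma sum_list_lower: "sum_list (lower a v) = sum_list v - int (length v) * a"
  by (induction v) (auto simp: algebra_simps)

lemma LRc_degree:
  assumes "is_partition \<mu>" "length \<gamma> = length \<mu>" "sorted_wrt (\<ge>) \<gamma>" "LRc \<mu> \<kappa> \<gamma> \<noteq> 0"
  shows "sum_list \<gamma> = sum_list (map int \<mu>) - int (sum_list \<kappa>)"
proof -
  let ?a = "last \<gamma>" let ?\<mu> = "lower ?a (map int \<mu>)" let ?\<gamma> = "lower ?a \<gamma>"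
  have s: "sorted_wrt (\<ge>) ?\<mu>" "sorted_wrt (\<ge>) ?\<gamma>"
    using sorted_lower[OF sorted_partition[OF assms(1)]] sorted_lower[OF assms(3)] by auto
  have pos: "\<forall>x\<in>set ?\<gamma>. x \<ge> 0" using sorted_last_le[OF assms(3)] by auto
  have ne: "form (bl ?\<mu> 1) (sch \<kappa> * bl ?\<gamma> 1) \<noteq> 0"
    using assms(4) unfolding LRc_eq_form[OF assms(1,3)] form_skew .
  then have pos': "\<forall>x\<in>set ?\<mu>. x \<ge> 0" using bl_negative[OF s(1)] by fastforce
  have "form (sch (strip ?\<mu>)) (sch \<kappa> * sch (strip ?\<gamma>)) \<noteq> 0"
    using ne strip_partition(2)[OF s(1) pos'] strip_partition(2)[OF s(2) pos] by simp
  then have "sum_list (strip ?\<mu>) = sum_list \<kappa> + sum_list (strip ?\<gamma>)"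
    using form_homogeneous[OF homogeneous_sch homogeneous_mult[OF homogeneous_sch homogeneous_sch]] by blast
  then have "sum_list ?\<mu> = int (sum_list \<kappa>) + sum_list ?\<gamma>"
    using sum_list_strip[OF pos] sum_list_strip[OF pos'] by linarith
  then show ?thesis using assms(2) unfolding sum_list_lower by simp
qed

section \<open>The expansion of a single operator\<close>

text \<open>\<open>bl \<gamma>\<close> moves degree bounds by |\<gamma>|, and N bounds the degree in
  Y of the finitely many monomials of \<open>Delta P\<close>.\<close>

lemma TA_B_symb_eq_0: "\<exists>N. \<forall>\<gamma>. sum_list \<gamma> + N < 0 \<longrightarrow> TA (B_symb d \<gamma>) P = 0"
proof -
  define N where "N = Max (insert 0 (weight ` Poly_Mapping.keys (Delta P)))"
  have "TA (B_symb d \<gamma>) P = 0" if "sum_list \<gamma> + int N < 0" for \<gamma>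
    unfolding TA_eq act_lin_def
  proof (rule sum.neutral, rule ballI)
    fix m assume "m \<in> Poly_Mapping.keys (Delta P)"
    then have "weight m \<le> N" unfolding N_def by (intro Max_ge) auto
    then have "dle (int N) (Poly_Mapping.single m 1 :: sym)" by (simp add: dle_def)
    then have "dle (int N + sum_list \<gamma>) (bl \<gamma> (series_perp (Omega (f_symb d)) (Poly_Mapping.single m 1)))"
      by (intro dle_bl dle_series_perp graded_Omega)
    then have "bl \<gamma> (series_perp (Omega (f_symb d)) (Poly_Mapping.single m 1)) = 0"
      by (rule dle_neg) (use that in simp)
    then show "Poly_Mapping.lookup (Delta P) m * B_symb d \<gamma> (Poly_Mapping.single m 1) = 0"
      by (simp add: B_symb_def B_op_eq linop_0[OF linop_series_perp[OF graded_Omega]])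
  qed
  then show ?thesis by blast
qed

text \<open>The nonvanishing of the last factor bounds |\<gamma>| from below and thus, by
  \<open>LRc_degree\<close>, |\<kappa>| from above. This makes the set finite.\<close>

definition H_pairs :: "symb \<Rightarrow> nat list \<Rightarrow> sym \<Rightarrow> (nat list \<times> int list) set" where
  "H_pairs d \<mu> P = {(\<kappa>, \<gamma>). \<kappa> \<in> symb_partitions d \<and> length \<gamma> = length \<mu> \<and> sorted_wrt (\<ge>) \<gamma> \<and>
     LRc \<mu> \<kappa> \<gamma> \<noteq> 0 \<and> TA (B_symb d \<gamma>) P \<noteq> 0}"

lemma H_op_expansion:
  assumes \<mu>: "is_partition \<mu>"
  shows finite_H_pairs: "finite (H_pairs d \<mu> P)"
    and H_op_eq: "H_op d (map int \<mu>) P =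
      (\<Sum>(\<kappa>, \<gamma>)\<in>H_pairs d \<mu> P. const (tt ^ sum_list \<kappa> * LRc \<mu> \<kappa> \<gamma>) * TA (B_symb d \<gamma>) P)"
proof -
  let ?n = "length \<mu>" let ?R = "map int \<mu>" let ?T = "\<lambda>\<gamma>. TA (B_symb d \<gamma>) P"
  let ?G = "\<lambda>\<kappa>. {\<gamma>. length \<gamma> = ?n \<and> sorted_wrt (\<ge>) \<gamma> \<and> LRc \<mu> \<kappa> \<gamma> \<noteq> 0}"
  obtain N where N: "\<And>\<gamma>. sum_list \<gamma> + N < 0 \<Longrightarrow> ?T \<gamma> = 0" using TA_B_symb_eq_0[of d P] by blast
  obtain N' where N': "\<And>M. int M \<ge> sum_list ?R + N' \<Longrightarrow> H_op d ?R P = H_sum d ?n M ?R P"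
    using H_op_eq_H_sum[of ?n d P] by (metis length_map)
  \<comment> \<open>The first bound keeps every nonzero term below the truncation, the second makes
    the truncated sum equal to \<open>H_op\<close>.\<close>
  define M where "M = nat (max (sum_list ?R + N) (sum_list ?R + N'))"
  let ?S = "symb_partitions_upto d M"
  have sub: "H_pairs d \<mu> P \<subseteq> Sigma ?S ?G"
  proof
    fix x assume x: "x \<in> H_pairs d \<mu> P"
    obtain \<kappa> \<gamma> where k: "x = (\<kappa>, \<gamma>)" by (cases x)
    have *: "\<kappa> \<in> symb_partitions d" "length \<gamma> = ?n" "sorted_wrt (\<ge>) \<gamma>" "LRc \<mu> \<kappa> \<gamma> \<noteq> 0" "?T \<gamma> \<noteq> 0"
      using x k by (auto simp: H_pairs_def)
    have "sum_list \<gamma> + N \<ge> 0" using N[of \<gamma>] *(5) by force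
    then have "sum_list \<kappa> \<le> M" using LRc_degree[OF \<mu> *(2,3,4)] unfolding M_def by linarith
    then show "x \<in> Sigma ?S ?G" using * k by (simp add: symb_partitions_upto_def)
  qed
  have fin: "finite (Sigma ?S ?G)"
    by (intro finite_SigmaI finite_symb_partitions_upto finite_LRc \<mu> refl)
  show "finite (H_pairs d \<mu> P)" using sub fin by (rule finite_subset)
  have "H_op d ?R P = H_sum d ?n M ?R P" by (rule N') (unfold M_def, linarith)
  also have "\<dots> = (\<Sum>\<kappa>\<in>?S. \<Sum>\<gamma>\<in>?G \<kappa>. const (tt ^ sum_list \<kappa> * LRc \<mu> \<kappa> \<gamma>) * ?T \<gamma>)"
    unfolding H_sum_def shifts_LRc[OF \<mu> refl alternating_TA_B_symb] sum_distrib_left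
    by (simp only: const_mult mult.assoc)
  also have "\<dots> = (\<Sum>(\<kappa>, \<gamma>)\<in>Sigma ?S ?G. const (tt ^ sum_list \<kappa> * LRc \<mu> \<kappa> \<gamma>) * ?T \<gamma>)"
    by (intro sum.Sigma finite_symb_partitions_upto ballI finite_LRc \<mu> refl)
  also have "\<dots> = (\<Sum>(\<kappa>, \<gamma>)\<in>H_pairs d \<mu> P. const (tt ^ sum_list \<kappa> * LRc \<mu> \<kappa> \<gamma>) * ?T \<gamma>)"
    using sub fin by (intro sum.mono_neutral_right) (auto simp: H_pairs_def symb_partitions_upto_def)
  finally show "H_op d ?R P = (\<Sum>(\<kappa>, \<gamma>)\<in>H_pairs d \<mu> P. const (tt ^ sum_list \<kappa> * LRc \<mu> \<kappa> \<gamma>) * ?T \<gamma>)" .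
qed

lemma const_eq_0_iff: "const c = 0 \<longleftrightarrow> c = 0"
  using const_inject[of c 0] by (simp del: const_inject)

section \<open>Composition of the operators\<close>

definition terms :: "symb \<Rightarrow> nat list list \<Rightarrow> (nat list list \<times> int list list) set" where
  "terms d R = {(\<nu>, \<gamma>) \<in> nu_seqs d R \<times> gamma_seqs R. sum_term d R \<nu> \<gamma> \<noteq> 0}"

definition coeff_term :: "nat list list \<Rightarrow> nat list list \<Rightarrow> int list list \<Rightarrow> coeff" where
  "coeff_term R \<nu> \<gamma> = tt ^ (\<Sum>i<length R. sum_list (\<nu> ! i)) *
            (\<Prod>i<length R. LRc (R ! i) (\<nu> ! i) (\<gamma> ! i))"

lemma sum_term_eq: "sum_term d R \<nu> \<gamma> = const (coeff_term R \<nu> \<gamma>) * BB d \<gamma> qq"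
  by (simp add: sum_term_def coeff_term_def LRc_def)

lemma coeff_term_Cons: "coeff_term (\<mu> # R) (\<kappa> # \<nu>) (\<delta> # \<gamma>) = tt ^ sum_list \<kappa> * LRc \<mu> \<kappa> \<delta> * coeff_term R \<nu> \<gamma>"
  by (simp add: coeff_term_def sum.lessThan_Suc_shift prod.lessThan_Suc_shift power_add mult_ac
      del: sum.lessThan_Suc prod.lessThan_Suc)

text \<open>A nonzero term for \<mu> # R has a nonzero term for R inside, because t-analogues map 0
  to 0. Conversely, nonzero factors give a nonzero product since the rings have no zero
  divisors.\<close>

lemma terms_Cons:
  "terms d (\<mu> # R) = (\<lambda>((\<nu>, \<gamma>), (\<kappa>, \<delta>)). (\<kappa> # \<nu>, \<delta> # \<gamma>)) ` (SIGMA (\<nu>, \<gamma>):terms d R. H_pairs d \<mu> (BB d \<gamma> qq))"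
  (is "_ = ?f ` ?S")
proof (rule equalityI; rule subsetI)
  fix x assume "x \<in> terms d (\<mu> # R)"
  then obtain \<nu>' \<gamma>' where x: "x = (\<nu>', \<gamma>')" and n: "\<nu>' \<in> nu_seqs d (\<mu> # R)" and g: "\<gamma>' \<in> gamma_seqs (\<mu> # R)"
    and t: "sum_term d (\<mu> # R) \<nu>' \<gamma>' \<noteq> 0" by (auto simp: terms_def)
  obtain \<kappa> \<nu> where \<nu>: "\<nu>' = \<kappa> # \<nu>" "\<kappa> \<in> symb_partitions d" "\<nu> \<in> nu_seqs d R"
    using n by (cases \<nu>') (auto simp: nu_seqs_def)
  obtain \<delta> \<gamma> where \<gamma>: "\<gamma>' = \<delta> # \<gamma>" "length \<delta> = length \<mu>" "sorted_wrt (\<ge>) \<delta>" "\<gamma> \<in> gamma_seqs R"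
    using g by (cases \<gamma>') (auto simp: gamma_seqs_def)
  have ne: "tt ^ sum_list \<kappa> * LRc \<mu> \<kappa> \<delta> * coeff_term R \<nu> \<gamma> \<noteq> 0" "TA (B_symb d \<delta>) (BB d \<gamma> qq) \<noteq> 0"
    using t \<nu> \<gamma> by (auto simp: sum_term_eq coeff_term_Cons BB_def)
  then have "BB d \<gamma> qq \<noteq> 0" using linop_0[OF linop_TA] by metis
  then have "sum_term d R \<nu> \<gamma> \<noteq> 0" using ne by (simp add: sum_term_eq const_eq_0_iff)
  then have "((\<nu>, \<gamma>), (\<kappa>, \<delta>)) \<in> ?S"
    using ne \<nu> \<gamma> by (auto simp: terms_def H_pairs_def)
  then show "x \<in> ?f ` ?S" using x \<nu>(1) \<gamma>(1) by (intro image_eqI) auto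
next
  fix x assume "x \<in> ?f ` ?S"
  then obtain \<nu> \<gamma> \<kappa> \<delta> where x: "x = (\<kappa> # \<nu>, \<delta> # \<gamma>)" and 1: "(\<nu>, \<gamma>) \<in> terms d R" and 2: "(\<kappa>, \<delta>) \<in> H_pairs d \<mu> (BB d \<gamma> qq)"
    by auto
  have "coeff_term R \<nu> \<gamma> \<noteq> 0" using 1 by (auto simp: terms_def sum_term_eq)
  then have "coeff_term (\<mu> # R) (\<kappa> # \<nu>) (\<delta> # \<gamma>) \<noteq> 0"
    using 2 by (simp add: coeff_term_Cons H_pairs_def)
  moreover have "BB d (\<delta> # \<gamma>) qq \<noteq> 0" using 2 by (simp add: BB_def H_pairs_def)
  ultimately have "sum_term d (\<mu> # R) (\<kappa> # \<nu>) (\<delta> # \<gamma>) \<noteq> 0" by (simp add: sum_term_eq const_eq_0_iff)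
  then show "x \<in> terms d (\<mu> # R)"
    using x 1 2 by (auto simp: terms_def H_pairs_def nu_seqs_def gamma_seqs_def)
qed

lemma HH_expansion:
  assumes "\<forall>\<mu>\<in>set R. is_partition \<mu>"
  shows "finite (terms d R) \<and> HH d R = (\<Sum>(\<nu>, \<gamma>)\<in>terms d R. sum_term d R \<nu> \<gamma>)"
  using assms
proof (induction R)
  case Nil
  have "terms d [] = {([], [])}"
    by (auto simp: terms_def nu_seqs_def gamma_seqs_def sum_term_eq coeff_term_def BB_def)
  then show ?case by (simp add: HH_def sum_term_eq coeff_term_def BB_def)
next
  case (Cons \<mu> R)
  then have \<mu>: "is_partition \<mu>" and fin: "finite (terms d R)"
    and IH: "HH d R = (\<Sum>(\<nu>, \<gamma>)\<in>terms d R. sum_term d R \<nu> \<gamma>)" by auto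
  let ?f = "\<lambda>((\<nu>, \<gamma>), (\<kappa>, \<delta>)). (\<kappa> # \<nu>, \<delta> # \<gamma>) :: nat list list \<times> int list list"
  let ?P = "\<lambda>x. H_pairs d \<mu> (BB d (snd x) qq)"
  let ?S = "Sigma (terms d R) ?P"
  have T: "terms d (\<mu> # R) = ?f ` ?S" unfolding terms_Cons by (auto simp: split_beta)
  have finS: "finite ?S" using fin finite_H_pairs[OF \<mu>] by (intro finite_SigmaI) auto
  have inj: "inj_on ?f ?S" by (auto simp: inj_on_def)
  have "HH d (\<mu> # R) = H_op d (map int \<mu>) (HH d R)" by (simp add: HH_def)
  also have "\<dots> = (\<Sum>x\<in>terms d R. H_op d (map int \<mu>) (const (coeff_term R (fst x) (snd x)) * BB d (snd x) qq))"
    unfolding IH linop_sum[OF linop_H_op] by (simp add: split_beta sum_term_eq)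
  also have "\<dots> = (\<Sum>x\<in>terms d R. \<Sum>y\<in>?P x. sum_term d (\<mu> # R) (fst y # fst x) (snd y # snd x))"
    unfolding linop_const_mult[OF linop_H_op] H_op_eq[OF \<mu>] sum_distrib_left sum_term_eq coeff_term_Cons
    by (intro sum.cong refl) (simp add: split_beta const_mult BB_def mult_ac)
  also have "\<dots> = (\<Sum>(x, y)\<in>?S. sum_term d (\<mu> # R) (fst y # fst x) (snd y # snd x))"
    using fin finite_H_pairs[OF \<mu>] by (intro sum.Sigma) auto
  also have "\<dots> = (\<Sum>(\<nu>, \<gamma>)\<in>terms d (\<mu> # R). sum_term d (\<mu> # R) \<nu> \<gamma>)"
    unfolding T by (subst sum.reindex[OF inj]) (simp add: split_beta comp_def)
  finally show ?case using T finS by simp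
qed

theorem theorem30:
  fixes d :: symb and R :: "nat list list"
  assumes "\<forall>\<mu>\<in>set R. is_partition \<mu>"
  shows "finite {(\<nu>, \<gamma>) \<in> nu_seqs d R \<times> gamma_seqs R. sum_term d R \<nu> \<gamma> \<noteq> 0} \<and>
         HH d R = (\<Sum>(\<nu>, \<gamma>)\<in>{(\<nu>, \<gamma>) \<in> nu_seqs d R \<times> gamma_seqs R. sum_term d R \<nu> \<gamma> \<noteq> 0}.
                     sum_term d R \<nu> \<gamma>)"
  using HH_expansion[OF assms, of d] unfolding terms_def .

end
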